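(* Let $(K,\nu)$ be a henselian valued field such that the residue field $K\nu$ is perfect. Let $(L_1/K,\nu)$ be a finite tame extension and $(L_2/K,\nu)$ a finite extension. Let $L = L_1\cdot L_2$, $L_2' = L_2\cap K^r$ and $L' = L_1\cdot L_2'$, where $K^r$ is the absolute ramification field of $(K,\nu)$. Then $(L/L_2,\nu)$ and $(L'/L_2',\nu)$ are finite tame extensions. Moreover, $(L/L_2,\nu)$ is unramified if and only if $(L'/L_2',\nu)$ is unramified.
   Context: Valuations are written additively with values in an arbitrary ordered abelian group. For a valued field $(F,\nu)$, $\nu F$ is the value group, $\mathfrak{O}_F$ the valuation ring, $F\nu$ the residue field. A valued field is henselian if its valuation extends uniquely to its algebraic closure (equivalently, Hensel's Lemma holds). For henselian $(K,\nu)$ all algebraic extensions of $K$ are taken inside a fixed algebraic closure $\overline{K}$ and carry the unique extension of $\nu$, again denoted $\nu$; they are again henselian. $F_1\cdot F_2$ denotes the compositum. The residue characteristic is $p=\operatorname{char} K\nu$ if this is positive, and $p=1$ otherwise. A finite extension $(F'/F,\nu)$ of henselian valued fields is defectless if $[F':F]=[\nu F':\nu F]\,[F'\nu:F\nu]$. An algebraic extension $(F'/F,\nu)$ of henselian valued fields is tame if for every finite subextension $F''/F$: (i) $p$ does not divide $[\nu F'':\nu F]$ (no condition when $\operatorname{char} F\nu=0$); (ii) $F''\nu/F\nu$ is separable; (iii) $(F''/F,\nu)$ is defectless. It is unramified if it is tame and $\nu F'=\nu F$. The absolute ramification group of henselian $(K,\nu)$ is $G^r=\{\sigma\in \operatorname{Aut}(\overline{K}/K)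 : \nu(\sigma x-x)>\nu(x)\ \text{for all } x\in\mathfrak{O}_{\overline{K}}\}$ (the condition being understood for $x\neq 0$), and the absolute ramification field $K^r$ is the fixed field of $G^r$ in the separable closure of $K$ in $\overline{K}$. *)

theory Defs
  imports "HOL-Algebra.Algebra"
begin

section \<open>Fields\<close>

text \<open>The additive order of 1; \<^const>\<open>group.ord\<close> is 0 for elements of infinite order.\<close>

definition field_char :: "('a, 'b) ring_scheme \<Rightarrow> nat"
  where "field_char k = group.ord (add_monoid k) \<one>\<^bsub>k\<^esub>"

definition perfect_field :: "('a, 'b) ring_scheme \<Rightarrow> bool"
  where "perfect_field k \<longleftrightarrow> field k \<and>
    (field_char k = 0 \<or> (\<forall>x\<in>carrier k. \<exists>y\<in>carrier k. y [^]\<^bsub>k\<^esub> field_char k = x))"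

text \<open>The minimal polynomial has no multiple root in the ambient field \<open>R\<close>, which has to be
  algebraically closed. Below, \<open>R\<close> is either the algebraic closure of a henselian field or the
  residue field of that closure, and the latter is algebraically closed because the former is.\<close>

definition (in ring) separable_over :: "'a set \<Rightarrow> 'a \<Rightarrow> bool"
  where "separable_over F x \<longleftrightarrow>
    (algebraic over F) x \<and> (\<forall>y\<in>carrier R. alg_mult (Irr F x) y \<le> 1)"

definition (in ring) algebraic_ext :: "'a set \<Rightarrow> 'a set \<Rightarrow> bool"
  where "algebraic_ext F E \<longleftrightarrow> subfield F R \<and> subfield E R \<and> F \<subseteq> E \<and>
    (\<forall>x\<in>E. (algebraic over F) x)"

definition (in ring) finite_ext :: "'a set \<Rightarrow> 'a set \<Rightarrow> bool"
  where "finite_ext F E \<longleftrightarrow> subfield F R \<and> subfield E R \<and> F \<subseteq> E \<and> finite_dimension F E"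

definition (in ring) separable_ext :: "'a set \<Rightarrow> 'a set \<Rightarrow> bool"
  where "separable_ext F E \<longleftrightarrow> subfield F R \<and> subfield E R \<and> F \<subseteq> E \<and>
    (\<forall>x\<in>E. separable_over F x)"


section \<open>Valued fields\<close>

text \<open>The value of zero, conventionally \<open>\<infinity>\<close>, is left unspecified; every statement about values
  treats zero separately.\<close>

locale valued_field = field R for R (structure) +
  fixes \<nu> :: "'a \<Rightarrow> 'g::linordered_ab_group_add"
  assumes val_mult: "\<lbrakk> x \<in> carrier R - {\<zero>}; y \<in> carrier R - {\<zero>} \<rbrakk> \<Longrightarrow> \<nu> (x \<otimes> y) = \<nu> x + \<nu> y"
    and val_add: "\<lbrakk> x \<in> carrier R - {\<zero>}; y \<in> carrier R - {\<zero>}; x \<oplus> y \<noteq> \<zero> \<rbrakk>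
      \<Longrightarrow> min (\<nu> x) (\<nu> y) \<le> \<nu> (x \<oplus> y)"
begin

definition value_group :: "'a set \<Rightarrow> 'g set"
  where "value_group F = \<nu> ` (F - {\<zero>})"

definition ramification_index :: "'a set \<Rightarrow> 'a set \<Rightarrow> nat"
  where "ramification_index F E =
    card (rcosets\<^bsub>\<lparr>carrier = value_group E, monoid.mult = (+), one = 0\<rparr>\<^esub> (value_group F))"

definition valuation_ring :: "'a set \<Rightarrow> 'a set"
  where "valuation_ring F = {x \<in> F. x = \<zero> \<or> 0 \<le> \<nu> x}"

definition valuation_ideal :: "'a set \<Rightarrow> 'a set"
  where "valuation_ideal F = {x \<in> F. x = \<zero> \<or> 0 < \<nu> x}"

text \<open>The residue field of the whole field \<open>R\<close> is the usual quotient. The residue field of a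
  subfield \<open>F\<close> is realised in it as the set of residues of elements of \<open>valuation_ring F\<close>
  (the image of the canonical embedding), so that residue fields of extensions are extensions.\<close>

definition residue_ring :: "'a set ring"
  where "residue_ring =
    (R\<lparr>carrier := valuation_ring (carrier R)\<rparr>) Quot (valuation_ideal (carrier R))"

definition residue_field :: "'a set \<Rightarrow> 'a set set"
  where "residue_field F = (\<lambda>x. valuation_ideal (carrier R) +> x) ` valuation_ring F"

definition residue_char :: "'a set \<Rightarrow> nat"
  where "residue_char F = field_char (residue_ring\<lparr>carrier := residue_field F\<rparr>)"

end


section \<open>Henselian fields\<close>

text \<open>\<open>R\<close> is the algebraic closure of \<open>K\<close>, and \<open>\<nu>\<close> is given on all of \<open>R\<close>. Competing extensions
  \<open>w\<close> of \<open>\<nu>\<close> from \<open>K\<close> to \<open>R\<close> may be taken with values in the same ordered group: the value group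
  of any of them is a divisible hull of the value group of \<open>K\<close>, hence isomorphic over it, as an
  ordered group, to that of \<open>(R, \<nu>)\<close>.\<close>

locale henselian = algebraic_closure R K + valued_field R \<nu>
  for R :: "('a, 'b) ring_scheme" (structure) and K and \<nu> :: "'a \<Rightarrow> 'g::linordered_ab_group_add" +
  assumes unique_extension:
    "\<lbrakk> valued_field R (w :: 'a \<Rightarrow> 'g); \<And>x. x \<in> K - {\<zero>} \<Longrightarrow> w x = \<nu> x; x \<in> carrier R - {\<zero>} \<rbrakk>
      \<Longrightarrow> w x = \<nu> x"
begin

text \<open>The second conjunct makes the residue degree meaningful; it holds for all finite extensions.\<close>

definition defectless :: "'a set \<Rightarrow> 'a set \<Rightarrow> bool"
  where "defectless F E \<longleftrightarrow> finite_ext F E \<and>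
    ring.finite_dimension residue_ring (residue_field F) (residue_field E) \<and>
    dim F E = ramification_index F E * ring.dim residue_ring (residue_field F) (residue_field E)"

definition tame :: "'a set \<Rightarrow> 'a set \<Rightarrow> bool"
  where "tame F E \<longleftrightarrow> algebraic_ext F E \<and>
    (\<forall>E'. finite_ext F E' \<and> E' \<subseteq> E \<longrightarrow>
      (residue_char F \<noteq> 0 \<longrightarrow> \<not> residue_char F dvd ramification_index F E') \<and>
      ring.separable_ext residue_ring (residue_field F) (residue_field E') \<and>
      defectless F E')"

definition unramified :: "'a set \<Rightarrow> 'a set \<Rightarrow> bool"
  where "unramified F E \<longleftrightarrow> tame F E \<and> value_group E = value_group F"

definition ramification_group :: "('a \<Rightarrow> 'a) set"
  where "ramification_group = {\<sigma> \<in> ring_iso R R. (\<forall>x\<in>K. \<sigma> x = x) \<and>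
    (\<forall>x \<in> valuation_ring (carrier R) - {\<zero>}. \<sigma> x \<ominus> x = \<zero> \<or> \<nu> x < \<nu> (\<sigma> x \<ominus> x))}"

definition separable_closure :: "'a set"
  where "separable_closure = {x \<in> carrier R. separable_over K x}"

definition ramification_field :: "'a set"
  where "ramification_field = {x \<in> separable_closure. \<forall>\<sigma>\<in>ramification_group. \<sigma> x = x}"

end

end

theory Submission
  imports Defs
begin

text \<open>
  With a perfect residue field, tameness of a finite extension is a numerical condition
  (\<open>tamely_defectless\<close>): the degree is the product of ramification index and residue degree, and the
  ramification index is prime to the residue characteristic \<open>p\<close>. The extensions that satisfy it are
  those that can be climbed in simple steps of two kinds (\<open>tower\<close>): adjoin an integral element whose
  conjugates have distinct residues (\<open>unramified_element\<close>), or adjoin an \<open>n\<close>-th root, with \<open>n\<close> prime to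
  \<open>p\<close>. Steps of the first kind alone give the unramified extensions.

  Both kinds of steps remain possible over a larger base field (\<open>tower_compositum\<close>). Therefore \<open>L\<close> is
  tame over \<open>L\<^sub>2\<close> and \<open>L'\<close> over \<open>L\<^sub>2'\<close>. Moreover, if \<open>L'\<close> is unramified over \<open>L\<^sub>2'\<close>, then so is
  \<open>L = L' L\<^sub>2\<close> over \<open>L\<^sub>2\<close>. Conversely, suppose that \<open>L\<close> is unramified over \<open>L\<^sub>2\<close>. Then a value \<open>\<gamma>\<close> of \<open>L'\<close> is
  a value of \<open>L\<^sub>2\<close>, and \<open>e \<gamma>\<close> is a value of \<open>L\<^sub>2'\<close>, where \<open>e\<close>, the ramification index of \<open>L'\<close> over \<open>L\<^sub>2'\<close>, is
  prime to \<open>p\<close>. But modulo the values of \<open>L\<^sub>2' = L\<^sub>2 \<inter> K\<^sup>r\<close>, the values of \<open>L\<^sub>2\<close> have no torsion prime to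
  \<open>p\<close> (\<open>value_group_ramification_field\<close>), so \<open>\<gamma>\<close> is a value of \<open>L\<^sub>2'\<close>.

  That the steps are tame follows from the fundamental inequality, by which the product of
  ramification index and residue degree is at most the degree, and from lower bounds for one of the
  two factors: distinct residues of conjugates, or distinct cosets of values of powers. That tame
  extensions consist of such steps is shown with a maximal tower inside the extension
  (\<open>tamely_defectless_tower\<close>). Simple roots of polynomials over the residue field can be lifted, so the
  tower has the same residue field; elements close to 1 have \<open>n\<close>-th roots, so it has the same value
  group; and a defectless extension that changes neither is trivial.

  The henselian property enters only through the invariance of the valuation under automorphisms
  over \<open>K\<close> (\<open>automorphism_value\<close>), and Hensel's lemma takes the following form
  (\<open>unramified_element_mem\<close>): if \<open>c\<close> is close to an element \<open>u\<close> of \<open>E\<close>, then so are its conjugates over \<open>E\<close>,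
  and if these have distinct residues, there is only one of them, so that \<open>c\<close> is in \<open>E\<close>. This relies on
  the existence of automorphisms that move an element to any of its conjugates
  (\<open>conjugate_automorphism\<close>). Since \<open>K\<^sup>r\<close> consists of separable elements, it is also needed that these
  form a field and that separability is transitive (\<open>separable_closure_subfield\<close>,
  \<open>radical_separable_trans\<close>).
\<close>

section \<open>The characteristic and the Frobenius map\<close>

(* This infix clashes with the one for natural multiples. *)
no_notation ideal_prod (infixl \<open>\<cdot>\<index>\<close> 80)

lemma (in ring) field_char_subring:
  assumes "subring A R" shows "field_char (R\<lparr>carrier := A\<rparr>) = field_char R"
proof -
  interpret A: ring "R\<lparr>carrier := A\<rparr>" using subring_is_ring[OF assms] .
  show ?thesis
    using A.add.is_group add.is_group
    by (simp add: field_char_def group.ord_def nat_pow_def)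
qed

context domain
begin

lemma field_char_dvd: "[n] \<cdot> \<one> = \<zero> \<longleftrightarrow> field_char R dvd n" for n :: nat
  unfolding field_char_def
  using add.pow_eq_id[of \<one> n] by simp

lemma add_pow_one_mult: "x \<in> carrier R \<Longrightarrow> [n] \<cdot> x = ([n] \<cdot> \<one>) \<otimes> x" for n :: nat
  using add_pow_ldistr[of \<one> x n] by simp

lemma add_pow_zero_iff: "x \<in> carrier R \<Longrightarrow> [n] \<cdot> x = \<zero> \<longleftrightarrow> field_char R dvd n \<or> x = \<zero>" for n :: nat
  using add_pow_one_mult[of x n] field_char_dvd[of n] integral_iff[of "[n] \<cdot> \<one>" x] by auto

lemma field_char_prime:
  assumes "field_char R \<noteq> 0" shows "Factorial_Ring.prime (field_char R)"
proof -
  let ?p = "field_char R"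
  have "?p \<noteq> 1"
    using field_char_dvd[of 1] by auto
  moreover have "?p dvd a \<or> ?p dvd b" if "?p dvd a * b" for a b
  proof -
    have "[(a * b)] \<cdot> \<one> = ([a] \<cdot> \<one>) \<otimes> ([b] \<cdot> \<one>)"
      by (metis add.nat_pow_closed add.nat_pow_pow add_pow_one_mult mult.commute one_closed)
    then show ?thesis
      using that field_char_dvd[of a] field_char_dvd[of b] field_char_dvd[of "a*b"] integral by auto
  qed
  ultimately show ?thesis
    using assms by (intro prime_elem_nat_iff[THEN iffD1] prime_elemI) auto
qed

end

context cring
begin

lemma binomial:
  assumes [simp]: "x \<in> carrier R" "y \<in> carrier R"
  shows "(x \<oplus> y) [^] n = (\<Oplus>k\<in>{..n}. [(n choose k)] \<cdot> (x [^] k \<otimes> y [^] (n - k)))"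
proof (induction n)
  case 0
  then show ?case by simp
next
  case (Suc n)
  let ?f = "\<lambda>n k. [(n choose k)] \<cdot> (x [^] k \<otimes> y [^] (n - k))"
  have y: "(\<Oplus>k\<in>{..n}. ?f n k) \<otimes> y = (\<Oplus>k\<in>{..n}. [(n choose k)] \<cdot> (x [^] k \<otimes> y [^] (Suc n - k)))"
    by (subst finsum_ldistr) (auto intro!: finsum_cong' simp: add_pow_ldistr m_assoc Suc_diff_le)
  have y': "\<dots> = (\<Oplus>k\<in>{..Suc n}. [(n choose k)] \<cdot> (x [^] k \<otimes> y [^] (Suc n - k)))"
    by (subst finsum_Suc) (auto simp: binomial_eq_0)
  have x: "(\<Oplus>k\<in>{..n}. ?f n k) \<otimes> x = (\<Oplus>k\<in>{..n}. [(n choose k)] \<cdot> (x [^] Suc k \<otimes> y [^] (n - k)))"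
    by (subst finsum_ldistr) (auto intro!: finsum_cong' simp: add_pow_ldistr add_pow_rdistr m_assoc m_comm m_lcomm)
  have "(x \<oplus> y) [^] Suc n = (\<Oplus>k\<in>{..n}. ?f n k) \<otimes> x \<oplus> (\<Oplus>k\<in>{..n}. ?f n k) \<otimes> y"
    using Suc by (simp add: r_distr)
  also have "\<dots> = (\<Oplus>k\<in>{..n}. [(n choose k)] \<cdot> (x [^] Suc k \<otimes> y [^] (n - k)))
      \<oplus> ((\<Oplus>k\<in>{..n}. [(n choose Suc k)] \<cdot> (x [^] Suc k \<otimes> y [^] (n - k))) \<oplus> y [^] Suc n)"
    unfolding x y y'
    using finsum_Suc2[of "\<lambda>k. [(n choose k)] \<cdot> (x [^] k \<otimes> y [^] (Suc n - k))" n]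
    by (simp add: Pi_def)
  also have "\<dots> = (\<Oplus>k\<in>{..n}. ?f (Suc n) (Suc k)) \<oplus> y [^] Suc n"
    by (subst add.m_assoc[symmetric], simp, simp, simp, subst finsum_addf[symmetric])
       (auto simp: add.nat_pow_mult add.m_comm)
  also have "\<dots> = (\<Oplus>k\<in>{..Suc n}. ?f (Suc n) k)"
    using finsum_Suc2[of "?f (Suc n)" n] by (simp add: Pi_def)
  finally show ?case .
qed

end

context domain
begin

lemma frobenius_hom:
  assumes "field_char R \<noteq> 0"
  shows "(\<lambda>x. x [^] field_char R) \<in> ring_hom R R"
proof (rule ring_hom_memI)
  let ?p = "field_char R"
  have pr: "Factorial_Ring.prime ?p" using field_char_prime assms by simp
  fix x y assume xy [simp]: "x \<in> carrier R" "y \<in> carrier R"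
  show "(x \<otimes> y) [^] ?p = x [^] ?p \<otimes> y [^] ?p" by (simp add: nat_pow_distrib)
  obtain q where q: "?p = Suc (Suc q)"
    using pr by (metis One_nat_def not_prime_0 not_prime_1 old.nat.exhaust)
  have dv: "?p dvd (?p choose k)" if "k \<in> {1..Suc q}" for k
    using pr that by (intro dvd_choose_prime) (auto simp: q)
  have z: "[(?p choose k)] \<cdot> (x [^] k \<otimes> y [^] (?p - k)) = \<zero>" if "k \<in> {1..Suc q}" for k
    using dv[OF that] by (subst add_pow_zero_iff) auto
  have "(x \<oplus> y) [^] ?p = (\<Oplus>k\<in>{..?p}. [(?p choose k)] \<cdot> (x [^] k \<otimes> y [^] (?p - k)))"
    by (rule binomial) auto
  also have "\<dots> = (\<Oplus>k\<in>{0, ?p}. [(?p choose k)] \<cdot> (x [^] k \<otimes> y [^] (?p - k)))"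
  proof (rule add.finprod_mono_neutral_cong_right)
    show "[(?p choose i)] \<cdot> (x [^] i \<otimes> y [^] (?p - i)) = \<zero>" if "i \<in> {..?p} - {0, ?p}" for i
      by (rule z) (use that q in auto)
  qed auto
  also have "\<dots> = x [^] ?p \<oplus> y [^] ?p"
    using assms by (subst finsum_insert) (auto simp: a_comm)
  finally show "(x \<oplus> y) [^] ?p = x [^] ?p \<oplus> y [^] ?p" .
qed auto

lemma frobenius_inj:
  assumes "field_char R \<noteq> 0" "x \<in> carrier R" "y \<in> carrier R" "x [^] field_char R = y [^] field_char R"
  shows "x = y"
proof -
  interpret h: ring_hom_ring R R "\<lambda>x. x [^] field_char R"
    using frobenius_hom[OF assms(1)] by (intro ring_hom_ringI2) (auto intro: ring_axioms)
  have pz: "x [^] n = \<zero> \<Longrightarrow> x = \<zero>" if "x \<in> carrier R" for x and n :: nat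
    using that by (induction n) (auto simp: integral_iff)
  have "(x \<ominus> y) [^] field_char R = \<zero>"
    using assms by (simp add: a_minus_def r_neg)
  then have "x \<ominus> y = \<zero>" using assms by (intro pz[of "x \<ominus> y"]) auto
  then show ?thesis using assms by simp
qed

end

section \<open>The formal derivative and separability\<close>

context ring
begin

text \<open>A polynomial is the list of its coefficients, the leading one first, so \<open>length p\<close> is the exponent
  that belongs to \<open>a\<close> in \<open>a # p\<close>.\<close>

fun pder :: "'a list \<Rightarrow> 'a list"
  where "pder [] = []"
  | "pder (a # p) = (if p = [] then [] else [length p] \<cdot> a # pder p)"

lemma length_pder: "length (pder p) = length p - 1"
  by (induction p rule: pder.induct) (auto simp: Suc_diff_Suc)

lemma pder_in_carrier: "set p \<subseteq> carrier R \<Longrightarrow> set (pder p) \<subseteq> carrier R"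
  by (induction p rule: pder.induct) auto

lemma pder_in_subring:
  assumes "subring K R" shows "set p \<subseteq> K \<Longrightarrow> set (pder p) \<subseteq> K"
proof (induction p rule: pder.induct)
  case (2 a p)
  have "[n] \<cdot> a \<in> K" if "a \<in> K" for n :: nat
    using that subringE[OF assms] by (induction n) (auto simp: subset_iff)
  then show ?case using 2 by auto
qed auto

lemma coeff_pder: "set p \<subseteq> carrier R \<Longrightarrow> coeff (pder p) i = [(Suc i)] \<cdot> coeff p (Suc i)"
proof (induction p rule: pder.induct)
  case (2 a p)
  then show ?case by (cases p) (auto simp: length_pder)
qed auto

text \<open>In contrast to the list \<open>pder p\<close>, its values are not affected by leading zeros, which sums and
  products of polynomials discard.\<close>

definition eval_der :: "'a list \<Rightarrow> 'a \<Rightarrow> 'a"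
  where "eval_der p x = eval (pder p) x"

lemma eval_der_Nil [simp]: "eval_der [] x = \<zero>"
  by (simp add: eval_der_def)

lemma eval_der_Cons:
  assumes "a \<in> carrier R" "set p \<subseteq> carrier R" "x \<in> carrier R"
  shows "eval_der (a # p) x = [length p] \<cdot> a \<otimes> x [^] (length p - 1) \<oplus> eval_der p x"
  using assms by (cases p) (auto simp: eval_der_def length_pder)

lemma eval_der_closed [simp]: "set p \<subseteq> carrier R \<Longrightarrow> x \<in> carrier R \<Longrightarrow> eval_der p x \<in> carrier R"
  by (simp add: eval_der_def eval_in_carrier pder_in_carrier)

lemma eval_der_normalize:
  "set p \<subseteq> carrier R \<Longrightarrow> x \<in> carrier R \<Longrightarrow> eval_der (normalize p) x = eval_der p x"
  by (induction p) (auto simp: eval_der_Cons)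

lemma eval_der_replicate:
  "set p \<subseteq> carrier R \<Longrightarrow> x \<in> carrier R \<Longrightarrow> eval_der (replicate n \<zero> @ p) x = eval_der p x"
proof (induction n)
  case (Suc n)
  have "set (replicate n \<zero> @ p) \<subseteq> carrier R" using Suc by auto
  then show ?case using Suc by (simp add: eval_der_Cons)
qed auto

end

context cring
begin

lemma map2_add_in_carrier:
  "set p \<subseteq> carrier R \<Longrightarrow> set q \<subseteq> carrier R \<Longrightarrow> set (map2 (\<oplus>) p q) \<subseteq> carrier R"
  by (auto intro!: add.m_closed intro: subsetD dest: set_zip_leftD set_zip_rightD)

lemma eval_der_map2:
  assumes "length p = length q" "set p \<subseteq> carrier R" "set q \<subseteq> carrier R" "x \<in> carrier R"
  shows "eval_der (map2 (\<oplus>) p q) x = eval_der p x \<oplus> eval_der q x"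
  using assms
proof (induction p q rule: list_induct2)
  case (Cons a p b q)
  have "set (map2 (\<oplus>) p q) \<subseteq> carrier R"
    using Cons.prems by (intro map2_add_in_carrier) auto
  then show ?case
    using Cons by (simp add: eval_der_Cons add.nat_pow_distrib l_distr a_ac)
qed auto

lemma eval_der_poly_add:
  assumes "set p \<subseteq> carrier R" "set q \<subseteq> carrier R" "x \<in> carrier R"
  shows "eval_der (poly_add p q) x = eval_der p x \<oplus> eval_der q x"
proof -
  have *: "eval_der (poly_add p q) x = eval_der p x \<oplus> eval_der q x"
    if "length q \<le> length p" "set p \<subseteq> carrier R" "set q \<subseteq> carrier R" for p q
  proof -
    let ?q = "replicate (length p - length q) \<zero> @ q"
    have q: "set ?q \<subseteq> carrier R" "length p = length ?q" using that by auto
    have "set (map2 (\<oplus>) p ?q) \<subseteq> carrier R"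
      using q(1) that by (intro map2_add_in_carrier)
    then show ?thesis
      using that assms q eval_der_map2[of p ?q x]
      by (simp add: eval_der_normalize eval_der_replicate)
  qed
  show ?thesis
  proof (cases "length q \<le> length p")
    case False
    then have "poly_add p q = poly_add q p" by simp
    then show ?thesis using *[of p q] False assms by (simp add: a_comm del: poly_add.simps)
  qed (use * assms in auto)
qed

lemma eval_der_scale:
  assumes "set p \<subseteq> carrier R" "a \<in> carrier R" "x \<in> carrier R"
  shows "eval_der (map ((\<otimes>) a) p) x = a \<otimes> eval_der p x"
  using assms
proof (induction p)
  case (Cons b p)
  moreover have "set (map ((\<otimes>) a) p) \<subseteq> carrier R" using Cons by auto
  moreover have "[length p] \<cdot> (a \<otimes> b) \<otimes> x [^] (length p - 1) = a \<otimes> ([length p] \<cdot> b \<otimes> x [^] (length p - 1))"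
    using Cons by (simp add: add_pow_rdistr[symmetric] m_assoc)
  ultimately show ?case
    by (simp add: eval_der_Cons r_distr)
qed auto

lemma eval_der_append:
  assumes "set p \<subseteq> carrier R" "x \<in> carrier R" "a \<in> carrier R"
  shows "eval_der (p @ [a]) x = x \<otimes> eval_der p x \<oplus> eval p x"
  using assms
proof (induction p)
  case (Cons b p)
  have s: "set (p @ [a]) \<subseteq> carrier R" using Cons by auto
  have "[length p] \<cdot> b \<otimes> x [^] length p = x \<otimes> ([length p] \<cdot> b \<otimes> x [^] (length p - 1))"
    using Cons by (cases p) (auto simp: m_ac)
  then show ?case
    using Cons s by (simp add: eval_der_Cons r_distr l_distr eval_in_carrier a_ac)
qed (auto simp: eval_der_def)

text \<open>The Leibniz rule for a linear factor, evaluated at the root of that factor.\<close>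

lemma eval_der_linear_mult:
  assumes "set q \<subseteq> carrier R" "x \<in> carrier R"
  shows "eval_der (poly_mult [\<one>, \<ominus> x] q) x = eval q x"
proof -
  have m1: "map ((\<otimes>) \<one>) q = q" using assms by (induction q) auto
  have m2: "set (map ((\<otimes>) (\<ominus> x)) q) \<subseteq> carrier R" using assms by auto
  have "poly_mult [\<one>, \<ominus> x] q = poly_add (q @ [\<zero>]) (poly_add (map ((\<otimes>) (\<ominus> x)) q) [])"
    by (simp add: m1 del: poly_add.simps)
  then have "eval_der (poly_mult [\<one>, \<ominus> x] q) x = x \<otimes> eval_der q x \<oplus> eval q x \<oplus> (\<ominus> x \<otimes> eval_der q x \<oplus> \<zero>)"
    using assms m2 by (simp add: eval_der_poly_add poly_add_in_carrier eval_der_append eval_der_scale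
        del: poly_add.simps)
  also have "\<dots> = eval q x"
    using assms eval_in_carrier[of q x] eval_der_closed[of q x] by algebra
  finally show ?thesis .
qed

end

context domain
begin

text \<open>Strip off the linear factor twice: the derivative of \<open>p\<close> at the root is the value of the first
  cofactor, which is divisible by the same linear factor.\<close>

lemma multiple_root_eval_der:
  assumes p: "p \<in> carrier (poly_ring R)" and x: "x \<in> carrier R" and m: "1 < alg_mult p x"
  shows "eval p x = \<zero>" "eval_der p x = \<zero>"
proof -
  interpret UP: domain "poly_ring R" by (rule univ_poly_is_domain[OF carrier_is_subring])
  let ?l = "[\<one>, \<ominus> x]"
  have l: "?l \<in> carrier (poly_ring R)"
    using x by (simp add: polynomial_def flip: univ_poly_carrier)
  have "(?l [^]\<^bsub>poly_ring R\<^esub> (2::nat)) pdivides p"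
    using le_alg_mult_imp_pdivides[OF x p, of 2] m by simp
  then obtain q where q: "q \<in> carrier (poly_ring R)"
    "p = ?l [^]\<^bsub>poly_ring R\<^esub> (2::nat) \<otimes>\<^bsub>poly_ring R\<^esub> q"
    unfolding pdivides_def by blast
  define r where "r = ?l \<otimes>\<^bsub>poly_ring R\<^esub> q"
  have r: "r \<in> carrier (poly_ring R)" using q(1) l by (simp add: r_def)
  have pr: "p = ?l \<otimes>\<^bsub>poly_ring R\<^esub> r"
    using q l by (simp add: r_def numeral_2_eq_2 UP.m_assoc)
  have sub: "set s \<subseteq> carrier R" if "s \<in> carrier (poly_ring R)" for s
    using that polynomial_incl univ_poly_carrier by blast
  have el: "eval ?l x = \<zero>" using x by (simp add: r_neg)
  have er: "eval r x = \<zero>"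
    unfolding r_def univ_poly_mult using x sub[OF l] sub[OF q(1)] eval_poly_mult[of ?l q x] el
    by (simp add: eval_in_carrier del: poly_mult.simps eval.simps)
  show "eval p x = \<zero>"
    unfolding pr univ_poly_mult using x sub[OF l] sub[OF r] eval_poly_mult[of ?l r x] el er
    by (simp add: eval_in_carrier del: poly_mult.simps eval.simps)
  show "eval_der p x = \<zero>"
    unfolding pr univ_poly_mult using x sub[OF r] er eval_der_linear_mult by simp
qed

lemma Irr_unique:
  assumes "subfield K R" "x \<in> carrier R" "algebraic K x" "y \<in> carrier R" "eval (Irr K x) y = \<zero>"
  shows "algebraic K y" "Irr K y = Irr K x"
proof -
  note I = IrrE[OF assms(1,2), unfolded over_def, OF assms(3)]
  have ne: "Irr K x \<noteq> []"
    using pirreducible_degree[OF assms(1) I(1,2)] by auto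
  show a: "algebraic K y"
    using algebraicI[OF I(1) ne assms(5)] by (simp add: over_def)
  note J = IrrE[OF assms(1,4), unfolded over_def, OF a]
  show "Irr K y = Irr K x"
    using minimal_polynomial_is_unique[OF assms(1,4), unfolded over_def, OF a] I J assms(5) by blast
qed

lemma Irr_degree_le:
  assumes "subfield K R" "x \<in> carrier R" "set p \<subseteq> K" "eval p x = \<zero>" "\<not> set p \<subseteq> {\<zero>}"
  shows "algebraic K x" "degree (Irr K x) \<le> length p - 1"
proof -
  have pc: "set p \<subseteq> carrier R" using assms(3) subfieldE(3)[OF assms(1)] by auto
  have n: "normalize p \<in> carrier (K[X])"
    using normalize_gives_polynomial[OF assms(3)] by (simp add: univ_poly_carrier)
  have nn: "normalize p \<noteq> []"
  proof
    assume "normalize p = []"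
    then have "coeff p i = \<zero>" for i using normalize_coeff[of p] by (metis coeff.simps(1))
    then show False using assms(5) coeff_img(3)[of p] by (metis image_subset_iff insertI1 sup.bounded_iff)
  qed
  have e: "eval (normalize p) x = \<zero>" using eval_normalize[OF pc assms(2)] assms(4) by simp
  show a: "algebraic K x" using algebraicI[OF n nn e] by (simp add: over_def)
  have "(Irr K x) pdivides (normalize p)"
    using Irr_minimal[OF assms(1,2) _ n e] a by (simp add: over_def)
  then have "degree (Irr K x) \<le> degree (normalize p)"
    using pdivides_imp_degree_le[OF subfieldE(1)[OF assms(1)] _ n nn]
      IrrE(1)[OF assms(1,2)] a by (simp add: over_def)
  then show "degree (Irr K x) \<le> length p - 1"
    using normalize_length_le[of p] by linarith
qed

end

context ring
begin

lemma eval_map_rev_upt: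
  assumes "\<And>i. i < n \<Longrightarrow> f i \<in> carrier R" "x \<in> carrier R"
  shows "eval (map f (rev [0..<n])) x = (\<Oplus>i\<in>{..<n}. f i \<otimes> x [^] i)"
  using assms(1)
proof (induction n)
  case (Suc n)
  have "(\<Oplus>i\<in>{..<Suc n}. f i \<otimes> x [^] i) = f n \<otimes> x [^] n \<oplus> (\<Oplus>i\<in>{..<n}. f i \<otimes> x [^] i)"
    unfolding lessThan_Suc using Suc.prems assms(2) by (subst finsum_insert) auto
  then show ?case using Suc by simp
qed auto

lemma eval_as_finsum:
  assumes "set p \<subseteq> carrier R" "x \<in> carrier R"
  shows "eval p x = (\<Oplus>i\<in>{..<length p}. coeff p i \<otimes> x [^] i)"
  using eval_map_rev_upt[of "length p" "coeff p" x] assms by (simp add: coeff_list)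

lemma coeff_mem: "set p \<subseteq> A \<Longrightarrow> \<zero> \<in> A \<Longrightarrow> coeff p i \<in> A"
  by (induction p) auto

text \<open>The polynomial \<open>X\<^sup>n - a\<close>, for positive \<open>n\<close>.\<close>

definition pure_poly :: "nat \<Rightarrow> 'a \<Rightarrow> 'a list"
  where "pure_poly n a = monom \<one> (n - 1) @ [\<ominus> a]"

end

context domain
begin

lemma pure_poly:
  assumes "subring K R" "a \<in> K" "0 < n"
  shows "pure_poly n a \<in> carrier (K[X])" "length (pure_poly n a) = Suc n" "set (pure_poly n a) \<subseteq> K"
    and "y \<in> carrier R \<Longrightarrow> eval (pure_poly n a) y = y [^] n \<ominus> a"
    and "y \<in> carrier R \<Longrightarrow> eval_der (pure_poly n a) y = [n] \<cdot> (y [^] (n - 1))"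
proof -
  note S = subringE[OF assms(1)]
  have a: "a \<in> carrier R" using assms S by auto
  have l: "length (monom \<one> (n - 1)) = n" using assms by (simp add: monom_def)
  then show "length (pure_poly n a) = Suc n" by (simp add: pure_poly_def)
  have "\<ominus> a \<in> K" using S(5) assms(2) .
  then show s: "set (pure_poly n a) \<subseteq> K"
    using S(2,3) by (auto simp: pure_poly_def monom_def)
  have "hd (pure_poly n a) \<noteq> \<zero>" by (simp add: pure_poly_def monom_def)
  then show "pure_poly n a \<in> carrier (K[X])"
    using s by (simp add: polynomial_def flip: univ_poly_carrier)
  show "eval (pure_poly n a) y = y [^] n \<ominus> a" if y: "y \<in> carrier R"
    using assms(3) y a
    by (cases n) (simp_all add: pure_poly_def eval_append_aux eval_monom monom_in_carrier a_minus_def del: eval.simps)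
  have z: "eval_der (replicate k \<zero>) y = \<zero>" if "y \<in> carrier R" for y k
    using that eval_der_replicate[of "[]" y k] by simp
  have m: "eval_der (monom \<one> k) y = [k] \<cdot> (y [^] (k - 1))" if "y \<in> carrier R" for y k
  proof -
    have "set (replicate k \<zero>) \<subseteq> carrier R" by auto
    then show ?thesis
      using that z[OF that, of k] eval_der_Cons[of \<one> "replicate k \<zero>" y] by (simp add: monom_def add_pow_ldistr)
  qed
  show "eval_der (pure_poly n a) y = [n] \<cdot> (y [^] (n - 1))" if y: "y \<in> carrier R"
  proof -
    obtain k where n: "n = Suc k" using assms(3) by (cases n) auto
    have "eval_der (pure_poly n a) y = y \<otimes> [k] \<cdot> (y [^] (k - 1)) \<oplus> y [^] k"
      using y a eval_monom[of \<one> y k]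
      by (simp add: pure_poly_def eval_der_append monom_in_carrier m n)
    also have "y \<otimes> [k] \<cdot> (y [^] (k - 1)) = [k] \<cdot> (y [^] k)"
    proof (cases k)
      case (Suc j)
      then show ?thesis
        using y add_pow_rdistr[of y "y [^] j" "Suc j"] nat_pow_Suc2[of y j]
        by (simp del: add.nat_pow_Suc nat_pow_Suc)
    qed (use y in simp)
    finally show ?thesis using y n by simp
  qed
qed

lemma IrrE':
  assumes "subfield K R" "x \<in> carrier R" "algebraic K x"
  shows "Irr K x \<in> carrier (K[X])" "pirreducible K (Irr K x)" "lead_coeff (Irr K x) = \<one>"
    "eval (Irr K x) x = \<zero>" "set (Irr K x) \<subseteq> K" "Irr K x \<in> carrier (poly_ring R)" "Irr K x \<noteq> []"
    "1 \<le> degree (Irr K x)" "set (Irr K x) \<subseteq> carrier R"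
proof -
  note I = IrrE[OF assms(1,2), unfolded over_def, OF assms(3)]
  show "Irr K x \<in> carrier (K[X])" "pirreducible K (Irr K x)" "lead_coeff (Irr K x) = \<one>"
    "eval (Irr K x) x = \<zero>" by (rule I)+
  show s: "set (Irr K x) \<subseteq> K"
    using I(1) polynomial_incl univ_poly_carrier by blast
  show "Irr K x \<in> carrier (poly_ring R)"
    using carrier_polynomial_shell[OF subfieldE(1)[OF assms(1)] I(1)] .
  show "1 \<le> degree (Irr K x)"
    using pirreducible_degree[OF assms(1) I(1,2)] .
  then show "Irr K x \<noteq> []" by auto
  show "set (Irr K x) \<subseteq> carrier R" using s subfieldE(3)[OF assms(1)] by auto
qed

lemma Irr_pdivides:
  assumes "subfield K R" "x \<in> carrier R" "p \<in> carrier (K[X])" "p \<noteq> []" "eval p x = \<zero>"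
  shows "algebraic K x" "Irr K x pdivides p" "roots (Irr K x) \<subseteq># roots p"
    "alg_mult (Irr K x) y \<le> alg_mult p y"
    "y \<in> carrier R \<Longrightarrow> eval (Irr K x) y = \<zero> \<Longrightarrow> eval p y = \<zero>"
proof -
  show a: "algebraic K x" using algebraicI[OF assms(3-5)] by (simp add: over_def)
  show d: "Irr K x pdivides p" using Irr_minimal[OF assms(1,2) _ assms(3,5)] a by (simp add: over_def)
  have p: "p \<in> carrier (poly_ring R)" using carrier_polynomial_shell[OF subfieldE(1)[OF assms(1)] assms(3)] .
  show r: "roots (Irr K x) \<subseteq># roots p"
    using pdivides_imp_roots_incl[OF IrrE'(6)[OF assms(1,2) a] p assms(4) d] .
  then show "alg_mult (Irr K x) y \<le> alg_mult p y"
    using alg_mult_eq_count_roots[OF p] alg_mult_eq_count_roots[OF IrrE'(6)[OF assms(1,2) a]]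
    by (simp add: mset_subset_eq_count)
  show "y \<in> carrier R \<Longrightarrow> eval (Irr K x) y = \<zero> \<Longrightarrow> eval p y = \<zero>"
    using pdivides_imp_root_sharing[OF IrrE'(6)[OF assms(1,2) a] d] by blast
qed

lemma univ_poly_mono: "K \<subseteq> F \<Longrightarrow> carrier (K[X]) \<subseteq> carrier (F[X])"
  unfolding univ_poly_def polynomial_def by auto

text \<open>The minimal polynomial divides \<open>p\<close>, so its multiple roots are common roots of \<open>p\<close> and of the
  derivative of \<open>p\<close>. This avoids computing the minimal polynomial.\<close>

lemma separable_overI_poly:
  assumes "subfield K R" "x \<in> carrier R" "p \<in> carrier (K[X])" "p \<noteq> []" "eval p x = \<zero>"
    and "\<And>y. \<lbrakk> y \<in> carrier R; eval p y = \<zero>; eval_der p y = \<zero> \<rbrakk> \<Longrightarrow> False"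
  shows "separable_over K x"
  unfolding separable_over_def over_def
proof (intro conjI ballI)
  have p: "p \<in> carrier (poly_ring R)" using carrier_polynomial_shell[OF subfieldE(1)[OF assms(1)] assms(3)] .
  show "algebraic K x" using Irr_pdivides(1)[OF assms(1-5)] .
  fix y assume y: "y \<in> carrier R"
  show "alg_mult (Irr K x) y \<le> 1"
  proof (rule ccontr)
    assume "\<not> alg_mult (Irr K x) y \<le> 1"
    then have "1 < alg_mult p y" using Irr_pdivides(4)[OF assms(1-5), of y] by simp
    then show False using multiple_root_eval_der[OF p y] assms(6)[OF y] by simp
  qed
qed

lemma separable_over_mono:
  assumes "subfield K R" "subfield F R" "K \<subseteq> F" "x \<in> carrier R" "separable_over K x"
  shows "separable_over F x"
proof -
  have a: "algebraic K x" and m: "\<And>y. y \<in> carrier R \<Longrightarrow> alg_mult (Irr K x) y \<le> 1"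
    using assms(5) by (auto simp: separable_over_def over_def)
  note I = IrrE'[OF assms(1,4) a]
  have "Irr K x \<in> carrier (F[X])" using I(1) univ_poly_mono[OF assms(3)] by blast
  note D = Irr_pdivides[OF assms(2,4) this I(7,4)]
  show ?thesis
    unfolding separable_over_def over_def using D(1,4) m order_trans by blast
qed

text \<open>The derivative of an irreducible polynomial with a multiple root has smaller degree and
  shares that root, hence vanishes, so that only exponents divisible by the characteristic occur.\<close>

lemma inseparable_polynomial_in_power:
  assumes "subfield K R" "x \<in> carrier R" "algebraic K x" "\<not> separable_over K x"
  obtains c where "set c \<subseteq> K" "\<not> set c \<subseteq> {\<zero>}" "eval c (x [^] field_char R) = \<zero>"
    "(length c - 1) * field_char R = degree (Irr K x)" "field_char R \<noteq> 0"
proof -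
  let ?m = "Irr K x" and ?p = "field_char R"
  note I = IrrE'[OF assms(1-3)]
  have K: "K \<subseteq> carrier R" using subfieldE(3)[OF assms(1)] .
  obtain y where y: "y \<in> carrier R" "1 < alg_mult ?m y"
    using assms(3,4) by (auto simp: separable_over_def over_def not_le)
  note r = multiple_root_eval_der[OF I(6) y]
  have yI: "Irr K y = ?m" using Irr_unique[OF assms(1-3) y(1) r(1)] by simp
  have der0: "set (pder ?m) \<subseteq> {\<zero>}"
  proof (rule ccontr)
    assume "\<not> set (pder ?m) \<subseteq> {\<zero>}"
    then have "degree ?m \<le> length (pder ?m) - 1"
      using Irr_degree_le(2)[OF assms(1) y(1), of "pder ?m"] yI r(2)
        pder_in_subring[OF subfieldE(1)[OF assms(1)] I(5)] by (simp add: eval_der_def)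
    then show False using I(8) by (simp add: length_pder)
  qed
  have cz: "coeff ?m i = \<zero>" if "\<not> ?p dvd i" for i
  proof -
    from that obtain j where i: "i = Suc j" by (cases i) auto
    have "coeff (pder ?m) j = \<zero>"
      using coeff_mem[OF der0, of j] by simp
    then show ?thesis
      using coeff_pder[OF I(9), of j] add_pow_zero_iff[of "coeff ?m i" i] that i I(9) by simp
  qed
  have pn: "?p dvd degree ?m"
    using cz[of "degree ?m"] lead_coeff_simp[OF I(7)] I(3) by auto
  then have p0: "?p \<noteq> 0" using I(8) by (intro notI) simp
  obtain n where n: "degree ?m = ?p * n" using pn by (auto elim: dvdE)
  have lm: "length ?m = Suc (?p * n)" using n I(7) by (cases ?m) auto
  define c where "c = map (\<lambda>j. coeff ?m (?p * j)) (rev [0..<Suc n])"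
  have lc: "length c = Suc n" by (simp add: c_def)
  have ck: "coeff ?m i \<in> K" for i
    using coeff_mem[OF I(5)] subringE(2)[OF subfieldE(1)[OF assms(1)]] .
  have "eval c (x [^] ?p) = (\<Oplus>j\<in>{..<Suc n}. coeff ?m (?p * j) \<otimes> (x [^] ?p) [^] j)"
    unfolding c_def using I(9) assms(2) by (intro eval_map_rev_upt) auto
  also have "\<dots> = (\<Oplus>j\<in>{..<Suc n}. coeff ?m (?p * j) \<otimes> x [^] (?p * j))"
    using I(9) assms(2) by (intro finsum_cong') (auto simp: nat_pow_pow)
  also have "\<dots> = (\<Oplus>i\<in>(\<lambda>j. ?p * j) ` {..<Suc n}. coeff ?m i \<otimes> x [^] i)"
    using I(9) assms(2) p0 by (subst finsum_reindex) (auto simp: inj_on_def)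
  also have "\<dots> = (\<Oplus>i\<in>{..<length ?m}. coeff ?m i \<otimes> x [^] i)"
  proof (rule add.finprod_mono_neutral_cong_left)
    show "coeff ?m i \<otimes> x [^] i = \<zero>" if "i \<in> {..<length ?m} - (\<lambda>j. ?p * j) ` {..<Suc n}" for i
    proof -
      have "\<not> ?p dvd i"
      proof
        assume "?p dvd i"
        then obtain j where "i = ?p * j" by (auto elim: dvdE)
        moreover from this have "j < Suc n" using that lm p0 by (auto simp: less_Suc_eq_le)
        ultimately show False using that by auto
      qed
      then show ?thesis using cz[of i] assms(2) by simp
    qed
  qed (use p0 lm I(9) assms(2) in \<open>auto simp: less_Suc_eq_le\<close>)
  also have "\<dots> = \<zero>" using eval_as_finsum[OF I(9) assms(2)] I(4) by simp
  finally have e: "eval c (x [^] ?p) = \<zero>" .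
  have "coeff ?m (?p * n) = \<one>" using lead_coeff_simp[OF I(7)] I(3) n by simp
  then have "\<one> \<in> set c" unfolding c_def by (auto intro!: image_eqI[of _ _ n])
  then have "\<not> set c \<subseteq> {\<zero>}" by auto
  moreover have "set c \<subseteq> K" using ck by (auto simp: c_def)
  ultimately show thesis using that[of c] e lc n p0 by (simp add: mult.commute)
qed

text \<open>Otherwise the minimal polynomial is a polynomial in the \<open>p\<close>-th power of the variable, and taking
  \<open>p\<close>-th roots of its coefficients gives one of smaller degree with the same root.\<close>

lemma perfect_imp_separable:
  assumes "subfield K R" "x \<in> carrier R" "algebraic K x"
    and perf: "field_char R = 0 \<or> (\<forall>a\<in>K. \<exists>b\<in>K. b [^] field_char R = a)"
  shows "separable_over K x"
proof (rule ccontr)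
  let ?p = "field_char R"
  assume "\<not> separable_over K x"
  then obtain c where c: "set c \<subseteq> K" "\<not> set c \<subseteq> {\<zero>}" "eval c (x [^] ?p) = \<zero>"
    "(length c - 1) * ?p = degree (Irr K x)" "?p \<noteq> 0"
    using inseparable_polynomial_in_power[OF assms(1-3)] by blast
  obtain g where g: "\<And>a. a \<in> K \<Longrightarrow> g a \<in> K \<and> g a [^] ?p = a"
    using perf c(5) by metis
  interpret h: ring_hom_ring R R "\<lambda>x. x [^] ?p"
    using frobenius_hom[OF c(5)] by (intro ring_hom_ringI2) (auto intro: ring_axioms)
  have K: "K \<subseteq> carrier R" using subfieldE(3)[OF assms(1)] .
  have gK: "set (map g c) \<subseteq> K" using c(1) g by auto
  have gc: "map (\<lambda>x. x [^] ?p) (map g c) = c"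
    using c(1) g by (auto intro!: map_idI simp: subset_iff)
  have "(eval (map g c) x) [^] ?p = eval c (x [^] ?p)"
    using h.eval_hom'[OF assms(2), of "map g c"] gK K gc by auto
  moreover have "eval (map g c) x \<in> carrier R" using gK K assms(2) by (intro eval_in_carrier) auto
  ultimately have e: "eval (map g c) x = \<zero>"
    using frobenius_inj[OF c(5), of "eval (map g c) x" \<zero>] c(3,5) by (simp add: nat_pow_zero)
  have "\<not> set (map g c) \<subseteq> {\<zero>}"
  proof
    assume z: "set (map g c) \<subseteq> {\<zero>}"
    have "a = \<zero>" if "a \<in> set c" for a
    proof -
      have "g a = \<zero>" using z that by auto
      then show ?thesis using g[of a] c(1,5) that by (auto simp: nat_pow_zero)
    qed
    then show False using c(2) by auto
  qed
  then have "degree (Irr K x) \<le> length c - 1"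
    using Irr_degree_le(2)[OF assms(1,2) gK e] by simp
  moreover have "1 < ?p" using prime_gt_1_nat[OF field_char_prime[OF c(5)]] .
  moreover have "1 \<le> degree (Irr K x)" using IrrE'(8)[OF assms(1-3)] .
  moreover have "(length c - 1) * 2 \<le> (length c - 1) * ?p"
    using \<open>1 < ?p\<close> by (intro mult_le_mono2) simp
  ultimately show False using c(4) by linarith
qed

lemma char_zero_imp_separable:
  assumes "subfield K R" "x \<in> carrier R" "algebraic K x" "field_char R = 0"
  shows "separable_over K x"
  using perfect_imp_separable assms by blast

text \<open>The derivative of \<open>X\<^sup>n - x\<^sup>n\<close> vanishes at \<open>0\<close> only, which is not a root.\<close>

lemma radical_separable:
  fixes n :: nat
  assumes "subfield K R" "x \<in> carrier R - {\<zero>}" "x [^] n \<in> K" "[n] \<cdot> \<one> \<noteq> \<zero>"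
  shows "separable_over K x"
proof -
  have n: "0 < n" using assms(4) by (cases n) auto
  note P = pure_poly[OF subfieldE(1)[OF assms(1)] assms(3) n]
  have x: "x \<in> carrier R" using assms by auto
  show ?thesis
  proof (rule separable_overI_poly[OF assms(1) x P(1)])
    show "pure_poly n (x [^] n) \<noteq> []" using P(2) by auto
    show "eval (pure_poly n (x [^] n)) x = \<zero>" using P(4)[OF x] x by simp
    fix y assume y: "y \<in> carrier R" and e: "eval (pure_poly n (x [^] n)) y = \<zero>"
      "eval_der (pure_poly n (x [^] n)) y = \<zero>"
    have pz: "z [^] k = \<zero> \<Longrightarrow> z = \<zero>" if "z \<in> carrier R" for z and k :: nat
      using that by (induction k) (auto simp: integral_iff)
    have "y [^] (n - 1) = \<zero>"
      using e(2) P(5)[OF y] add_pow_zero_iff[of "y [^] (n - 1)" n] field_char_dvd[of n] assms(4) y by auto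
    then have "y = \<zero>" using pz y by blast
    then have "\<zero> \<ominus> x [^] n = \<zero>" using e(1) P(4)[OF y] n by (simp add: nat_pow_zero)
    then have "x [^] n = \<zero>" using r_right_minus_eq[of \<zero> "x [^] n"] x by simp
    then show False using pz x assms(2) by blast
  qed
qed

end

(* Spans are handled by their properties; their defining fold would otherwise be unfolded. *)
lemma (in ring) Span_Nil: "Span K [] = {\<zero>}"
  and Span_Cons: "Span K (u # Us) = line_extension K u (Span K Us)"
  by simp_all

declare (in ring) Span.simps [simp del] Span_Nil [simp]

context algebraically_closed
begin

lemma size_roots_eq_degree:
  assumes "p \<in> carrier (poly_ring L)" shows "size (roots p) = degree p"
  using roots_over_carrier[OF assms] by (simp add: splitted_def)

lemma exists_root_of_positive_degree:
  assumes "p \<in> carrier (poly_ring L)" "1 \<le> degree p"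
  obtains x where "x \<in> carrier L" "eval p x = \<zero>"
proof -
  have "size (roots p) \<noteq> 0" using size_roots_eq_degree[OF assms(1)] assms(2) by simp
  then obtain x where "x \<in># roots p" by fastforce
  then show thesis using that roots_mem_iff_is_root[OF assms(1), of x] by (auto simp: is_root_def)
qed

lemma finite_roots:
  assumes "p \<in> carrier (poly_ring L)" "p \<noteq> []"
  shows "finite {y \<in> carrier L. eval p y = \<zero>}" "{y \<in> carrier L. eval p y = \<zero>} = set_mset (roots p)"
proof -
  show "{y \<in> carrier L. eval p y = \<zero>} = set_mset (roots p)"
    using roots_mem_iff_is_root[OF assms(1)] assms(2) by (auto simp: is_root_def)
  then show "finite {y \<in> carrier L. eval p y = \<zero>}" by simp
qed

lemma card_roots_separable:
  assumes "subfield K L" "x \<in> carrier L" "separable_over K x"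
  shows "card {y \<in> carrier L. eval (Irr K x) y = \<zero>} = degree (Irr K x)"
proof -
  have a: "algebraic K x" and m: "\<And>y. y \<in> carrier L \<Longrightarrow> alg_mult (Irr K x) y \<le> 1"
    using assms(3) by (auto simp: separable_over_def over_def)
  note I = IrrE'[OF assms(1,2) a]
  let ?r = "roots (Irr K x)"
  have c: "count ?r y = 1" if "y \<in># ?r" for y
  proof -
    have "y \<in> carrier L" using that roots_mem_iff_is_root[OF I(6), of y] by (auto simp: is_root_def)
    then have "count ?r y \<le> 1" using m[of y] alg_mult_eq_count_roots[OF I(6)] by simp
    moreover have "1 \<le> count ?r y" using that unfolding One_nat_def Suc_le_eq count_greater_zero_iff .
    ultimately show ?thesis by (rule le_antisym)
  qed
  have "size ?r = (\<Sum>y\<in>set_mset ?r. 1)"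
    unfolding size_multiset_overloaded_eq using c by (intro sum.cong) auto
  then show ?thesis
    using finite_roots(2)[OF I(6,7)] size_roots_eq_degree[OF I(6)] by simp
qed

lemma unique_root_imp_mem:
  assumes "subfield K L" "x \<in> carrier L" "separable_over K x"
    and "\<And>y. \<lbrakk> y \<in> carrier L; eval (Irr K x) y = \<zero> \<rbrakk> \<Longrightarrow> y = x"
  shows "x \<in> K"
proof -
  have a: "algebraic K x" using assms(3) by (auto simp: separable_over_def over_def)
  note I = IrrE'[OF assms(1,2) a]
  have "{y \<in> carrier L. eval (Irr K x) y = \<zero>} = {x}" using assms(2,4) I(4) by auto
  then have d: "degree (Irr K x) = 1" using card_roots_separable[OF assms(1-3)] by simp
  obtain c where c: "Irr K x = [\<one>, c]" "c \<in> K"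
    using degree_oneE[OF I(1) d] I(3) by (metis list.sel(1))
  have cc: "c \<in> carrier L" using c(2) subfieldE(3)[OF assms(1)] by auto
  then have "x \<oplus> c = \<zero>" using I(4) c(1) assms(2) by simp
  then have "x = \<ominus> c" using assms(2) cc by (simp add: minus_equality[symmetric] add.m_comm)
  then show ?thesis using subringE(5)[OF subfieldE(1)[OF assms(1)] c(2)] by simp
qed

text \<open>Frobenius is injective, so over \<open>K(x\<^sup>p)\<close> the only conjugate of \<open>x\<close> is \<open>x\<close> itself.\<close>

lemma separable_mem_frobenius:
  assumes "subfield K L" "x \<in> carrier L" "separable_over K x" "field_char L \<noteq> 0"
  shows "x \<in> simple_extension K (x [^] field_char L)"
proof -
  let ?p = "field_char L" and ?F = "simple_extension K (x [^] field_char L)"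
  have a: "algebraic K x" using assms(3) by (auto simp: separable_over_def over_def)
  have sx: "subring (simple_extension K x) L"
    using simple_extension_is_subring[OF subfieldE(1)[OF assms(1)] assms(2)] .
  have xx: "x \<in> simple_extension K x" using simple_extension_mem[OF subfieldE(1)[OF assms(1)] assms(2)] .
  have pw: "x [^] n \<in> simple_extension K x" for n :: nat
    using subringE(3,6)[OF sx] xx by (induction n) auto
  have xp: "x [^] ?p \<in> carrier L" using assms(2) by simp
  have "algebraic K (x [^] ?p)"
    using simple_extesion_mem_imp_algebraic[OF assms(1,2)] a pw by (simp add: over_def)
  then have F: "subfield ?F L"
    using simple_extension_is_subfield[OF assms(1) xp] by (simp add: over_def)
  have KF: "K \<subseteq> ?F" using simple_extension_incl[OF subfieldE(3)[OF assms(1)] xp] .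
  have xpF: "x [^] ?p \<in> ?F" using simple_extension_mem[OF subfieldE(1)[OF assms(1)] xp] .
  have p: "0 < ?p" using assms(4) by simp
  note P = pure_poly[OF subfieldE(1)[OF F] xpF p]
  have ne: "pure_poly ?p (x [^] ?p) \<noteq> []" using P(2) by auto
  have e: "eval (pure_poly ?p (x [^] ?p)) x = \<zero>" using P(4)[OF assms(2)] assms(2) by simp
  note D = Irr_pdivides[OF F assms(2) P(1) ne e]
  show ?thesis
  proof (rule unique_root_imp_mem[OF F assms(2) separable_over_mono[OF assms(1) F KF assms(2,3)]])
    fix y assume y: "y \<in> carrier L" "eval (Irr ?F x) y = \<zero>"
    then have "y [^] ?p = x [^] ?p" using D(5)[OF y] P(4)[OF y(1)] y assms(2) by simp
    then show "y = x" using frobenius_inj[OF assms(4) y(1) assms(2)] by simp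
  qed
qed

text \<open>In positive characteristic \<open>p\<close>, this says that the \<open>p\<close>-th powers of elements of \<open>E\<close> span \<open>E\<close>
  over \<open>K\<close>. For finite extensions it is equivalent to separability, and it passes to towers easily,
  which separability in terms of minimal polynomials does not. The quantification over subspaces
  avoids a choice of spanning lists.\<close>

definition frobenius_generated :: "'a set \<Rightarrow> 'a set \<Rightarrow> bool"
  where "frobenius_generated K E \<longleftrightarrow>
    (\<forall>V. subalgebra K V L \<and> (\<forall>x\<in>E. x [^] field_char L \<in> V) \<longrightarrow> E \<subseteq> V)"

lemma subalgebra_closed:
  assumes "subalgebra K V L"
  shows "V \<subseteq> carrier L" "\<zero> \<in> V" "\<lbrakk> x \<in> V; y \<in> V \<rbrakk> \<Longrightarrow> x \<oplus> y \<in> V" "\<lbrakk> k \<in> K; x \<in> V \<rbrakk> \<Longrightarrow> k \<otimes> x \<in> V"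
  using assms subgroup.subset[of V "add_monoid L"] subgroup.one_closed[of V "add_monoid L"]
    subgroup.m_closed[of V "add_monoid L"] subalgebra.smult_closed[of K V L]
  by (auto simp: subalgebra_def)

lemma subalgebraI:
  assumes "subring K L" "V \<subseteq> carrier L" "\<zero> \<in> V" "\<And>x y. \<lbrakk> x \<in> V; y \<in> V \<rbrakk> \<Longrightarrow> x \<oplus> y \<in> V"
    and "\<And>k x. \<lbrakk> k \<in> K; x \<in> V \<rbrakk> \<Longrightarrow> k \<otimes> x \<in> V"
  shows "subalgebra K V L"
proof -
  have "\<ominus> x \<in> V" if "x \<in> V" for x
  proof -
    have "\<ominus> \<one> \<otimes> x \<in> V" using assms(5) that subringE(3,5)[OF assms(1)] by blast
    then show ?thesis using that assms(2) by (simp add: l_minus subset_iff)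
  qed
  then have "subgroup V (add_monoid L)"
    using assms(2-4) by (intro add.subgroupI) auto
  then show ?thesis using assms(5) by (simp add: subalgebra_def subalgebra_axioms_def)
qed

lemma eval_in_subalgebra:
  assumes "subalgebra K V L" "\<And>a i. a \<in> set p \<Longrightarrow> a \<otimes> x [^] (i::nat) \<in> V"
  shows "eval p x \<in> V"
  using assms(2) by (induction p) (auto intro: subalgebra_closed(2,3)[OF assms(1)])

lemma simple_extension_mem_eval:
  assumes "subring K L" "x \<in> carrier L" "z \<in> simple_extension K x"
  shows "\<exists>p. set p \<subseteq> K \<and> p \<in> carrier (K[X]) \<and> z = eval p x"
proof -
  obtain p where p: "p \<in> carrier (K[X])" "z = eval p x"
    using simple_extension_as_eval_img[OF subringE(1)[OF assms(1)] assms(2)] assms(3) by auto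
  then have "set p \<subseteq> K" using polynomial_incl univ_poly_carrier by blast
  then show ?thesis using p by blast
qed

lemma pow_closed_subring:
  assumes "subring K L" "x \<in> K" shows "x [^] (n::nat) \<in> K"
  using subringE(3,6)[OF assms(1)] assms(2) by (induction n) auto

lemma frobenius_generated_self:
  assumes "subfield K L" shows "frobenius_generated K K"
  unfolding frobenius_generated_def
proof (intro allI impI subsetI)
  fix V k assume V: "subalgebra K V L \<and> (\<forall>x\<in>K. x [^] field_char L \<in> V)" and k: "k \<in> K"
  have "\<one> \<in> K" using subringE(3)[OF subfieldE(1)[OF assms]] .
  then have "\<one> \<in> V" using V by (metis nat_pow_one)
  then have "k \<otimes> \<one> \<in> V" using subalgebra_closed(4) V k by blast
  then show "k \<in> V" using k subfieldE(3)[OF assms] by auto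
qed

lemma separable_imp_frobenius_generated:
  assumes "subfield K L" "subfield E L" "field_char L \<noteq> 0" "\<And>x. x \<in> E \<Longrightarrow> separable_over K x"
  shows "frobenius_generated K E"
  unfolding frobenius_generated_def
proof (intro allI impI subsetI)
  let ?p = "field_char L"
  fix V x assume V: "subalgebra K V L \<and> (\<forall>x\<in>E. x [^] field_char L \<in> V)" and x: "x \<in> E"
  have xc: "x \<in> carrier L" using x subfieldE(3)[OF assms(2)] by auto
  then have xp: "x [^] ?p \<in> carrier L" by simp
  obtain q where q: "set q \<subseteq> K" "x = eval q (x [^] ?p)"
    using simple_extension_mem_eval[OF subfieldE(1)[OF assms(1)] xp separable_mem_frobenius[OF assms(1) xc assms(4)[OF x] assms(3)]]
    by blast
  have "eval q (x [^] ?p) \<in> V"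
  proof (rule eval_in_subalgebra)
    show "subalgebra K V L" using V by simp
    fix a i assume a: "a \<in> set q"
    have "(x [^] (i::nat)) [^] ?p \<in> V"
      using V pow_closed_subring[OF subfieldE(1)[OF assms(2)] x] by blast
    then show "a \<otimes> (x [^] ?p) [^] i \<in> V"
      using subalgebra_closed(4)[of K V a] V a q(1) xc by (auto simp: nat_pow_pow mult.commute)
  qed
  then show "x \<in> V" using q(2) by simp
qed

text \<open>An element of \<open>T(w)\<close> is a sum of terms \<open>t u\<close> with \<open>t\<close> in \<open>T\<close> and \<open>u\<close> a power of \<open>w\<^sup>p\<close>. If a subspace
  \<open>V\<close> contains all \<open>p\<close>-th powers, then the elements \<open>t\<close> with \<open>t u\<close> in \<open>V\<close> form a subspace that
  contains the \<open>p\<close>-th powers from \<open>T\<close>, hence all of \<open>T\<close>.\<close>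

lemma frobenius_generated_simple_extension:
  assumes "subfield K L" "subfield T L" "K \<subseteq> T" "frobenius_generated K T" "w \<in> carrier L"
    and w: "w \<in> simple_extension T (w [^] field_char L)"
  shows "frobenius_generated K (simple_extension T w)"
  unfolding frobenius_generated_def
proof (intro allI impI subsetI)
  let ?p = "field_char L"
  fix V z assume V: "subalgebra K V L \<and> (\<forall>x\<in>simple_extension T w. x [^] field_char L \<in> V)"
    and z: "z \<in> simple_extension T w"
  have T: "subring T L" "T \<subseteq> carrier L" using subfieldE(1,3)[OF assms(2)] by auto
  have TT: "subring (simple_extension T (w [^] ?p)) L"
    using simple_extension_is_subring[OF T(1)] assms(5) by simp
  have wp: "w [^] ?p \<in> carrier L" using assms(5) by simp
  have "simple_extension T w \<subseteq> simple_extension T (w [^] ?p)"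
    using simple_extension_subring_incl[OF TT simple_extension_incl[OF T(2) wp] w] .
  then have z': "z \<in> simple_extension T (w [^] ?p)" using z by auto
  obtain q where q: "set q \<subseteq> T" "z = eval q (w [^] ?p)"
    using simple_extension_mem_eval[OF T(1) wp z'] by blast
  have "eval q (w [^] ?p) \<in> V"
  proof (rule eval_in_subalgebra)
    show V': "subalgebra K V L" using V by simp
    fix a i assume a: "a \<in> set q"
    let ?u = "(w [^] ?p) [^] (i::nat)"
    have u: "?u \<in> carrier L" using assms(5) by simp
    have "subalgebra K {t \<in> carrier L. t \<otimes> ?u \<in> V} L"
      using subalgebra_closed[OF V'] u subfieldE(3)[OF assms(1)]
      by (intro subalgebraI subfieldE(1)[OF assms(1)]) (auto simp: l_distr m_assoc)
    moreover have "t [^] ?p \<in> {t \<in> carrier L. t \<otimes> ?u \<in> V}" if t: "t \<in> T" for t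
    proof -
      have sr: "subring (simple_extension T w) L" using simple_extension_is_subring[OF T(1) assms(5)] .
      have "t \<in> simple_extension T w" using simple_extension_incl[OF T(2) assms(5)] t by auto
      moreover have "w [^] i \<in> simple_extension T w"
        using pow_closed_subring[OF sr] simple_extension_mem[OF T(1) assms(5)] by blast
      ultimately have "(t \<otimes> w [^] i) [^] ?p \<in> V" using V subringE(6)[OF sr] by blast
      moreover have "(t \<otimes> w [^] i) [^] ?p = t [^] ?p \<otimes> ?u"
        using t T(2) assms(5) by (auto simp: nat_pow_distrib nat_pow_pow mult.commute)
      ultimately show ?thesis using t T(2) by auto
    qed
    ultimately have "T \<subseteq> {t \<in> carrier L. t \<otimes> ?u \<in> V}"
      using assms(4) unfolding frobenius_generated_def by blast
    then show "a \<otimes> ?u \<in> V" using a q(1) by auto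
  qed
  then show "z \<in> V" using q(2) by simp
qed

lemma spanning_list_independent:
  assumes "subfield K L" "set Us \<subseteq> carrier L"
  obtains m where "dimension m K (Span K Us)" "m \<le> length Us" "m = length Us \<longrightarrow> independent K Us"
proof -
  have "\<exists>m. dimension m K (Span K Us) \<and> m \<le> length Us \<and> (m = length Us \<longrightarrow> independent K Us)"
    using assms(2)
  proof (induction Us)
    case Nil
    then show ?case using dimension.zero_dim[of K] by force
  next
    case (Cons u Us)
    then obtain m where m: "dimension m K (Span K Us)" "m \<le> length Us" "m = length Us \<longrightarrow> independent K Us"
      by auto
    show ?case
    proof (cases "u \<in> Span K Us")
      case True
      have "Span K (u # Us) \<subseteq> Span K Us"
        using mono_Span_subset[OF assms(1), of "u # Us" Us] Span_base_incl[OF assms(1), of Us] True Cons.prems by auto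
      then have "Span K (u # Us) = Span K Us"
        using mono_Span[OF assms(1), of Us u] Cons.prems by auto
      then show ?thesis using m by (intro exI[of _ m]) auto
    next
      case False
      then have "dimension (Suc m) K (Span K (u # Us))"
        using dimension.Suc_dim[OF _ False m(1)] Cons.prems by (simp add: Span_Cons)
      then show ?thesis using m False Cons.prems by (intro exI[of _ "Suc m"]) (auto intro: li_Cons)
    qed
  qed
  then show thesis using that by blast
qed

text \<open>The powers \<open>1, z, z^2, ...\<close> below the degree of \<open>z\<close> extend to a basis of \<open>E\<close>, whose image
  under Frobenius generates \<open>E\<close> and is therefore a basis. So the powers of \<open>z^p\<close> are independent
  up to the degree of \<open>z\<close>, whereas \<open>z^p\<close> has smaller degree when \<open>z\<close> is inseparable.\<close>

lemma frobenius_generated_imp_separable: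
  assumes "subfield K L" "subfield E L" "K \<subseteq> E" "finite_dimension K E" "field_char L \<noteq> 0"
    and "frobenius_generated K E" "z \<in> E"
  shows "separable_over K z"
proof (rule ccontr)
  let ?p = "field_char L" and ?h = "\<lambda>x. x [^] field_char L"
  assume ins: "\<not> separable_over K z"
  have E: "E \<subseteq> carrier L" and K: "K \<subseteq> carrier L" using subfieldE(3)[OF assms(2)] subfieldE(3)[OF assms(1)] by auto
  have z: "z \<in> carrier L" using E assms(7) by auto
  have alg: "algebraic K z"
    using finite_dimension_imp_algebraic[OF assms(1) subfieldE(1)[OF assms(2)] assms(4,7)] by (simp add: over_def)
  let ?n = "degree (Irr K z)"
  interpret h: ring_hom_ring L L ?h
    using frobenius_hom[OF assms(5)] by (intro ring_hom_ringI2) (auto intro: ring_axioms)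
  have ind: "independent K (exp_base z ?n)"
    using exp_base_independent[OF assms(1) z] alg by (simp add: over_def)
  have sub: "set (exp_base z ?n) \<subseteq> E"
    using pow_closed_subring[OF subfieldE(1)[OF assms(2)] assms(7)] by (auto simp: exp_base_def)
  obtain d where d: "dimension d K E" using assms(4) by blast
  obtain Vs where Vs: "length (Vs @ exp_base z ?n) = d" "independent K (Vs @ exp_base z ?n)"
    "Span K (Vs @ exp_base z ?n) = E"
    using complete_base[OF assms(1) d ind sub] by blast
  define Bs where "Bs = Vs @ exp_base z ?n"
  have SB: "Span K Bs = E" and lB: "length Bs = d" using Vs(1,3) unfolding Bs_def by simp_all
  have Bc: "set Bs \<subseteq> carrier L" using independent_in_carrier[OF Vs(2)] by (simp add: Bs_def)
  have Hc: "set (map ?h Bs) \<subseteq> carrier L" using Bc by auto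
  have "E \<subseteq> Span K (map ?h Bs)"
  proof -
    have "x [^] ?p \<in> Span K (map ?h Bs)" if "x \<in> E" for x
    proof -
      have "x \<in> {combine Ks Bs |Ks. set Ks \<subseteq> K}"
        using that SB Span_eq_combine_set[OF assms(1) Bc] by simp
      then obtain Ks where Ks: "set Ks \<subseteq> K" "x = combine Ks Bs" by blast
      have "set Ks \<subseteq> carrier L" using Ks K by auto
      then have "x [^] ?p = combine (map ?h Ks) (map ?h Bs)"
        using h.combine_hom[OF _ Bc] Ks(2) by simp
      moreover have "set (map ?h Ks) \<subseteq> K"
        using Ks pow_closed_subring[OF subfieldE(1)[OF assms(1)]] by auto
      ultimately show ?thesis unfolding Span_eq_combine_set[OF assms(1) Hc] by blast
    qed
    then show ?thesis
      using assms(6) Span_is_subalgebra[OF assms(1) Hc] unfolding frobenius_generated_def by blast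
  qed
  moreover have "set (map ?h Bs) \<subseteq> E"
    using SB Span_base_incl[OF assms(1) Bc] pow_closed_subring[OF subfieldE(1)[OF assms(2)]] by auto
  ultimately have "Span K (map ?h Bs) = E"
    using subalgebra_Span_incl[OF assms(1) finite_dimension_imp_subalgebra[OF assms(1,4)]] by blast
  then have "independent K (map ?h Bs)"
    using spanning_list_independent[OF assms(1) Hc] dimension_is_inj[OF assms(1) d] lB
    by (metis length_map)
  then have i: "independent K (map ?h (exp_base z ?n))"
    using independent_split(1)[OF assms(1), of "map ?h Vs"] by (simp add: Bs_def)
  have eb: "map ?h (exp_base z ?n) = exp_base (z [^] ?p) ?n"
    using z by (simp add: exp_base_def nat_pow_pow mult.commute[of _ ?p] o_def)
  obtain c where c: "set c \<subseteq> K" "\<not> set c \<subseteq> {\<zero>}" "eval c (z [^] ?p) = \<zero>" "(length c - 1) * ?p = ?n"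
    by (rule inseparable_polynomial_in_power[OF assms(1) z alg ins])
  have n1: "1 \<le> ?n" using IrrE'(8)[OF assms(1) z alg] .
  have "1 < ?p" using prime_gt_1_nat[OF field_char_prime[OF assms(5)]] .
  then have "(length c - 1) * 2 \<le> (length c - 1) * ?p" by (intro mult_le_mono2) simp
  then have "length c - 1 < ?n" using c(4) n1 by linarith
  then have "length c \<le> ?n" by linarith
  then have "drop (?n - length c) (exp_base (z [^] ?p) ?n) = exp_base (z [^] ?p) (length c)"
    unfolding drop_exp_base by (subst diff_diff_cancel) auto
  then have "independent K (exp_base (z [^] ?p) (length c))"
    using i eb independent_split(1)[OF assms(1)] by (metis append_take_drop_id)
  moreover have "combine c (exp_base (z [^] ?p) (length c)) = \<zero>"
    using combine_eq_eval[of c "z [^] ?p"] c(3) by simp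
  ultimately have "set (take (length c) c) \<subseteq> {\<zero>}"
    using independent_imp_trivial_combine[OF assms(1), of "exp_base (z [^] ?p) (length c)" c] c(1)
    by (simp add: exp_base_def)
  then show False using c(2) by simp
qed

lemma simple_extension_subfield:
  assumes "subfield K L" "x \<in> carrier L" "algebraic K x"
  shows "subfield (simple_extension K x) L" "finite_dimension K (simple_extension K x)"
    "K \<subseteq> simple_extension K x" "x \<in> simple_extension K x"
  using simple_extension_is_subfield[OF assms(1,2)] finite_dimension_simple_extension[OF assms(1,2)]
    simple_extension_incl[OF subfieldE(3)[OF assms(1)] assms(2)]
    simple_extension_mem[OF subfieldE(1)[OF assms(1)] assms(2)] assms(3)
  by (auto simp: over_def)

text \<open>For separable \<open>x\<close> and \<open>y\<close> the field \<open>K(x, y)\<close> is spanned by its \<open>p\<close>-th powers, so all of its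
  elements are separable.\<close>

lemma separable_closure_subfield:
  assumes K: "subfield K L"
  shows "subfield {x \<in> carrier L. separable_over K x} L"
proof -
  have alg: "algebraic K x" if "separable_over K x" for x
    using that by (simp add: separable_over_def over_def)
  have two: "separable_over K z"
    if x: "x \<in> carrier L" "separable_over K x" and y: "y \<in> carrier L" "separable_over K y"
      and z: "z \<in> simple_extension (simple_extension K x) y" for x y z
  proof -
    let ?T = "simple_extension K x"
    note T = simple_extension_subfield[OF K x(1) alg[OF x(2)]]
    have ya: "algebraic ?T y" using algebraic_mono[OF T(3)] alg[OF y(2)] by (simp add: over_def)
    note E = simple_extension_subfield[OF T(1) y(1) ya]
    have fd: "finite_dimension K (simple_extension ?T y)"
      using telescopic_base_dim(1)[OF K T(1,2) E(2)] .
    show ?thesis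
    proof (cases "field_char L = 0")
      case True
      have "algebraic K z"
        using finite_dimension_imp_algebraic[OF K subfieldE(1)[OF E(1)] fd z] by (simp add: over_def)
      then show ?thesis using char_zero_imp_separable[OF K _ _ True] z subfieldE(3)[OF E(1)] by auto
    next
      case False
      have 1: "frobenius_generated K ?T"
        using frobenius_generated_simple_extension[OF K K _ frobenius_generated_self[OF K] x(1)
          separable_mem_frobenius[OF K x False]] by simp
      have "y \<in> simple_extension ?T (y [^] field_char L)"
        using separable_mem_frobenius[OF K y False] mono_simple_extension[OF T(3)] by blast
      then have "frobenius_generated K (simple_extension ?T y)"
        using frobenius_generated_simple_extension[OF K T(1,3) 1 y(1)] by simp
      then show ?thesis
        using frobenius_generated_imp_separable[OF K E(1) _ fd False _ z] T(3) E(3) by blast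
    qed
  qed
  have one: "separable_over K \<one>"
  proof (rule separable_overI_poly[OF K, of _ "pure_poly 1 \<one>"])
    note P = pure_poly[OF subfieldE(1)[OF K] subringE(3)[OF subfieldE(1)[OF K]], of 1]
    show "pure_poly 1 \<one> \<in> carrier (K[X])" "pure_poly 1 \<one> \<noteq> []" "eval (pure_poly 1 \<one>) \<one> = \<zero>"
      using P by auto
    show "False" if "y \<in> carrier L" "eval_der (pure_poly 1 \<one>) y = \<zero>" for y
      using that P(5)[of y] by simp
  qed auto
  let ?S = "{x \<in> carrier L. separable_over K x}"
  have sf: "\<exists>E. subfield E L \<and> x \<in> E \<and> y \<in> E \<and> E \<subseteq> ?S" if "x \<in> ?S" "y \<in> ?S" for x y
  proof -
    have x: "x \<in> carrier L" "separable_over K x" and y: "y \<in> carrier L" "separable_over K y" using that by auto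
    note T = simple_extension_subfield[OF K x(1) alg[OF x(2)]]
    have ya: "algebraic (simple_extension K x) y"
      using algebraic_mono[OF T(3)] alg[OF y(2)] by (simp add: over_def)
    note E = simple_extension_subfield[OF T(1) y(1) ya]
    have "simple_extension (simple_extension K x) y \<subseteq> ?S"
      using two[OF x y] subfieldE(3)[OF E(1)] by auto
    then show ?thesis using E T(4) by blast
  qed
  show ?thesis
  proof (rule subfieldI'[OF subringI])
    show "?S \<subseteq> carrier L" by auto
    show "\<one> \<in> ?S" using one by simp
  next
    fix x y assume xy: "x \<in> ?S" "y \<in> ?S"
    obtain E where E: "subfield E L" "x \<in> E" "y \<in> E" "E \<subseteq> ?S" using sf[OF xy] by blast
    note S = subfieldE(1)[OF E(1)]
    show "\<ominus> x \<in> ?S" using subringE(5)[OF S E(2)] E(4) by (rule subsetD[rotated])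
    show "x \<otimes> y \<in> ?S" using subringE(6)[OF S E(2,3)] E(4) by (rule subsetD[rotated])
    show "x \<oplus> y \<in> ?S" using subringE(7)[OF S E(2,3)] E(4) by (rule subsetD[rotated])
  next
    fix x assume x: "x \<in> ?S - {\<zero>}"
    then obtain E where E: "subfield E L" "x \<in> E" "E \<subseteq> ?S" using sf[of x x] by blast
    have "inv x \<in> E" using subfield_m_inv(1)[OF E(1), of x] E(2) x by simp
    then show "inv x \<in> ?S" using E(3) by (rule subsetD[rotated])
  qed
qed

lemma radical_separable_trans:
  fixes n :: nat
  assumes K: "subfield K L" and T: "subfield T L" "K \<subseteq> T" "finite_dimension K T"
    and sep: "\<And>x. x \<in> T \<Longrightarrow> separable_over K x"
    and w: "w \<in> carrier L - {\<zero>}" "w [^] n \<in> T" and n: "[n] \<cdot> \<one> \<noteq> \<zero>"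
  shows "separable_over K w"
proof -
  have wc: "w \<in> carrier L" using w by simp
  have wT: "separable_over T w" using radical_separable[OF T(1) w n] .
  have wa: "algebraic T w" using wT by (simp add: separable_over_def over_def)
  note E = simple_extension_subfield[OF T(1) wc wa]
  have fd: "finite_dimension K (simple_extension T w)"
    using telescopic_base_dim(1)[OF K T(1,3) E(2)] .
  show ?thesis
  proof (cases "field_char L = 0")
    case True
    have "algebraic K w"
      using finite_dimension_imp_algebraic[OF K subfieldE(1)[OF E(1)] fd E(4)] by (simp add: over_def)
    then show ?thesis using char_zero_imp_separable[OF K wc _ True] by simp
  next
    case False
    have "frobenius_generated K (simple_extension T w)"
      using frobenius_generated_simple_extension[OF K T(1,2) separable_imp_frobenius_generated[OF K T(1) False sep] wc]
        separable_mem_frobenius[OF T(1) wc wT False] by simp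
    then show ?thesis
      using frobenius_generated_imp_separable[OF K E(1) _ fd False _ E(4)] T(2) E(3) by blast
  qed
qed

end

section \<open>Conjugate elements\<close>

text \<open>Graphs of embeddings over \<open>F\<close> of subfields into the field. As sets of pairs they are ordered by
  inclusion, which is what Zorn's lemma needs, and the last condition makes them single-valued
  because they are closed under subtraction.\<close>

definition (in ring) embedding_graph :: "'a set \<Rightarrow> ('a \<times> 'a) set \<Rightarrow> bool"
  where "embedding_graph F G \<longleftrightarrow> G \<subseteq> carrier R \<times> carrier R \<and> (\<forall>x\<in>F. (x, x) \<in> G) \<and>
    (\<forall>x y x' y'. (x, y) \<in> G \<and> (x', y') \<in> G \<longrightarrow> (x \<oplus> x', y \<oplus> y') \<in> G \<and> (x \<otimes> x', y \<otimes> y') \<in> G) \<and>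
    (\<forall>x y. (x, y) \<in> G \<and> x \<noteq> \<zero> \<longrightarrow> (inv x, inv y) \<in> G) \<and>
    (\<forall>y. (\<zero>, y) \<in> G \<longrightarrow> y = \<zero>)"

context field
begin

lemma embedding_graphD:
  assumes "embedding_graph F G"
  shows "(x, y) \<in> G \<Longrightarrow> x \<in> carrier R" "(x, y) \<in> G \<Longrightarrow> y \<in> carrier R"
    "x \<in> F \<Longrightarrow> (x, x) \<in> G"
    "(x, y) \<in> G \<Longrightarrow> (x', y') \<in> G \<Longrightarrow> (x \<oplus> x', y \<oplus> y') \<in> G"
    "(x, y) \<in> G \<Longrightarrow> (x', y') \<in> G \<Longrightarrow> (x \<otimes> x', y \<otimes> y') \<in> G"
    "(x, y) \<in> G \<Longrightarrow> x \<noteq> \<zero> \<Longrightarrow> (inv x, inv y) \<in> G"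
    "(\<zero>, y) \<in> G \<Longrightarrow> y = \<zero>"
  using assms unfolding embedding_graph_def by blast+

lemma embedding_graph_hom:
  assumes F: "subfield F R" and G: "embedding_graph F G"
  defines "E \<equiv> Domain G" and "\<phi> \<equiv> \<lambda>x. THE y. (x, y) \<in> G"
  shows "subfield E R" "F \<subseteq> E" "\<And>x y. (x, y) \<in> G \<longleftrightarrow> x \<in> E \<and> y = \<phi> x"
    "\<phi> \<in> ring_hom (R\<lparr>carrier := E\<rparr>) R" "\<And>x. x \<in> F \<Longrightarrow> \<phi> x = x"
proof -
  note D = embedding_graphD[OF G]
  have m1: "\<ominus> \<one> \<in> F" and one: "\<one> \<in> F" using subringE(3,5)[OF subfieldE(1)[OF F]] by auto
  have neg: "(\<ominus> x, \<ominus> y) \<in> G" if "(x, y) \<in> G" for x y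
    using D(5)[OF D(3)[OF m1] that] D(1,2)[OF that] by (simp add: l_minus)
  have uniq: "y = y'" if "(x, y) \<in> G" "(x, y') \<in> G" for x y y'
  proof -
    have "(x \<oplus> \<ominus> x, y \<oplus> \<ominus> y') \<in> G" using D(4)[OF that(1) neg[OF that(2)]] .
    then have "y \<oplus> \<ominus> y' = \<zero>" using D(7) D(1)[OF that(1)] by (simp add: r_neg)
    then show ?thesis using D(2)[OF that(1)] D(2)[OF that(2)] by (simp add: r_right_minus_eq flip: a_minus_def)
  qed
  show iff: "(x, y) \<in> G \<longleftrightarrow> x \<in> E \<and> y = \<phi> x" for x y
  proof -
    have "(x, \<phi> x) \<in> G" if "x \<in> E" for x
      unfolding \<phi>_def using that uniq by (auto simp: E_def intro: theI)
    then show ?thesis using uniq by (auto simp: E_def)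
  qed
  show FE: "F \<subseteq> E" using D(3) by (auto simp: E_def)
  show fixd: "\<phi> x = x" if "x \<in> F" for x using D(3)[OF that] iff[of x x] by simp
  show "subfield E R"
  proof (rule subfieldI'[OF subringI])
    show "E \<subseteq> carrier R" using D(1) by (auto simp: E_def)
    show "\<one> \<in> E" using one FE by auto
    show "\<ominus> x \<in> E" if "x \<in> E" for x using that neg by (auto simp: E_def)
    show "x \<otimes> y \<in> E" "x \<oplus> y \<in> E" if "x \<in> E" "y \<in> E" for x y
      using that D(4,5) unfolding E_def by blast+
    show "inv x \<in> E" if "x \<in> E - {\<zero>}" for x using that D(6) by (auto simp: E_def)
  qed
  show "\<phi> \<in> ring_hom (R\<lparr>carrier := E\<rparr>) R"
  proof (rule ring_hom_memI)
    fix x y assume xy: "x \<in> carrier (R\<lparr>carrier := E\<rparr>)" "y \<in> carrier (R\<lparr>carrier := E\<rparr>)"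
    then have g: "(x, \<phi> x) \<in> G" "(y, \<phi> y) \<in> G" using iff by auto
    show "\<phi> (x \<otimes>\<^bsub>R\<lparr>carrier := E\<rparr>\<^esub> y) = \<phi> x \<otimes> \<phi> y" using D(5)[OF g] iff by auto
    show "\<phi> (x \<oplus>\<^bsub>R\<lparr>carrier := E\<rparr>\<^esub> y) = \<phi> x \<oplus> \<phi> y" using D(4)[OF g] iff by auto
  next
    show "\<phi> x \<in> carrier R" if "x \<in> carrier (R\<lparr>carrier := E\<rparr>)" for x
      using that iff[of x "\<phi> x"] D(2) by auto
    show "\<phi> \<one>\<^bsub>R\<lparr>carrier := E\<rparr>\<^esub> = \<one>" using fixd[OF one] by simp
  qed
qed

text \<open>Map the value of a polynomial at \<open>x\<close> to the value at \<open>y\<close> of its image under the embedding. This is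
  well defined because a polynomial that vanishes at \<open>x\<close> is a multiple of the minimal polynomial,
  whose image vanishes at \<open>y\<close>.\<close>

lemma embedding_graph_extend:
  assumes F: "subfield F R" and G: "embedding_graph F G"
  defines "E \<equiv> Domain G" and "\<phi> \<equiv> \<lambda>x. THE y. (x, y) \<in> G"
  assumes x: "x \<in> carrier R" "algebraic E x" and y: "y \<in> carrier R" "eval (map \<phi> (Irr E x)) y = \<zero>"
  shows "\<exists>G'. embedding_graph F G' \<and> G \<subseteq> G' \<and> (x, y) \<in> G'"
proof -
  note H = embedding_graph_hom[OF F G, folded E_def \<phi>_def]
  note Er = subfieldE(1)[OF H(1)]
  note I = IrrE'[OF H(1) x]
  have Ec: "E \<subseteq> carrier R" using subfieldE(3)[OF H(1)] .
  interpret E: ring "R\<lparr>carrier := E\<rparr>" using subring_is_ring[OF Er] .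
  interpret h: ring_hom_ring "R\<lparr>carrier := E\<rparr>" R \<phi>
    using H(4) by (intro ring_hom_ringI2) (auto intro: ring_axioms E.ring_axioms)
  have pc: "set (map \<phi> p) \<subseteq> carrier R" if "set p \<subseteq> E" for p using that by auto
  have ec: "set p \<subseteq> carrier R" if "set p \<subseteq> E" for p using that Ec by auto
  have add: "eval (map \<phi> (poly_add p q)) y = eval (map \<phi> p) y \<oplus> eval (map \<phi> q) y"
    if "set p \<subseteq> E" "set q \<subseteq> E" for p q
  proof -
    have "set (poly_add p q) \<subseteq> E"
      using E.poly_add_in_carrier[of p q] that by (simp add: poly_add_consistent[OF Er])
    then have "eval (map \<phi> (poly_add p q)) y = eval (normalize (map \<phi> (poly_add p q))) y"
      using eval_normalize[OF pc y(1)] by simp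
    also have "normalize (map \<phi> (poly_add p q)) = poly_add (map \<phi> p) (map \<phi> q)"
      using h.poly_add_hom'[of p q] that by (simp add: poly_add_consistent[OF Er])
    finally show ?thesis using eval_poly_add[OF pc[OF that(1)] pc[OF that(2)] y(1)] by simp
  qed
  have mult: "eval (map \<phi> (poly_mult p q)) y = eval (map \<phi> p) y \<otimes> eval (map \<phi> q) y"
    if "set p \<subseteq> E" "set q \<subseteq> E" for p q
  proof -
    have "set (poly_mult p q) \<subseteq> E"
      using E.poly_mult_in_carrier[of p q] that by (simp add: poly_mult_consistent[OF Er])
    then have "eval (map \<phi> (poly_mult p q)) y = eval (normalize (map \<phi> (poly_mult p q))) y"
      using eval_normalize[OF pc y(1)] by simp
    also have "normalize (map \<phi> (poly_mult p q)) = poly_mult (map \<phi> p) (map \<phi> q)"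
      using h.poly_mult_hom'[of p q] that by (simp add: poly_mult_consistent[OF Er])
    finally show ?thesis using eval_poly_mult[OF pc[OF that(1)] pc[OF that(2)] y(1)] by simp
  qed
  define G' where "G' = {(eval p x, eval (map \<phi> p) y) | p. set p \<subseteq> E}"
  have GI: "(eval p x, eval (map \<phi> p) y) \<in> G'" if "set p \<subseteq> E" for p using that by (auto simp: G'_def)
  have zero: "eval (map \<phi> p) y = \<zero>" if p: "set p \<subseteq> E" "eval p x = \<zero>" for p
  proof -
    let ?q = "normalize p"
    have q: "?q \<in> carrier (E[X])" using normalize_gives_polynomial[OF p(1)] by (simp add: univ_poly_carrier)
    have qe: "eval ?q x = \<zero>" using eval_normalize[OF ec[OF p(1)] x(1)] p(2) by simp
    have "Irr E x pdivides ?q"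
      using Irr_minimal[OF H(1) x(1) _ q qe] x(2) by (simp add: over_def)
    then have "Irr E x divides\<^bsub>E[X]\<^esub> ?q" using pdivides_iff_shell[OF H(1) I(1) q] by simp
    then obtain r where r: "r \<in> carrier (E[X])" "?q = poly_mult (Irr E x) r"
      unfolding factor_def by (auto simp: univ_poly_mult)
    have rE: "set r \<subseteq> E" using r(1) polynomial_incl univ_poly_carrier by blast
    have "eval (map \<phi> ?q) y = \<zero>"
      unfolding r(2) using mult[OF I(5) rE] y pc[OF rE] by (simp add: eval_in_carrier)
    moreover have "eval (map \<phi> ?q) y = eval (map \<phi> p) y"
    proof -
      have "map \<phi> p = map \<phi> (replicate (length p - length ?q) \<zero> @ ?q)"
        by (rule arg_cong[OF normalize_trick])
      also have "\<dots> = replicate (length p - length ?q) \<zero> @ map \<phi> ?q"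
        using h.hom_zero by simp
      finally have "map \<phi> p = replicate (length p - length ?q) \<zero> @ map \<phi> ?q" .
      moreover have "set ?q \<subseteq> E" using q polynomial_incl univ_poly_carrier by blast
      ultimately show ?thesis using eval_replicate[OF pc y(1), of ?q] by simp
    qed
    ultimately show ?thesis by simp
  qed
  have one: "\<one> \<in> F" and z: "\<zero> \<in> F" by (rule subringE[OF subfieldE(1)[OF F]])+
  have m1: "\<ominus> \<one> \<in> F" by (rule subringE(5)[OF subfieldE(1)[OF F] one])
  have H3: "(x, y) \<in> G \<longleftrightarrow> x \<in> E \<and> y = \<phi> x" for x y using H(3)[of x y] by (simp add: \<phi>_def)
  have fixd: "\<phi> k = k" if "k \<in> F" for k using H(5)[OF that] by (simp add: \<phi>_def)
  have GG: "G \<subseteq> G'"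
  proof (rule subrelI)
    fix a b assume "(a, b) \<in> G"
    then have a: "a \<in> E" "b = \<phi> a" using H3 by auto
    then have "a \<in> carrier R" "b \<in> carrier R" using Ec h.hom_closed[of a] by auto
    then show "(a, b) \<in> G'" using GI[of "[a]"] a x(1) y(1) by simp
  qed
  have xy: "(x, y) \<in> G'"
  proof -
    have "set [\<one>, \<zero>] \<subseteq> E" using one z H(2) by auto
    from GI[OF this] show ?thesis using fixd[OF one] fixd[OF z] x(1) y(1) by simp
  qed
  have addG: "(a \<oplus> a', b \<oplus> b') \<in> G'" and multG: "(a \<otimes> a', b \<otimes> b') \<in> G'"
    if ab: "(a, b) \<in> G'" "(a', b') \<in> G'" for a b a' b'
  proof -
    obtain p q where p: "set p \<subseteq> E" "a = eval p x" "b = eval (map \<phi> p) y"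
      and q: "set q \<subseteq> E" "a' = eval q x" "b' = eval (map \<phi> q) y"
      using ab unfolding G'_def by blast
    have "set (poly_add p q) \<subseteq> E" "set (poly_mult p q) \<subseteq> E"
      using E.poly_add_in_carrier[of p q] E.poly_mult_in_carrier[of p q] p q
      by (auto simp: poly_add_consistent[OF Er] poly_mult_consistent[OF Er])
    from this[THEN GI] show "(a \<oplus> a', b \<oplus> b') \<in> G'" "(a \<otimes> a', b \<otimes> b') \<in> G'"
      unfolding p(2,3) q(2,3) add[OF p(1) q(1)] mult[OF p(1) q(1)]
        eval_poly_add[OF ec[OF p(1)] ec[OF q(1)] x(1)] eval_poly_mult[OF ec[OF p(1)] ec[OF q(1)] x(1)] by auto
  qed
  have carr: "a \<in> carrier R" "b \<in> carrier R" if "(a, b) \<in> G'" for a b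
    using that eval_in_carrier[OF ec x(1)] eval_in_carrier[OF pc y(1)] unfolding G'_def by auto
  have z0: "b = \<zero>" if "(\<zero>, b) \<in> G'" for b
  proof -
    have "\<exists>p. (\<zero>, b) = (eval p x, eval (map \<phi> p) y) \<and> set p \<subseteq> E"
      using that unfolding G'_def mem_Collect_eq .
    then obtain p where p: "set p \<subseteq> E" "eval p x = \<zero>" "b = eval (map \<phi> p) y"
      unfolding prod.inject by metis
    show ?thesis using zero[OF p(1,2)] p(3) by simp
  qed
  have S: "subfield (simple_extension E x) R"
    using simple_extension_is_subfield[OF H(1) x(1)] x(2) by (simp add: over_def)
  have invG: "(inv a, inv b) \<in> G'" if ab: "(a, b) \<in> G'" and a0: "a \<noteq> \<zero>" for a b
  proof -
    have img: "simple_extension E x = (\<lambda>p. eval p x) ` carrier (E[X])"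
      using simple_extension_as_eval_img[OF Ec x(1)] .
    obtain p where p: "set p \<subseteq> E" "a = eval p x" using ab unfolding G'_def by blast
    have "a = eval (normalize p) x" using p eval_normalize[OF ec[OF p(1)] x(1)] by simp
    moreover have "normalize p \<in> carrier (E[X])"
      using normalize_gives_polynomial[OF p(1)] by (simp add: univ_poly_carrier)
    ultimately have "a \<in> simple_extension E x" unfolding img by blast
    then have "inv a \<in> simple_extension E x" using subfield_m_inv(1)[OF S] a0 by blast
    then obtain q where q: "q \<in> carrier (E[X])" "inv a = eval q x" unfolding img by blast
    have "set q \<subseteq> E" using q(1) polynomial_incl univ_poly_carrier by blast
    then have g: "(inv a, eval (map \<phi> q) y) \<in> G'" using GI[of q] q(2) by simp
    let ?c = "eval (map \<phi> q) y"
    have "a \<otimes> inv a = \<one>" using a0 carr(1)[OF ab] field_Units by (intro Units_r_inv) auto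
    then have "(\<one>, b \<otimes> ?c) \<in> G'" using multG[OF ab g] by simp
    moreover have "(\<ominus> \<one>, \<ominus> \<one>) \<in> G'" using GG embedding_graphD(3)[OF G m1] by blast
    ultimately have "(\<one> \<oplus> \<ominus> \<one>, b \<otimes> ?c \<oplus> \<ominus> \<one>) \<in> G'" by (rule addG)
    then have "b \<otimes> ?c \<oplus> \<ominus> \<one> = \<zero>" using z0 by (simp add: r_neg)
    then have "b \<otimes> ?c = \<one>" using carr(2)[OF ab] carr(2)[OF g] by (simp add: r_right_minus_eq flip: a_minus_def)
    then have "inv b = ?c" using carr(2)[OF ab] carr(2)[OF g] by (intro comm_inv_char) auto
    then show ?thesis using g by simp
  qed
  have "embedding_graph F G'"
    unfolding embedding_graph_def
  proof (intro conjI allI impI ballI)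
    show "G' \<subseteq> carrier R \<times> carrier R" using carr by auto
    show "(k, k) \<in> G'" if "k \<in> F" for k using GG embedding_graphD(3)[OF G that] by blast
    show "(a \<oplus> a', b \<oplus> b') \<in> G'" if "(a, b) \<in> G' \<and> (a', b') \<in> G'" for a b a' b'
      using addG that by simp
    show "(a \<otimes> a', b \<otimes> b') \<in> G'" if "(a, b) \<in> G' \<and> (a', b') \<in> G'" for a b a' b'
      using multG that by simp
    show "(inv a, inv b) \<in> G'" if "(a, b) \<in> G' \<and> a \<noteq> \<zero>" for a b using invG that by simp
    show "b = \<zero>" if "(\<zero>, b) \<in> G'" for b using z0[OF that] .
  qed
  then show ?thesis using GG xy by blast
qed

end

context algebraically_closed
begin

lemma exists_root_map_Irr:
  assumes "subfield E L" "\<phi> \<in> ring_hom (L\<lparr>carrier := E\<rparr>) L" "x \<in> carrier L" "algebraic E x"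
  obtains y where "y \<in> carrier L" "eval (map \<phi> (Irr E x)) y = \<zero>"
proof -
  note I = IrrE'[OF assms(1,3,4)]
  interpret E: ring "L\<lparr>carrier := E\<rparr>" using subring_is_ring[OF subfieldE(1)[OF assms(1)]] .
  interpret h: ring_hom_ring "L\<lparr>carrier := E\<rparr>" L \<phi>
    using assms(2) by (intro ring_hom_ringI2) (auto intro: ring_axioms E.ring_axioms)
  have "set (map \<phi> (Irr E x)) \<subseteq> carrier L" using I(5) by auto
  moreover have "hd (map \<phi> (Irr E x)) = \<one>" using I(3,7) h.hom_one by (simp add: hd_map)
  ultimately have "map \<phi> (Irr E x) \<in> carrier (poly_ring L)"
    by (simp add: polynomial_def flip: univ_poly_carrier)
  then show thesis using exists_root_of_positive_degree[of "map \<phi> (Irr E x)"] I(8) that by auto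
qed

text \<open>A maximal embedding that sends \<open>x\<close> to \<open>y\<close> is defined everywhere, since minimal polynomials have roots
  in the algebraically closed field. It is onto, since it permutes the finitely many roots of each
  minimal polynomial over \<open>F\<close>.\<close>

lemma conjugate_automorphism:
  assumes F: "subfield F L" and alg: "\<And>x. x \<in> carrier L \<Longrightarrow> algebraic F x"
    and x: "x \<in> carrier L" and y: "y \<in> carrier L" "eval (Irr F x) y = \<zero>"
  shows "\<exists>\<sigma>. \<sigma> \<in> ring_iso L L \<and> (\<forall>k\<in>F. \<sigma> k = k) \<and> \<sigma> x = y"
proof -
  have Fc: "F \<subseteq> carrier L" using subfieldE(3)[OF F] .
  have g0: "embedding_graph F (Id_on F)"
    using Fc subringE(6,7)[OF subfieldE(1)[OF F]] subfield_m_inv(1)[OF F]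
    unfolding embedding_graph_def by auto
  have the0: "(THE y. (x, y) \<in> Id_on F) = x" if "x \<in> F" for x using that by (intro the_equality) auto
  have "map (\<lambda>x. THE y. (x, y) \<in> Id_on F) (Irr F x) = Irr F x"
    using IrrE'(5)[OF F x alg[OF x]] the0 by (intro map_idI) auto
  then obtain G1 where G1: "embedding_graph F G1" "(x, y) \<in> G1"
    using embedding_graph_extend[OF F g0, of x y] x y alg[OF x] by (auto simp: Domain_Id_on)
  let ?A = "{G. embedding_graph F G \<and> (x, y) \<in> G}"
  have "\<exists>M\<in>?A. \<forall>Z\<in>?A. M \<subseteq> Z \<longrightarrow> Z = M"
  proof (rule subset_Zorn_nonempty)
    show "?A \<noteq> {}" using G1 by blast
    fix C assume ne: "C \<noteq> {}" and ch: "subset.chain ?A C"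
    have CA: "\<And>G. G \<in> C \<Longrightarrow> embedding_graph F G \<and> (x, y) \<in> G"
      using ch by (auto simp: subset.chain_def)
    have two: "\<exists>G\<in>C. p \<in> G \<and> q \<in> G" if "p \<in> \<Union>C" "q \<in> \<Union>C" for p q
    proof -
      obtain G G' where "G \<in> C" "p \<in> G" "G' \<in> C" "q \<in> G'" using \<open>p \<in> \<Union>C\<close> \<open>q \<in> \<Union>C\<close> by blast
      moreover from this have "G \<subseteq> G' \<or> G' \<subseteq> G" using ch by (auto simp: subset_chain_def)
      ultimately show ?thesis by blast
    qed
    have "embedding_graph F (\<Union>C)"
      unfolding embedding_graph_def
    proof (intro conjI allI impI ballI)
      show "\<Union>C \<subseteq> carrier L \<times> carrier L" using CA embedding_graphD(1,2) by fast
      show "(k, k) \<in> \<Union>C" if "k \<in> F" for k using CA embedding_graphD(3) that ne by blast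
      show "b = \<zero>" if "(\<zero>, b) \<in> \<Union>C" for b using CA embedding_graphD(7) that by blast
      show "(inv a, inv b) \<in> \<Union>C" if "(a, b) \<in> \<Union>C \<and> a \<noteq> \<zero>" for a b
        using CA embedding_graphD(6) that by blast
      fix a b a' b' assume ab: "(a, b) \<in> \<Union>C \<and> (a', b') \<in> \<Union>C"
      then obtain G where G: "G \<in> C" "(a, b) \<in> G" "(a', b') \<in> G" using two by blast
      show "(a \<oplus> a', b \<oplus> b') \<in> \<Union>C" "(a \<otimes> a', b \<otimes> b') \<in> \<Union>C"
        using embedding_graphD(4,5)[of F G, OF _ G(2,3)] CA[OF G(1)] G(1) by blast+
    qed
    then show "\<Union>C \<in> ?A" using CA ne by blast
  qed
  then obtain M where M: "embedding_graph F M" "(x, y) \<in> M"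
    and max: "\<And>Z. embedding_graph F Z \<Longrightarrow> M \<subseteq> Z \<Longrightarrow> Z = M" by blast
  let ?E = "Domain M" and ?f = "\<lambda>x. THE y. (x, y) \<in> M"
  note H = embedding_graph_hom[OF F M(1)]
  have E: "?E = carrier L"
  proof
    show "?E \<subseteq> carrier L" using subfieldE(3)[OF H(1)] .
    show "carrier L \<subseteq> ?E"
    proof
      fix z assume z: "z \<in> carrier L"
      have za: "algebraic ?E z" using algebraic_mono[OF H(2)] alg[OF z] by (simp add: over_def)
      obtain w where w: "w \<in> carrier L" "eval (map ?f (Irr ?E z)) w = \<zero>"
        using exists_root_map_Irr[OF H(1,4) z za] by blast
      then obtain G' where "embedding_graph F G'" "M \<subseteq> G'" "(z, w) \<in> G'"
        using embedding_graph_extend[OF F M(1) z za w] by blast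
      then show "z \<in> ?E" using max by blast
    qed
  qed
  define f where "f = ?f"
  have L: "L\<lparr>carrier := carrier L\<rparr> = L" by simp
  have hom: "f \<in> ring_hom L L" using H(4) unfolding E L f_def .
  have fixd: "f k = k" if "k \<in> F" for k using H(5)[OF that] by (simp add: f_def)
  interpret h: ring_hom_ring L L f
    using hom by (intro ring_hom_ringI2) (auto intro: ring_axioms)
  have inj: "inj_on f (carrier L)"
    using h.img_is_subfield(1)[OF carrier_is_subfield] one_not_zero by blast
  have surj: "z \<in> f ` carrier L" if z: "z \<in> carrier L" for z
  proof -
    note I = IrrE'[OF F z alg[OF z]]
    let ?R = "{w \<in> carrier L. eval (Irr F z) w = \<zero>}"
    have mp: "map f (Irr F z) = Irr F z" using I(5) fixd by (intro map_idI) auto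
    have "f w \<in> ?R" if "w \<in> ?R" for w
      using h.eval_hom'[OF _ I(9), of w] that mp by simp
    then have "f ` ?R \<subseteq> ?R" by blast
    moreover have "finite ?R" using finite_roots(1)[OF I(6,7)] .
    moreover have "inj_on f ?R" using inj by (rule inj_on_subset) auto
    ultimately have "f ` ?R = ?R" by (simp add: endo_inj_surj)
    moreover have "z \<in> ?R" using z I(4) by simp
    ultimately show ?thesis by blast
  qed
  have "f ` carrier L = carrier L" using surj h.hom_closed by blast
  then have "f \<in> ring_iso L L"
    using hom inj unfolding ring_iso_def bij_betw_def by simp
  moreover have "f x = y"
    using H(3)[of x y] M(2) by (simp add: f_def)
  ultimately show ?thesis using fixd by blast
qed

end

section \<open>The valuation ring and the residue field\<close>

context valued_field
begin

abbreviation val_ring :: "'a set" where "val_ring \<equiv> valuation_ring (carrier R)"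
abbreviation val_ideal :: "'a set" where "val_ideal \<equiv> valuation_ideal (carrier R)"

lemma mem_val_ring: "x \<in> val_ring \<longleftrightarrow> x \<in> carrier R \<and> (x = \<zero> \<or> 0 \<le> \<nu> x)"
  by (simp add: valuation_ring_def)

lemma mem_val_ideal: "x \<in> val_ideal \<longleftrightarrow> x \<in> carrier R \<and> (x = \<zero> \<or> 0 < \<nu> x)"
  by (simp add: valuation_ideal_def)

lemma val_one [simp]: "\<nu> \<one> = 0"
  using val_mult[of \<one> \<one>] by simp

lemma val_neg [simp]: "x \<in> carrier R \<Longrightarrow> \<nu> (\<ominus> x) = \<nu> x"
proof (cases "x = \<zero>")
  case False
  assume x: "x \<in> carrier R"
  have n0: "\<ominus> \<one> \<noteq> \<zero>" by simp
  have "\<nu> (\<ominus> \<one>) + \<nu> (\<ominus> \<one>) = 0"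
    using val_mult[of "\<ominus> \<one>" "\<ominus> \<one>"] n0 by (simp add: l_minus)
  then have "\<nu> (\<ominus> \<one>) = 0" by (simp add: double_zero)
  then show ?thesis
    using val_mult[of "\<ominus> \<one>" x] x False n0 by (simp add: l_minus)
qed simp

lemma inv_props:
  assumes "x \<in> carrier R" "x \<noteq> \<zero>"
  shows inv_closed: "inv x \<in> carrier R" and r_inv': "x \<otimes> inv x = \<one>"
    and l_inv': "inv x \<otimes> x = \<one>" and inv_nonzero: "inv x \<noteq> \<zero>"
proof -
  have u: "x \<in> Units R" using assms by (simp add: field_Units)
  show c: "inv x \<in> carrier R" and r: "x \<otimes> inv x = \<one>" and "inv x \<otimes> x = \<one>"
    using u by (rule Units_inv_closed Units_r_inv Units_l_inv)+
  show "inv x \<noteq> \<zero>" using r assms(1) by (intro notI) simp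
qed

lemma val_inv: "x \<in> carrier R \<Longrightarrow> x \<noteq> \<zero> \<Longrightarrow> \<nu> (inv x) = - \<nu> x"
  using val_mult[of x "inv x"] by (simp add: inv_closed inv_nonzero r_inv' eq_neg_iff_add_eq_0 add.commute)

lemma val_add_less:
  assumes "x \<in> carrier R" "x \<noteq> \<zero>" "y \<in> carrier R" "y = \<zero> \<or> \<nu> x < \<nu> y"
  shows "x \<oplus> y \<noteq> \<zero>" "\<nu> (x \<oplus> y) = \<nu> x"
proof -
  show n: "x \<oplus> y \<noteq> \<zero>"
  proof
    assume "x \<oplus> y = \<zero>"
    then have "y = \<ominus> x" using assms(1,3) by (metis minus_equality add.m_comm)
    then show False using assms by auto
  qed
  show "\<nu> (x \<oplus> y) = \<nu> x"
  proof (cases "y = \<zero>")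
    case False
    then have l: "\<nu> x < \<nu> y" using assms by simp
    have 1: "\<nu> x \<le> \<nu> (x \<oplus> y)" using val_add[of x y] assms False n l by simp
    have e: "x = (x \<oplus> y) \<oplus> \<ominus> y" using assms by (simp add: a_assoc r_neg)
    have "min (\<nu> (x \<oplus> y)) (\<nu> (\<ominus> y)) \<le> \<nu> ((x \<oplus> y) \<oplus> \<ominus> y)"
      using assms False n e by (intro val_add) auto
    then have "min (\<nu> (x \<oplus> y)) (\<nu> y) \<le> \<nu> x" using e assms by simp
    then show ?thesis using 1 l by (auto simp: min_def split: if_splits)
  qed (use assms in simp)
qed

lemma val_ring_subring: "subring val_ring R"
proof (rule subringI)
  show "val_ring \<subseteq> carrier R" "\<one> \<in> val_ring" by (auto simp: mem_val_ring)
  show "\<ominus> x \<in> val_ring" if "x \<in> val_ring" for x using that by (auto simp: mem_val_ring)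
  show "x \<otimes> y \<in> val_ring" if "x \<in> val_ring" "y \<in> val_ring" for x y
    using that val_mult[of x y] by (cases "x = \<zero> \<or> y = \<zero>") (auto simp: mem_val_ring)
  show "x \<oplus> y \<in> val_ring" if "x \<in> val_ring" "y \<in> val_ring" for x y
  proof (cases "x = \<zero> \<or> y = \<zero> \<or> x \<oplus> y = \<zero>")
    case False
    then have "0 \<le> \<nu> x" "0 \<le> \<nu> y" using that by (auto simp: mem_val_ring)
    then have "0 \<le> min (\<nu> x) (\<nu> y)" by simp
    also have "\<dots> \<le> \<nu> (x \<oplus> y)" using that False by (intro val_add) (auto simp: mem_val_ring)
    finally show ?thesis using that by (auto simp: mem_val_ring)
  qed (use that in \<open>auto simp: mem_val_ring\<close>)
qed

lemmas val_ring_closed = subringE(2,3,5,6,7)[OF val_ring_subring]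
lemma val_ring_carrier: "x \<in> val_ring \<Longrightarrow> x \<in> carrier R" by (simp add: mem_val_ring)

lemma val_ideal_closed:
  shows "\<zero> \<in> val_ideal" "x \<in> val_ideal \<Longrightarrow> y \<in> val_ideal \<Longrightarrow> x \<oplus> y \<in> val_ideal"
    "x \<in> val_ideal \<Longrightarrow> \<ominus> x \<in> val_ideal" "x \<in> val_ideal \<Longrightarrow> y \<in> val_ring \<Longrightarrow> x \<otimes> y \<in> val_ideal"
    "x \<in> val_ideal \<Longrightarrow> y \<in> val_ring \<Longrightarrow> y \<otimes> x \<in> val_ideal"
    "x \<in> val_ideal \<Longrightarrow> y \<in> val_ideal \<Longrightarrow> x \<ominus> y \<in> val_ideal"
    "x \<in> val_ideal \<Longrightarrow> x \<in> val_ring" "x \<in> val_ideal \<Longrightarrow> x \<in> carrier R" "\<one> \<notin> val_ideal"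
proof -
  show "\<zero> \<in> val_ideal" "\<one> \<notin> val_ideal" by (auto simp: mem_val_ideal)
  show n: "x \<in> val_ideal \<Longrightarrow> \<ominus> x \<in> val_ideal" for x by (auto simp: mem_val_ideal)
  show "x \<in> val_ideal \<Longrightarrow> x \<in> val_ring" "x \<in> val_ideal \<Longrightarrow> x \<in> carrier R"
    by (auto simp: mem_val_ideal mem_val_ring)
  show m: "x \<otimes> y \<in> val_ideal" if "x \<in> val_ideal" "y \<in> val_ring" for x y
    using that val_mult[of x y] by (cases "x = \<zero> \<or> y = \<zero>") (auto simp: mem_val_ideal mem_val_ring add_pos_nonneg)
  show "y \<otimes> x \<in> val_ideal" if "x \<in> val_ideal" "y \<in> val_ring" for x y
  proof -
    have "y \<otimes> x = x \<otimes> y" using that by (intro m_comm) (auto simp: mem_val_ideal mem_val_ring)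
    then show ?thesis using m[OF that] by simp
  qed
  show a: "x \<oplus> y \<in> val_ideal" if "x \<in> val_ideal" "y \<in> val_ideal" for x y
  proof (cases "x = \<zero> \<or> y = \<zero> \<or> x \<oplus> y = \<zero>")
    case False
    then have "0 < \<nu> x" "0 < \<nu> y" using that by (auto simp: mem_val_ideal)
    then have "0 < min (\<nu> x) (\<nu> y)" by simp
    also have "\<dots> \<le> \<nu> (x \<oplus> y)" using that False by (intro val_add) (auto simp: mem_val_ideal)
    finally show ?thesis using that by (auto simp: mem_val_ideal)
  qed (use that in \<open>auto simp: mem_val_ideal\<close>)
  show "x \<ominus> y \<in> val_ideal" if "x \<in> val_ideal" "y \<in> val_ideal" for x y
    using a[OF that(1) n[OF that(2)]] by (simp add: a_minus_def)
qed

lemma unit_iff: "x \<in> val_ring - val_ideal \<longleftrightarrow> x \<in> carrier R \<and> x \<noteq> \<zero> \<and> \<nu> x = 0"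
  by (auto simp: mem_val_ring mem_val_ideal)

lemma unit_inv: "x \<in> val_ring - val_ideal \<Longrightarrow> inv x \<in> val_ring - val_ideal"
  unfolding unit_iff by (auto simp: inv_closed inv_nonzero val_inv)

lemma inv_mem_val_ideal: "x \<in> carrier R \<Longrightarrow> x \<notin> val_ring \<Longrightarrow> inv x \<in> val_ideal"
  by (auto simp: mem_val_ring mem_val_ideal inv_closed val_inv)

definition residue :: "'a \<Rightarrow> 'a set"
  where "residue x = val_ideal +> x"

lemma val_ring_ring: "cring (R\<lparr>carrier := val_ring\<rparr>)"
proof -
  have "subcring val_ring R"
    using m_comm val_ring_carrier by (intro subcringI[OF val_ring_subring]) blast
  then show ?thesis using subcring_iff[OF subringE(1)[OF val_ring_subring]] by simp
qed

lemma val_ideal_ideal: "ideal val_ideal (R\<lparr>carrier := val_ring\<rparr>)"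
proof (rule idealI)
  interpret V: cring "R\<lparr>carrier := val_ring\<rparr>" by (rule val_ring_ring)
  show "ring (R\<lparr>carrier := val_ring\<rparr>)" by (rule V.ring_axioms)
  show "subgroup val_ideal (add_monoid (R\<lparr>carrier := val_ring\<rparr>))"
  proof (rule V.add.subgroupI)
    fix a assume a: "a \<in> val_ideal"
    have "\<ominus>\<^bsub>R\<lparr>carrier := val_ring\<rparr>\<^esub> a = \<ominus> a"
      using a val_ideal_closed(3,7,8)[OF a] val_ideal_closed(7)[OF val_ideal_closed(3)[OF a]]
      by (intro V.minus_equality) (auto simp: l_neg)
    then show "\<ominus>\<^bsub>R\<lparr>carrier := val_ring\<rparr>\<^esub> a \<in> val_ideal" using val_ideal_closed(3)[OF a] by simp
  qed (use val_ideal_closed in auto)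
qed (use val_ideal_closed in auto)

lemma residue_alt: "residue = (\<lambda>x. val_ideal +>\<^bsub>R\<lparr>carrier := val_ring\<rparr>\<^esub> x)"
  by (simp add: fun_eq_iff residue_def a_r_coset_def r_coset_def)

lemma residue_hom: "residue \<in> ring_hom (R\<lparr>carrier := val_ring\<rparr>) residue_ring"
  using ideal.rcos_ring_hom[OF val_ideal_ideal] by (simp add: residue_alt residue_ring_def)

lemma residue_ring_cring: "cring residue_ring"
  using ideal.quotient_is_cring[OF val_ideal_ideal val_ring_ring] by (simp add: residue_ring_def)

lemma residue_eq_iff:
  assumes "x \<in> val_ring" "y \<in> val_ring"
  shows "residue x = residue y \<longleftrightarrow> x \<ominus> y \<in> val_ideal"
proof -
  interpret V: cring "R\<lparr>carrier := val_ring\<rparr>" by (rule val_ring_ring)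
  have "\<ominus>\<^bsub>R\<lparr>carrier := val_ring\<rparr>\<^esub> y = \<ominus> y"
    using assms val_ring_carrier val_ring_closed by (intro V.minus_equality) (auto simp: l_neg)
  then have "x \<ominus>\<^bsub>R\<lparr>carrier := val_ring\<rparr>\<^esub> y = x \<ominus> y" by (simp add: a_minus_def)
  then show ?thesis
    using ring.quotient_eq_iff_same_a_r_cos[OF V.ring_axioms val_ideal_ideal, of x y] assms by (auto simp: residue_alt)
qed

lemma residue_ring_carrier: "carrier residue_ring = residue ` val_ring"
  by (auto simp: residue_ring_def FactRing_def A_RCOSETS_def' residue_alt)

lemma residue_ring_hom_ring: "ring_hom_ring (R\<lparr>carrier := val_ring\<rparr>) residue_ring residue"
  using val_ring_ring residue_ring_cring residue_hom
  by (intro ring_hom_ringI2) (auto simp: cring_def)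

lemma residue_simps:
  shows residue_one: "residue \<one> = \<one>\<^bsub>residue_ring\<^esub>" and residue_zero: "residue \<zero> = \<zero>\<^bsub>residue_ring\<^esub>"
    and residue_add: "\<And>x y. \<lbrakk> x \<in> val_ring; y \<in> val_ring \<rbrakk> \<Longrightarrow> residue (x \<oplus> y) = residue x \<oplus>\<^bsub>residue_ring\<^esub> residue y"
    and residue_mult: "\<And>x y. \<lbrakk> x \<in> val_ring; y \<in> val_ring \<rbrakk> \<Longrightarrow> residue (x \<otimes> y) = residue x \<otimes>\<^bsub>residue_ring\<^esub> residue y"
proof -
  interpret h: ring_hom_ring "R\<lparr>carrier := val_ring\<rparr>" residue_ring residue
    by (rule residue_ring_hom_ring)
  show "residue \<one> = \<one>\<^bsub>residue_ring\<^esub>" "residue \<zero> = \<zero>\<^bsub>residue_ring\<^esub>"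
    using h.hom_one h.hom_zero by simp_all
  show "residue (x \<oplus> y) = residue x \<oplus>\<^bsub>residue_ring\<^esub> residue y"
    "residue (x \<otimes> y) = residue x \<otimes>\<^bsub>residue_ring\<^esub> residue y" if "x \<in> val_ring" "y \<in> val_ring" for x y
    using h.hom_add[of x y] h.hom_mult[of x y] that by simp_all
qed

lemma residue_zero_iff: "x \<in> val_ring \<Longrightarrow> residue x = \<zero>\<^bsub>residue_ring\<^esub> \<longleftrightarrow> x \<in> val_ideal"
  using residue_eq_iff[of x \<zero>] val_ring_closed(1) val_ring_carrier[of x]
  by (simp add: a_minus_def residue_zero)

lemma residue_ring_field: "field residue_ring"
proof (rule cring.cring_fieldI2[OF residue_ring_cring])
  show "\<zero>\<^bsub>residue_ring\<^esub> \<noteq> \<one>\<^bsub>residue_ring\<^esub>"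
    using residue_zero_iff[OF val_ring_closed(2)] val_ideal_closed(9) residue_one by auto
  fix a assume a: "a \<in> carrier residue_ring" "a \<noteq> \<zero>\<^bsub>residue_ring\<^esub>"
  then obtain x where x: "x \<in> val_ring" "a = residue x" by (auto simp: residue_ring_carrier)
  then have u: "x \<in> val_ring - val_ideal" using a residue_zero_iff[of x] by auto
  then have i: "inv x \<in> val_ring" using unit_inv by blast
  have "x \<otimes> inv x = \<one>" using u unfolding unit_iff by (simp add: r_inv')
  then have "a \<otimes>\<^bsub>residue_ring\<^esub> residue (inv x) = \<one>\<^bsub>residue_ring\<^esub>"
    using residue_mult[OF x(1) i] x(2) residue_one by simp
  then show "\<exists>b\<in>carrier residue_ring. a \<otimes>\<^bsub>residue_ring\<^esub> b = \<one>\<^bsub>residue_ring\<^esub>"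
    using i by (auto simp: residue_ring_carrier)
qed

end

sublocale valued_field \<subseteq> k: field residue_ring
  by (rule residue_ring_field)

context valued_field
begin

lemma residue_closed: "x \<in> val_ring \<Longrightarrow> residue x \<in> carrier residue_ring"
  by (auto simp: residue_ring_carrier)

lemma residue_field_alt: "residue_field F = residue ` (valuation_ring F)"
  by (simp add: residue_field_def residue_def)

lemma mem_valuation_ring: "subfield F R \<Longrightarrow> x \<in> valuation_ring F \<longleftrightarrow> x \<in> F \<and> x \<in> val_ring"
  using subfieldE(3)[of F R] by (auto simp: valuation_ring_def subset_iff)

lemma pow_val_ring: "x \<in> val_ring \<Longrightarrow> x [^] (n::nat) \<in> val_ring"
  using val_ring_closed by (induction n) auto

lemma residue_field_subfield:
  assumes F: "subfield F R" shows "subfield (residue_field F) residue_ring"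
proof (rule k.subfieldI'[OF k.subringI])
  note S = subringE[OF subfieldE(1)[OF F]]
  let ?V = "valuation_ring F"
  have V: "x \<in> ?V \<longleftrightarrow> x \<in> F \<and> x \<in> val_ring" for x by (rule mem_valuation_ring[OF F])
  have mem: "residue x \<in> residue_field F" if "x \<in> F" "x \<in> val_ring" for x
    using that V by (auto simp: residue_field_alt)
  show "residue_field F \<subseteq> carrier residue_ring" using V residue_closed by (auto simp: residue_field_alt)
  show "\<one>\<^bsub>residue_ring\<^esub> \<in> residue_field F"
    using mem[OF S(3) val_ring_closed(2)] residue_one by simp
  fix a b assume "a \<in> residue_field F"  "b \<in> residue_field F"
  then obtain x y where x: "a = residue x" "x \<in> F" "x \<in> val_ring" and y: "b = residue y" "y \<in> F" "y \<in> val_ring"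
    using V by (auto simp: residue_field_alt)
  have nx: "\<ominus> x \<in> F" "\<ominus> x \<in> val_ring" using S(5) x val_ring_closed by auto
  have "residue x \<oplus>\<^bsub>residue_ring\<^esub> residue (\<ominus> x) = \<zero>\<^bsub>residue_ring\<^esub>"
    using residue_add[OF x(3) nx(2)] val_ring_carrier[OF x(3)] residue_zero by (simp add: r_neg)
  then have "\<ominus>\<^bsub>residue_ring\<^esub> a = residue (\<ominus> x)"
    using x nx residue_closed by (intro k.minus_equality) (auto simp: k.a_comm)
  then show "\<ominus>\<^bsub>residue_ring\<^esub> a \<in> residue_field F" using mem nx by simp
  show "a \<otimes>\<^bsub>residue_ring\<^esub> b \<in> residue_field F"
    using mem[of "x \<otimes> y"] S(6) x y val_ring_closed residue_mult by simp
  show "a \<oplus>\<^bsub>residue_ring\<^esub> b \<in> residue_field F"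
    using mem[of "x \<oplus> y"] S(7) x y val_ring_closed residue_add by simp
next
  fix a assume "a \<in> residue_field F - {\<zero>\<^bsub>residue_ring\<^esub>}"
  then obtain x where x: "a = residue x" "x \<in> F" "x \<in> val_ring" "x \<notin> val_ideal"
    using mem_valuation_ring[OF F] residue_zero_iff by (auto simp: residue_field_alt)
  then have i: "inv x \<in> val_ring" using unit_inv[of x] by blast
  have x0: "x \<noteq> \<zero>" using x val_ideal_closed(1) by auto
  then have iF: "inv x \<in> F" using subfield_m_inv(1)[OF F] x by simp
  have "x \<otimes> inv x = \<one>" using x x0 val_ring_carrier by (simp add: r_inv')
  then have "a \<otimes>\<^bsub>residue_ring\<^esub> residue (inv x) = \<one>\<^bsub>residue_ring\<^esub>"
    using residue_mult[OF x(3) i] x(1) residue_one by simp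
  then have "inv\<^bsub>residue_ring\<^esub> a = residue (inv x)"
    using x i residue_closed by (intro k.comm_inv_char) auto
  then show "inv\<^bsub>residue_ring\<^esub> a \<in> residue_field F"
    using i iF mem_valuation_ring[OF F] by (auto simp: residue_field_alt)
qed

lemma residue_field_mono: "F \<subseteq> E \<Longrightarrow> residue_field F \<subseteq> residue_field E"
  by (auto simp: residue_field_alt valuation_ring_def)

lemma residue_field_carrier: "residue_field (carrier R) = carrier residue_ring"
  by (simp add: residue_field_alt residue_ring_carrier)

lemma residue_eval:
  assumes "set p \<subseteq> val_ring" "x \<in> val_ring"
  shows "residue (eval p x) = k.eval (map residue p) (residue x)"
proof -
  interpret h: ring_hom_ring "R\<lparr>carrier := val_ring\<rparr>" residue_ring residue
    by (rule residue_ring_hom_ring)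
  show ?thesis using h.eval_hom'[of x p] assms eval_consistent[OF val_ring_subring] by simp
qed

lemma eval_val_ring: "set p \<subseteq> val_ring \<Longrightarrow> x \<in> val_ring \<Longrightarrow> eval p x \<in> val_ring"
proof (induction p)
  case (Cons a p)
  have "x [^] length p \<in> val_ring" using pow_val_ring Cons by blast
  then show ?case using Cons val_ring_closed by simp
qed (use val_ring_closed in simp)

lemma lift_list:
  assumes "subfield F R" "set p \<subseteq> residue_field F"
  obtains q where "set q \<subseteq> F" "set q \<subseteq> val_ring" "map residue q = p"
proof -
  have "p \<in> lists (residue ` valuation_ring F)" using assms(2) by (auto simp: residue_field_alt)
  then obtain q where "q \<in> lists (valuation_ring F)" "p = map residue q" by (auto simp: lists_image)
  then show thesis using that mem_valuation_ring[OF assms(1)] by (auto simp: in_lists_conv_set subset_iff)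
qed

text \<open>A root that is not integral would make the leading term dominate.\<close>

lemma root_of_unit_lead_coeff:
  assumes p: "set p \<subseteq> val_ring" "p \<noteq> []" "hd p \<notin> val_ideal" and c: "c \<in> carrier R" "eval p c = \<zero>"
  shows "c \<in> val_ring"
proof (rule ccontr)
  assume nc: "c \<notin> val_ring"
  have c0: "c \<noteq> \<zero>" using nc by (auto simp: mem_val_ring)
  let ?d = "inv c"
  have d: "?d \<in> val_ideal" using inv_mem_val_ideal c nc by blast
  have dc: "?d \<in> carrier R" using d val_ideal_closed(8) by blast
  have cd: "c [^] n \<otimes> ?d [^] n = \<one>" for n :: nat
    using nat_pow_distrib[of c ?d n] c dc c0 by (simp add: r_inv' nat_pow_one)
  have key: "eval q c \<otimes> ?d [^] length q \<in> val_ideal" if "set q \<subseteq> val_ring" for q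
    using that
  proof (induction q)
    case (Cons b q)
    have b: "b \<in> val_ring" "b \<in> carrier R" using Cons.prems val_ring_carrier by auto
    have qc: "set q \<subseteq> carrier R" using Cons.prems val_ring_carrier by auto
    have e: "eval q c \<in> carrier R" using eval_in_carrier[OF qc c(1)] .
    have "eval (b # q) c \<otimes> ?d [^] length (b # q)
        = b \<otimes> (c [^] length q \<otimes> ?d [^] length q) \<otimes> ?d \<oplus> eval q c \<otimes> ?d [^] length q \<otimes> ?d"
      using b e c dc by (simp add: l_distr m_assoc)
    also have "\<dots> = b \<otimes> ?d \<oplus> (eval q c \<otimes> ?d [^] length q) \<otimes> ?d" using cd b by simp
    finally show ?case
      using Cons b d val_ideal_closed(2,4,5,7) by auto
  qed (use val_ideal_closed dc in simp)
  obtain a q where aq: "p = a # q" using p(2) by (cases p) auto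
  have a: "a \<in> val_ring" "a \<in> carrier R" and q: "set q \<subseteq> val_ring" "set q \<subseteq> carrier R"
    using p(1) aq val_ring_carrier by auto
  have e: "eval q c \<in> carrier R" using eval_in_carrier[OF q(2) c(1)] .
  have "(a \<otimes> c [^] length q \<oplus> eval q c) \<otimes> ?d [^] length q = \<zero>" using c aq dc by simp
  then have "a \<otimes> (c [^] length q \<otimes> ?d [^] length q) \<oplus> eval q c \<otimes> ?d [^] length q = \<zero>"
    using a e c dc by (simp add: l_distr m_assoc)
  then have "a \<oplus> eval q c \<otimes> ?d [^] length q = \<zero>" using cd a by simp
  then have "a = \<ominus> (eval q c \<otimes> ?d [^] length q)" using a e dc by (simp add: minus_equality)
  then have "a \<in> val_ideal" using val_ideal_closed(3)[OF key[OF q(1)]] by simp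
  then show False using p(3) aq by simp
qed

end

locale ac_valued_field = algebraically_closed R + valued_field R \<nu>
  for R :: "('a, 'b) ring_scheme" (structure) and \<nu> :: "'a \<Rightarrow> 'g::linordered_ab_group_add"
begin

text \<open>The value of \<open>p\<close> at \<open>x\<close> is a unit times the product of the differences between \<open>x\<close> and the roots.
  These are integral, so one of them is in the maximal ideal if the product is. The roots are split
  off one at a time.\<close>

lemma root_near_approximate_root:
  assumes "p \<in> carrier (poly_ring R)" "p \<noteq> []" "hd p \<in> val_ring - val_ideal"
    and "\<And>c. \<lbrakk> c \<in> carrier R; eval p c = \<zero> \<rbrakk> \<Longrightarrow> c \<in> val_ring"
    and x: "x \<in> val_ring" and "eval p x \<in> val_ideal"
  shows "\<exists>c\<in>val_ring. eval p c = \<zero> \<and> x \<ominus> c \<in> val_ideal"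
  using assms(1-4,6)
proof (induction "length p" arbitrary: p rule: less_induct)
  case less
  note p = less.prems
  show ?case
  proof (cases "degree p = 0")
    case True
    then obtain a where "p = [a]" using p(2) by (cases p) auto
    then have "eval p x = hd p" using p(3) val_ring_carrier[OF x] val_ring_carrier[of a] by simp
    then show ?thesis using p(3,5) by simp
  next
    case False
    then have "1 \<le> degree p" by linarith
    then obtain c where c: "c \<in> carrier R" "eval p c = \<zero>"
      by (rule exists_root_of_positive_degree[OF p(1)])
    have cO: "c \<in> val_ring" using p(4) c by blast
    let ?l = "[\<one>, \<ominus> c]"
    have l: "?l \<in> carrier (poly_ring R)" using c by (simp add: polynomial_def flip: univ_poly_carrier)
    have "?l pdivides p" using is_root_imp_pdivides[OF p(1), of c] c p(2) by (simp add: is_root_def)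
    then obtain q where q: "q \<in> carrier (poly_ring R)" "p = poly_mult ?l q"
      unfolding pdivides_def factor_def univ_poly_mult by blast
    have sub: "set s \<subseteq> carrier R" "polynomial (carrier R) s" if "s \<in> carrier (poly_ring R)" for s
      using that polynomial_incl univ_poly_carrier by blast+
    have q0: "q \<noteq> []" using q(2) p(2) poly_mult_zero(2)[OF sub(1)[OF l]] by auto
    have len: "length q < length p"
      using poly_mult_degree_eq[OF carrier_is_subring sub(2)[OF l] sub(2)[OF q(1)]] q(2) q0 p(2)
      by (cases p; cases q) (auto simp del: poly_mult.simps)
    have hq: "hd q = hd p"
      using poly_mult_lead_coeff[OF carrier_is_subring sub(2)[OF l] sub(2)[OF q(1)] _ q0] q(2)
        sub(1)[OF q(1)] q0 by (cases q) (auto simp del: poly_mult.simps)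
    have ev: "eval p y = (y \<ominus> c) \<otimes> eval q y" if "y \<in> carrier R" for y
      using eval_poly_mult[OF sub(1)[OF l] sub(1)[OF q(1)] that] q(2) c that
      by (simp add: a_minus_def del: poly_mult.simps)
    have qc: "eval q y \<in> carrier R" if "y \<in> carrier R" for y using eval_in_carrier[OF sub(1)[OF q(1)] that] .
    have xc: "x \<in> carrier R" using val_ring_carrier x .
    show ?thesis
    proof (cases "x \<ominus> c \<in> val_ideal")
      case False
      have d: "x \<ominus> c \<in> val_ring" using x cO val_ring_closed by (simp add: a_minus_def)
      then have u: "x \<ominus> c \<in> val_ring - val_ideal" using False by blast
      then have dc: "x \<ominus> c \<in> carrier R" "x \<ominus> c \<noteq> \<zero>" unfolding unit_iff by auto
      have "inv (x \<ominus> c) \<otimes> eval p x = eval q x"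
        using ev[OF xc] dc qc[OF xc] inv_props[OF dc] by (simp flip: m_assoc)
      moreover have "inv (x \<ominus> c) \<otimes> eval p x \<in> val_ideal"
        using val_ideal_closed(5)[OF p(5)] unit_inv[OF u] by blast
      ultimately have "eval q x \<in> val_ideal" by simp
      moreover have "y \<in> val_ring" if "y \<in> carrier R" "eval q y = \<zero>" for y
        using p(4)[OF that(1)] ev[OF that(1)] that c by simp
      ultimately obtain b where b: "b \<in> val_ring" "eval q b = \<zero>" "x \<ominus> b \<in> val_ideal"
        using less.hyps[OF len q(1) q0] p(3) hq by auto
      then show ?thesis using ev[of b] val_ring_carrier[of b] c by auto
    qed (use c cO in blast)
  qed
qed

text \<open>The leading coefficient of a lift is a unit, which makes the roots integral.\<close>

lemma lift_polynomial:
  assumes F: "subfield F R" and p: "p \<in> carrier (univ_poly residue_ring (residue_field F))" "p \<noteq> []"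
  obtains q where "set q \<subseteq> F" "set q \<subseteq> val_ring" "map residue q = p" "q \<noteq> []"
    "hd q \<in> val_ring - val_ideal" "q \<in> carrier (F[X])" "q \<in> carrier (poly_ring R)"
    "\<And>c. \<lbrakk> c \<in> carrier R; eval q c = \<zero> \<rbrakk> \<Longrightarrow> c \<in> val_ring"
proof -
  have ps: "set p \<subseteq> residue_field F" "hd p \<noteq> \<zero>\<^bsub>residue_ring\<^esub>"
    using p by (auto simp: polynomial_def simp flip: univ_poly_carrier)
  obtain q where q: "set q \<subseteq> F" "set q \<subseteq> val_ring" "map residue q = p"
    using lift_list[OF F ps(1)] by blast
  have q0: "q \<noteq> []" using q(3) p(2) by auto
  then have hq: "hd q \<in> val_ring" "residue (hd q) = hd p" using q(2,3) by (auto simp: hd_map)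
  then have h: "hd q \<in> val_ring - val_ideal" using ps(2) residue_zero_iff[of "hd q"] by auto
  then have "hd q \<noteq> \<zero>" using val_ideal_closed(1) by auto
  then have F': "q \<in> carrier (F[X])" using q(1) by (simp add: polynomial_def flip: univ_poly_carrier)
  then have "q \<in> carrier (poly_ring R)" using carrier_polynomial_shell[OF subfieldE(1)[OF F]] by blast
  moreover have "c \<in> val_ring" if "c \<in> carrier R" "eval q c = \<zero>" for c
    using root_of_unit_lead_coeff[OF q(2) q0 _ that] h by blast
  ultimately show thesis using that q q0 h F' by blast
qed

lemma residue_ring_algebraically_closed: "algebraically_closed residue_ring"
proof (rule k.algebraically_closedI)
  fix p assume p: "p \<in> carrier (poly_ring residue_ring)" "degree p > 1"
  then have p0: "p \<noteq> []" by auto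
  have p': "p \<in> carrier (univ_poly residue_ring (residue_field (carrier R)))"
    using p(1) by (simp add: residue_field_carrier)
  obtain q where q: "set q \<subseteq> val_ring" "map residue q = p" "q \<in> carrier (poly_ring R)"
    "\<And>c. \<lbrakk> c \<in> carrier R; eval q c = \<zero> \<rbrakk> \<Longrightarrow> c \<in> val_ring"
    using lift_polynomial[OF carrier_is_subfield p' p0] by metis
  have "1 \<le> degree q" using p(2) q(2) by auto
  then obtain c where c: "c \<in> carrier R" "eval q c = \<zero>"
    by (rule exists_root_of_positive_degree[OF q(3)])
  then have "c \<in> val_ring" using q(4) by blast
  then show "\<exists>x\<in>carrier residue_ring. k.eval p x = \<zero>\<^bsub>residue_ring\<^esub>"
    using residue_eval[OF q(1), of c] q(2) c residue_zero residue_closed by auto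
qed

end

sublocale ac_valued_field \<subseteq> k: algebraically_closed residue_ring
  by (rule residue_ring_algebraically_closed)

section \<open>Cosets of value groups\<close>

text \<open>The right cosets that the ramification index counts, for additively written groups.\<close>

definition translate :: "'g::ab_group_add set \<Rightarrow> 'g \<Rightarrow> 'g set"
  where "translate H g = (\<lambda>h. h + g) ` H"

definition additive_subgroup_set :: "'g::ab_group_add set \<Rightarrow> bool"
  where "additive_subgroup_set H \<longleftrightarrow> 0 \<in> H \<and> (\<forall>x\<in>H. \<forall>y\<in>H. x - y \<in> H)"

lemma additive_subgroup_setD:
  assumes "additive_subgroup_set H"
  shows "0 \<in> H" "\<lbrakk> x \<in> H; y \<in> H \<rbrakk> \<Longrightarrow> x - y \<in> H" "x \<in> H \<Longrightarrow> - x \<in> H" "\<lbrakk> x \<in> H; y \<in> H \<rbrakk> \<Longrightarrow> x + y \<in> H"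
proof -
  show 0: "0 \<in> H" and m: "\<lbrakk> x \<in> H; y \<in> H \<rbrakk> \<Longrightarrow> x - y \<in> H" for x y
    using assms by (auto simp: additive_subgroup_set_def)
  show n: "x \<in> H \<Longrightarrow> - x \<in> H" for x using m[OF 0, of x] by simp
  show "\<lbrakk> x \<in> H; y \<in> H \<rbrakk> \<Longrightarrow> x + y \<in> H" using m[of x "- y"] n[of y] by simp
qed

lemma translate_eq_iff:
  assumes "additive_subgroup_set H" shows "translate H a = translate H b \<longleftrightarrow> a - b \<in> H"
proof
  note D = additive_subgroup_setD[OF assms]
  assume "translate H a = translate H b"
  moreover have "a \<in> translate H a" using D(1) by (force simp: translate_def)
  ultimately obtain h where "h \<in> H" "a = h + b" by (auto simp: translate_def)
  then show "a - b \<in> H" by simp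
next
  note D = additive_subgroup_setD[OF assms]
  have sub: "translate H a \<subseteq> translate H b" if ab: "a - b \<in> H" for a b
  proof
    fix x assume "x \<in> translate H a"
    then obtain h where h: "h \<in> H" "x = h + a" by (auto simp: translate_def)
    then have "x = (h + (a - b)) + b" by simp
    then show "x \<in> translate H b" using D(4)[OF h(1) ab] unfolding translate_def by blast
  qed
  assume ab: "a - b \<in> H"
  then have "b - a \<in> H" using D(3)[OF ab] by simp
  then show "translate H a = translate H b" using sub[OF ab] sub by blast
qed

text \<open>Fix a representative of every coset of \<open>T\<close>. Then a coset of \<open>H\<close> in \<open>G\<close> is in a unique way the
  translate, by such a representative, of a coset of \<open>H\<close> in \<open>T\<close>.\<close>

lemma card_translates_tower:
  assumes H: "additive_subgroup_set H" and T: "additive_subgroup_set T" and G: "additive_subgroup_set G"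
    and HT: "H \<subseteq> T" "T \<subseteq> G"
  shows "card (translate H ` G) = card (translate H ` T) * card (translate T ` G)"
proof -
  note eH = translate_eq_iff[OF H] and eT = translate_eq_iff[OF T]
  note DT = additive_subgroup_setD[OF T] and DG = additive_subgroup_setD[OF G]
  define r where "r C = (SOME g. g \<in> G \<and> translate T g = C)" for C
  have r: "r C \<in> G \<and> translate T (r C) = C" if "C \<in> translate T ` G" for C
    unfolding r_def using that by (intro someI_ex[of "\<lambda>g. g \<in> G \<and> translate T g = C"]) auto
  define f where "f = (\<lambda>(A, C). (\<lambda>x. x + r C) ` A)"
  have f: "f (translate H t, C) = translate H (t + r C)" for t C
    by (force simp: f_def translate_def add.assoc)
  have "bij_betw f (translate H ` T \<times> translate T ` G) (translate H ` G)"
    unfolding bij_betw_def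
  proof
    show "inj_on f (translate H ` T \<times> translate T ` G)"
    proof (rule inj_onI, clarify)
      fix t g t' g' assume t: "t \<in> T" "t' \<in> T" and g: "g \<in> G" "g' \<in> G"
        and "f (translate H t, translate T g) = f (translate H t', translate T g')"
      then have d: "(t + r (translate T g)) - (t' + r (translate T g')) \<in> H"
        by (simp add: f eH)
      let ?r = "r (translate T g)" and ?r' = "r (translate T g')"
      have "?r - ?r' = ((t + ?r) - (t' + ?r')) - (t - t')" by (simp add: algebra_simps)
      also have "\<dots> \<in> T" using d HT DT(2) t by blast
      finally have "translate T ?r = translate T ?r'" by (simp add: eT)
      then have C: "translate T g = translate T g'" using r g by auto
      then have "t - t' \<in> H" using d by simp
      then show "translate H t = translate H t' \<and> translate T g = translate T g'" using C by (simp add: eH)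
    qed
    show "f ` (translate H ` T \<times> translate T ` G) = translate H ` G"
    proof
      show "f ` (translate H ` T \<times> translate T ` G) \<subseteq> translate H ` G"
        using r HT DG(4) by (auto simp: f)
      show "translate H ` G \<subseteq> f ` (translate H ` T \<times> translate T ` G)"
      proof
        fix A assume "A \<in> translate H ` G"
        then obtain g where g: "g \<in> G" "A = translate H g" by auto
        let ?C = "translate T g"
        have C: "?C \<in> translate T ` G" using g by blast
        have "translate T g = translate T (r ?C)" using r[OF C] by simp
        then have t: "g - r ?C \<in> T" by (simp add: eT)
        have "f (translate H (g - r ?C), ?C) = A" using g by (simp add: f)
        then show "A \<in> f ` (translate H ` T \<times> translate T ` G)" using t C by blast
      qed
    qed
  qed
  from bij_betw_same_card[OF this] show ?thesis by (simp add: card_cartesian_product)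
qed

context valued_field
begin

lemma value_group_subgroup: "subfield F R \<Longrightarrow> additive_subgroup_set (value_group F)"
proof -
  assume F: "subfield F R"
  have Fc: "F \<subseteq> carrier R" using subfieldE(3)[OF F] .
  have "\<one> \<in> F - {\<zero>}" using subringE(3)[OF subfieldE(1)[OF F]] by simp
  then have z: "0 \<in> value_group F" unfolding value_group_def using val_one by force
  have "\<nu> x - \<nu> y \<in> value_group F" if "x \<in> F - {\<zero>}" "y \<in> F - {\<zero>}" for x y
  proof -
    have xy: "x \<in> carrier R" "y \<in> carrier R" "x \<noteq> \<zero>" "y \<noteq> \<zero>" using that Fc by auto
    have i: "inv y \<in> F - {\<zero>}" using subfield_m_inv(1)[OF F, of y] that by simp
    then have m: "x \<otimes> inv y \<in> F" using subringE(6)[OF subfieldE(1)[OF F]] that by blast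
    have "\<nu> (x \<otimes> inv y) = \<nu> x - \<nu> y"
      using val_mult[of x "inv y"] xy inv_props[of y] val_inv[of y] by simp
    moreover have "x \<otimes> inv y \<noteq> \<zero>" using integral_iff[of x "inv y"] xy inv_props[of y] by simp
    ultimately show ?thesis unfolding value_group_def using m by force
  qed
  then show ?thesis using z by (auto simp: additive_subgroup_set_def value_group_def)
qed

lemma value_group_mono: "F \<subseteq> E \<Longrightarrow> value_group F \<subseteq> value_group E"
  by (auto simp: value_group_def)

lemma ramification_index_alt:
  "ramification_index F E = card (translate (value_group F) ` value_group E)"
proof -
  have "rcosets\<^bsub>\<lparr>carrier = value_group E, monoid.mult = (+), one = 0\<rparr>\<^esub> (value_group F)
      = translate (value_group F) ` value_group E"
    by (auto simp: RCOSETS_def r_coset_def translate_def)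
  then show ?thesis by (simp add: ramification_index_def)
qed

lemma ramification_index_tower:
  assumes "subfield F R" "subfield T R" "subfield E R" "F \<subseteq> T" "T \<subseteq> E"
  shows "ramification_index F E = ramification_index F T * ramification_index T E"
  unfolding ramification_index_alt
  using assms by (intro card_translates_tower value_group_subgroup value_group_mono)

lemma ramification_index_eq_1_iff:
  assumes "subfield F R" "subfield E R" "F \<subseteq> E"
  shows "ramification_index F E = 1 \<longleftrightarrow> value_group E = value_group F"
proof
  note HF = value_group_subgroup[OF assms(1)] and HE = value_group_subgroup[OF assms(2)]
  have z: "0 \<in> value_group E" using additive_subgroup_setD(1)[OF HE] .
  { assume "ramification_index F E = 1"
    then obtain C where C: "translate (value_group F) ` value_group E = {C}"
      by (auto simp: ramification_index_alt card_1_singleton_iff)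
    have "g \<in> value_group F" if "g \<in> value_group E" for g
    proof -
      have "translate (value_group F) g = translate (value_group F) 0" using C that z by blast
      then show ?thesis by (simp add: translate_eq_iff[OF HF])
    qed
    then show "value_group E = value_group F" using value_group_mono[OF assms(3)] by blast }
  { assume e: "value_group E = value_group F"
    have "translate (value_group F) g = translate (value_group F) 0" if "g \<in> value_group E" for g
      using that e by (simp add: translate_eq_iff[OF HF])
    then have "translate (value_group F) ` value_group E = {translate (value_group F) 0}"
      using z by blast
    then show "ramification_index F E = 1" by (simp add: ramification_index_alt) }
qed

lemma val_pow: "x \<in> carrier R \<Longrightarrow> x \<noteq> \<zero> \<Longrightarrow>
    \<nu> (x [^] n) = x' [^]\<^bsub>\<lparr>carrier = G, monoid.mult = (+), one = 0\<rparr>\<^esub> n" if "x' = \<nu> x" for n :: nat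
proof (induction n)
  case (Suc n)
  have "x [^] n \<noteq> \<zero>" using Suc.prems by (induction n) (auto simp: integral_iff)
  then show ?case using Suc that val_mult[of "x [^] n" x] by simp
qed simp

text \<open>Lagrange's theorem in the quotient of the value groups.\<close>

lemma ramification_index_torsion:
  assumes F: "subfield F R" and E: "subfield E R" and FE: "F \<subseteq> E"
    and fin: "finite (translate (value_group F) ` value_group E)" and a: "a \<in> E - {\<zero>}"
  shows "\<nu> (a [^] ramification_index F E) \<in> value_group F"
proof -
  note DE = additive_subgroup_setD[OF value_group_subgroup[OF E]]
  note DF = additive_subgroup_setD[OF value_group_subgroup[OF F]]
  have sub: "value_group F \<subseteq> value_group E" using value_group_mono[OF FE] .
  let ?G = "\<lparr>carrier = value_group E, monoid.mult = (+), one = 0\<rparr>"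
  let ?H = "value_group F"
  interpret G: comm_group ?G
  proof (rule comm_groupI)
    show "\<exists>y\<in>carrier ?G. y \<otimes>\<^bsub>?G\<^esub> x = \<one>\<^bsub>?G\<^esub>" if "x \<in> carrier ?G" for x
      using that DE(3)[of x] by (intro bexI[of _ "- x"]) auto
  qed (use DE in \<open>auto simp: add_ac\<close>)
  have invG: "inv\<^bsub>?G\<^esub> x = - x" if "x \<in> carrier ?G" for x
    using that DE(3)[of x] by (intro G.inv_equality) auto
  have sg: "subgroup ?H ?G"
    using sub DF invG by (intro G.subgroupI) auto
  interpret N: normal ?H ?G using G.subgroup_imp_normal[OF sg] .
  interpret Q: group "?G Mod ?H" by (rule N.factorgroup_is_group)
  let ?g = "\<nu> a"
  have g: "?g \<in> carrier ?G" using a by (auto simp: value_group_def)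
  let ?e = "ramification_index F E"
  have "order (?G Mod ?H) = ?e" by (simp add: order_def FactGroup_def ramification_index_def)
  moreover have "?H #>\<^bsub>?G\<^esub> ?g \<in> carrier (?G Mod ?H)"
    using g by (auto simp: FactGroup_def RCOSETS_def)
  ultimately have "(?H #>\<^bsub>?G\<^esub> ?g) [^]\<^bsub>?G Mod ?H\<^esub> ?e = \<one>\<^bsub>?G Mod ?H\<^esub>"
    using Q.pow_order_eq_1 by metis
  moreover have "(?H #>\<^bsub>?G\<^esub> ?g) [^]\<^bsub>?G Mod ?H\<^esub> ?e = ?H #>\<^bsub>?G\<^esub> (?g [^]\<^bsub>?G\<^esub> ?e)"
    using group_hom.hom_nat_pow[of ?G "?G Mod ?H" "(#>\<^bsub>?G\<^esub>) ?H" ?g ?e] N.r_coset_hom_Mod g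
    by (simp add: group_hom_def group_hom_axioms_def G.is_group Q.is_group)
  ultimately have "?H #>\<^bsub>?G\<^esub> (?g [^]\<^bsub>?G\<^esub> ?e) = ?H" by (simp add: FactGroup_def)
  then have "?g [^]\<^bsub>?G\<^esub> ?e \<in> ?H"
    using G.coset_join1[OF _ _ sg, of "?g [^]\<^bsub>?G\<^esub> ?e"] G.nat_pow_closed[OF g, of ?e] sub by auto
  then show ?thesis using val_pow[of ?g a ?e] a subfieldE(3)[OF E] by auto
qed

end

section \<open>The fundamental inequality\<close>

context ring
begin

lemma finite_dimension_bounded:
  assumes K: "subfield K R" and V: "subalgebra K V R"
    and bound: "\<And>Us. \<lbrakk> independent K Us; set Us \<subseteq> V \<rbrakk> \<Longrightarrow> length Us \<le> N"
  shows "finite_dimension K V"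
proof -
  let ?P = "\<lambda>n. \<exists>Us. independent K Us \<and> set Us \<subseteq> V \<and> length Us = n"
  have P0: "?P 0" by simp
  have PN: "\<forall>n. ?P n \<longrightarrow> n \<le> N" using bound by auto
  have "\<exists>n. ?P n \<and> (\<forall>m. ?P m \<longrightarrow> m \<le> n)"
    using ex_has_greatest_nat[of ?P 0 "\<lambda>n. n" "Suc N", OF P0] PN by (simp add: less_Suc_eq_le)
  then obtain Us where Us: "independent K Us" "set Us \<subseteq> V"
    and mx: "\<And>m. ?P m \<Longrightarrow> m \<le> length Us" by blast
  have "Span K Us \<subseteq> V" using subalgebra_Span_incl[OF K V Us(2)] .
  moreover have "v \<in> Span K Us" if v: "v \<in> V" for v
  proof (rule ccontr)
    assume "v \<notin> Span K Us"
    then have "independent K (v # Us)"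
      using subalgebra_in_carrier[OF V] v Us(1) by (intro li_Cons) auto
    then have "?P (Suc (length Us))" using v Us(2) by (intro exI[of _ "v # Us"]) auto
    then show False using mx by fastforce
  qed
  ultimately have "Span K Us = V" by blast
  then show ?thesis using dimensionI[OF K Us(1)] finite_dimensionI by blast
qed

lemma subfield_subalgebra:
  assumes "subfield K R" "subfield E R" "K \<subseteq> E"
  shows "subalgebra K E R"
  using subring.axioms(1)[OF subfieldE(1)[OF assms(2)]] subringE(6)[OF subfieldE(1)[OF assms(2)]] assms(3)
  by (auto simp: subalgebra_def subalgebra_axioms_def)

lemma finite_extD:
  assumes "finite_ext F E"
  shows "subfield F R" "subfield E R" "F \<subseteq> E" "finite_dimension F E" "dimension (dim F E) F E" "E \<subseteq> carrier R"
  using assms finite_dimensionE[of F E] subfieldE(3)[of E R] by (auto simp: finite_ext_def over_def)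

lemma finite_ext_refl: "subfield F R \<Longrightarrow> finite_ext F F" "subfield F R \<Longrightarrow> dim F F = 1"
  using dimension_one[of F] dimI[of F 1 F] finite_dimensionI[of 1 F F] by (auto simp: finite_ext_def over_def)

lemma finite_ext_trans:
  assumes "finite_ext F T" "finite_ext T E"
  shows "finite_ext F E" "dim F E = dim F T * dim T E"
  using telescopic_base_dim[OF finite_extD(1)[OF assms(1)] finite_extD(1)[OF assms(2)]
      finite_extD(4)[OF assms(1)] finite_extD(4)[OF assms(2)]] finite_extD[OF assms(1)] finite_extD[OF assms(2)]
  by (auto simp: finite_ext_def over_def)

lemma finite_ext_intermediate:
  assumes FE: "finite_ext F E" and T: "subfield T R" "F \<subseteq> T" "T \<subseteq> E"
  shows "finite_ext F T" "finite_ext T E"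
proof -
  note D = finite_extD[OF FE]
  show "finite_ext F T"
    using subalbegra_incl_imp_finite_dimension[OF D(1,4) subfield_subalgebra[OF D(1) T(1,2)] T(3)] D T
    by (simp add: finite_ext_def)
  obtain Us where Us: "set Us \<subseteq> carrier R" "independent F Us" "Span F Us = E"
    using exists_base[OF D(1,5)] by blast
  have UE: "set Us \<subseteq> E" using Span_base_incl[OF D(1) Us(1)] Us(3) by simp
  have "Span T Us \<subseteq> E" using subalgebra_Span_incl[OF T(1) subfield_subalgebra[OF T(1) D(2) T(3)] UE] .
  moreover have "E \<subseteq> Span T Us"
  proof -
    have "Span F Us = {combine Ks Us |Ks. set Ks \<subseteq> F}" using Span_eq_combine_set[OF D(1) Us(1)] .
    moreover have "Span T Us = {combine Ks Us |Ks. set Ks \<subseteq> T}" using Span_eq_combine_set[OF T(1) Us(1)] .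
    ultimately show ?thesis using Us(3) T(2) by blast
  qed
  ultimately have "finite_dimension T E" using Span_finite_dimension[OF T(1) Us(1)] by simp
  then show "finite_ext T E" using D T by (simp add: finite_ext_def)
qed

lemma dim_1_imp_eq:
  assumes "finite_ext F E" "dim F E = 1" "\<one> \<noteq> \<zero>"
  shows "E = F"
proof -
  note D = finite_extD[OF assms(1)]
  have "dimension 1 F F" by (rule dimension_one[OF D(1)])
  then obtain Vs where Vs: "set Vs \<subseteq> carrier R" "independent F Vs" "length Vs = 1" "Span F Vs = F"
    using exists_base[OF D(1)] by blast
  have "set Vs \<subseteq> E" using Span_base_incl[OF D(1) Vs(1)] Vs(4) D(3) by blast
  then have "Span F Vs = E"
    using independent_length_eq_dimension[OF D(1,5) Vs(2)] Vs(3) assms(2) by simp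
  then show ?thesis using Vs(4) by simp
qed

end

context valued_field
begin

lemma combine_residue:
  "\<lbrakk> set Ks \<subseteq> val_ring; set Us \<subseteq> val_ring \<rbrakk> \<Longrightarrow> combine Ks Us \<in> val_ring \<and>
    residue (combine Ks Us) = k.combine (map residue Ks) (map residue Us)"
  by (induction Ks Us rule: combine.induct)
     (auto simp: val_ring_closed residue_add residue_mult residue_zero)

text \<open>Dividing by a coefficient of least value makes all coefficients integral and one of them a
  unit, so that the residue of the combination does not vanish.\<close>

lemma value_combine:
  assumes F: "subfield F R" and Ws: "set Ws \<subseteq> val_ring"
    and ind: "k.independent (residue_field F) (map residue Ws)"
    and Ks: "set Ks \<subseteq> F" "length Ks = length Ws" "\<not> set Ks \<subseteq> {\<zero>}"
  shows "combine Ks Ws \<noteq> \<zero>" "\<nu> (combine Ks Ws) \<in> value_group F"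
proof -
  note Fc = subfieldE(3)[OF F]
  have Kc: "set Ks \<subseteq> carrier R" and Wc: "set Ws \<subseteq> carrier R" using Ks(1) Fc Ws val_ring_carrier by auto
  let ?S = "set Ks - {\<zero>}"
  have "finite (\<nu> ` ?S)" "\<nu> ` ?S \<noteq> {}" using Ks(3) by auto
  then have "Min (\<nu> ` ?S) \<in> \<nu> ` ?S" by (rule Min_in)
  then obtain a where a': "Min (\<nu> ` ?S) = \<nu> a" and a: "a \<in> ?S" by (rule imageE)
  have mn: "\<nu> a \<le> \<nu> b" if "b \<in> ?S" for b
    unfolding a'[symmetric] using that by (intro Min_le) auto
  have ac: "a \<in> carrier R" "a \<noteq> \<zero>" "a \<in> F" using a Kc Ks(1) by auto
  note i = inv_props[OF ac(1,2)]
  have iF: "inv a \<in> F" using subfield_m_inv(1)[OF F] ac by simp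
  let ?Ks = "map ((\<otimes>) (inv a)) Ks"
  have KF: "set ?Ks \<subseteq> F" using iF Ks(1) subringE(6)[OF subfieldE(1)[OF F]] by auto
  have KO: "set ?Ks \<subseteq> val_ring"
  proof clarsimp
    fix b assume b: "b \<in> set Ks"
    show "inv a \<otimes> b \<in> val_ring"
    proof (cases "b = \<zero>")
      case False
      then have "\<nu> (inv a \<otimes> b) = \<nu> b - \<nu> a"
        using val_mult[of "inv a" b] i b Kc val_inv[OF ac(1,2)] by auto
      then show ?thesis using mn[of b] b False i Kc by (auto simp: mem_val_ring)
    qed (use i in \<open>simp add: mem_val_ring\<close>)
  qed
  have eq: "combine ?Ks Ws = inv a \<otimes> combine Ks Ws" using combine_r_distr[OF Kc Wc i(1)] by simp
  note cr = combine_residue[OF KO Ws]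
  (* The coefficient at \<open>a\<close> is now 1, so the residues form a nontrivial combination. *)
  have "combine ?Ks Ws \<notin> val_ideal"
  proof
    assume "combine ?Ks Ws \<in> val_ideal"
    then have "k.combine (map residue ?Ks) (map residue Ws) = \<zero>\<^bsub>residue_ring\<^esub>"
      using cr residue_zero_iff by metis
    moreover have "set (map residue ?Ks) \<subseteq> residue_field F"
      using KO KF mem_valuation_ring[OF F] by (auto simp: residue_field_alt)
    ultimately have "set (take (length (map residue Ws)) (map residue ?Ks)) \<subseteq> {\<zero>\<^bsub>residue_ring\<^esub>}"
      using k.independent_imp_trivial_combine[OF residue_field_subfield[OF F] ind] by blast
    then have "set (map residue ?Ks) \<subseteq> {\<zero>\<^bsub>residue_ring\<^esub>}" using Ks(2) by simp
    moreover have "residue (inv a \<otimes> a) \<in> set (map residue ?Ks)" using a by auto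
    ultimately have "residue \<one> = \<zero>\<^bsub>residue_ring\<^esub>" using i(3) by auto
    then show False using residue_one by simp
  qed
  then have u: "combine ?Ks Ws \<in> val_ring - val_ideal" using cr by blast
  then have u': "combine ?Ks Ws \<in> carrier R" "combine ?Ks Ws \<noteq> \<zero>" "\<nu> (combine ?Ks Ws) = 0"
    unfolding unit_iff by auto
  have cc: "combine Ks Ws \<in> carrier R" using Kc Wc by simp
  have e2: "combine Ks Ws = a \<otimes> combine ?Ks Ws" unfolding eq using i ac cc by (simp flip: m_assoc)
  show "combine Ks Ws \<noteq> \<zero>" using e2 integral[of a "combine ?Ks Ws"] ac u' by auto
  have "\<nu> (combine Ks Ws) = \<nu> a" unfolding e2 using val_mult[of a "combine ?Ks Ws"] ac u' by simp
  then show "\<nu> (combine Ks Ws) \<in> value_group F" using ac by (auto simp: value_group_def)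
qed

text \<open>A combination of the \<open>w p\<close> is \<open>p\<close> times one of the \<open>w\<close>, whose value is known.\<close>

lemma independent_scaled:
  assumes F: "subfield F R" and Ws: "set Ws \<subseteq> val_ring"
    and ind: "k.independent (residue_field F) (map residue Ws)" and p: "p \<in> carrier R" "p \<noteq> \<zero>"
  shows "independent F (map (\<lambda>w. w \<otimes> p) Ws)"
    "\<And>x. \<lbrakk> x \<in> Span F (map (\<lambda>w. w \<otimes> p) Ws); x \<noteq> \<zero> \<rbrakk> \<Longrightarrow> \<nu> x - \<nu> p \<in> value_group F"
proof -
  note Fc = subfieldE(3)[OF F]
  have Wc: "set Ws \<subseteq> carrier R" using Ws val_ring_carrier by auto
  have Pc: "set (map (\<lambda>w. w \<otimes> p) Ws) \<subseteq> carrier R" using Wc p by auto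
  have cp: "combine Ks (map (\<lambda>w. w \<otimes> p) Ws) = combine Ks Ws \<otimes> p" if "set Ks \<subseteq> F" for Ks
    using combine_l_distr[of Ks Ws p] that Fc Wc p by auto
  have cc: "combine Ks Ws \<in> carrier R" if "set Ks \<subseteq> F" for Ks using that Fc Wc by auto
  show "independent F (map (\<lambda>w. w \<otimes> p) Ws)"
  proof (rule ccontr)
    assume d: "\<not> independent F (map (\<lambda>w. w \<otimes> p) Ws)"
    obtain Ks where Ks: "length Ks = length (map (\<lambda>w. w \<otimes> p) Ws)"
      "combine Ks (map (\<lambda>w. w \<otimes> p) Ws) = \<zero>" "set Ks \<subseteq> F" "set Ks \<noteq> {\<zero>}"
      by (rule dependent_imp_non_trivial_combine[OF F Pc d])
    have "Ws \<noteq> []" using d by auto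
    then have "\<not> set Ks \<subseteq> {\<zero>}" using Ks(1,4) by (auto simp: subset_singleton_iff)
    then have "combine Ks Ws \<noteq> \<zero>" using value_combine(1)[OF F Ws ind Ks(3)] Ks(1) by simp
    moreover have "combine Ks Ws \<otimes> p = \<zero>" using Ks(2) cp[OF Ks(3)] by simp
    ultimately show False using integral[of "combine Ks Ws" p] cc[OF Ks(3)] p by auto
  qed
  fix x assume x: "x \<in> Span F (map (\<lambda>w. w \<otimes> p) Ws)" "x \<noteq> \<zero>"
  then obtain Ks where Ks: "set Ks \<subseteq> F" "length Ks = length Ws" "x = combine Ks (map (\<lambda>w. w \<otimes> p) Ws)"
    using Span_mem_iff_length_version[OF F Pc] by auto
  have x': "x = combine Ks Ws \<otimes> p" using Ks cp by simp
  have n0: "\<not> set Ks \<subseteq> {\<zero>}"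
  proof
    assume "set Ks \<subseteq> {\<zero>}"
    then have "Ks = replicate (length Ws) \<zero>" using Ks(2) by (metis replicate_eqI singletonD subsetD)
    then have "combine Ks Ws = \<zero>" using combine_replicate[OF Wc] by simp
    then show False using x' x(2) p by simp
  qed
  note v = value_combine[OF F Ws ind Ks(1,2) n0]
  show "\<nu> x - \<nu> p \<in> value_group F"
    using val_mult[of "combine Ks Ws" p] v cc[OF Ks(1)] p x' by simp
qed

text \<open>The summands that belong to different elements of \<open>Ps\<close> have values in different cosets of the value
  group of \<open>F\<close>. So the value of the sum is the least of theirs; in particular the sum is not zero.
  The statement about values is what carries the induction.\<close>

lemma independent_products:
  assumes F: "subfield F R" and Ws: "set Ws \<subseteq> val_ring"
    and ind: "k.independent (residue_field F) (map residue Ws)"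
    and Ps: "set Ps \<subseteq> carrier R - {\<zero>}" "sorted_wrt (\<lambda>p q. \<nu> p - \<nu> q \<notin> value_group F) Ps"
  shows "independent F (concat (map (\<lambda>p. map (\<lambda>w. w \<otimes> p) Ws) Ps)) \<and>
    (\<forall>x\<in>Span F (concat (map (\<lambda>p. map (\<lambda>w. w \<otimes> p) Ws) Ps)).
      x \<noteq> \<zero> \<longrightarrow> (\<exists>p\<in>set Ps. \<nu> x - \<nu> p \<in> value_group F))"
  using Ps
proof (induction Ps)
  case (Cons p Ps)
  note D = additive_subgroup_setD[OF value_group_subgroup[OF F]]
  let ?A = "map (\<lambda>w. w \<otimes> p) Ws" and ?B = "concat (map (\<lambda>p. map (\<lambda>w. w \<otimes> p) Ws) Ps)"
  have p: "p \<in> carrier R" "p \<noteq> \<zero>" using Cons.prems by auto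
  note A = independent_scaled[OF F Ws ind p]
  have B: "independent F ?B"
    "\<And>x. x \<in> Span F ?B \<Longrightarrow> x \<noteq> \<zero> \<Longrightarrow> \<exists>p\<in>set Ps. \<nu> x - \<nu> p \<in> value_group F"
    using Cons.IH Cons.prems by auto
  have Ac: "set ?A \<subseteq> carrier R" and Bc: "set ?B \<subseteq> carrier R"
    using independent_in_carrier A(1) B(1) by blast+
  have sep: "\<nu> x \<noteq> \<nu> y" if x: "x \<in> Span F ?A" "x \<noteq> \<zero>" and y: "y \<in> Span F ?B" "y \<noteq> \<zero>" for x y
  proof
    assume e: "\<nu> x = \<nu> y"
    obtain q where q: "q \<in> set Ps" "\<nu> y - \<nu> q \<in> value_group F" using B(2)[OF y] by blast
    have "(\<nu> y - \<nu> q) - (\<nu> x - \<nu> p) \<in> value_group F" using D(2) q(2) A(2)[OF x] by blast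
    then have "\<nu> p - \<nu> q \<in> value_group F" using e by simp
    then show False using Cons.prems(2) q(1) by simp
  qed
  have int: "Span F ?A \<inter> Span F ?B = {\<zero>}"
    using sep Span_subgroup_props(2)[OF F Ac] Span_subgroup_props(2)[OF F Bc] by blast
  have "independent F (?A @ ?B)" by (rule independent_append[OF F A(1) B(1) int])
  moreover have "\<exists>q\<in>set (p # Ps). \<nu> x - \<nu> q \<in> value_group F" if x: "x \<in> Span F (?A @ ?B)" "x \<noteq> \<zero>" for x
  proof -
    obtain a b where ab: "a \<in> Span F ?A" "b \<in> Span F ?B" "x = a \<oplus> b"
      using x(1) Span_append_eq_set_add[OF F Ac Bc] by (auto simp: set_add_def')
    have c: "a \<in> carrier R" "b \<in> carrier R"
      using ab Span_subgroup_props(1)[OF F Ac] Span_subgroup_props(1)[OF F Bc] by auto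
    consider "a = \<zero>" | "b = \<zero>" "a \<noteq> \<zero>" | "a \<noteq> \<zero>" "b \<noteq> \<zero>" by blast
    then show ?thesis
    proof cases
      case 1
      then have "x = b" using ab c by simp
      then show ?thesis using B(2)[OF ab(2)] x(2) by auto
    next
      case 2
      then have "x = a" using ab c by simp
      then show ?thesis using A(2)[OF ab(1)] x(2) by auto
    next
      case 3
      then consider "\<nu> a < \<nu> b" | "\<nu> b < \<nu> a" using sep[OF ab(1) _ ab(2)] by (auto simp: neq_iff)
      then show ?thesis
      proof cases
        case 1
        then have "\<nu> x = \<nu> a" using val_add_less(2)[of a b] c 3 ab(3) by simp
        then show ?thesis using A(2)[OF ab(1)] 3 by auto
      next
        case 2
        then have "\<nu> x = \<nu> b" using val_add_less(2)[of b a] c 3 ab(3) by (simp add: a_comm)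
        then show ?thesis using B(2)[OF ab(2)] 3 by auto
      qed
    qed
  qed
  ultimately show ?case by simp
qed simp

lemma coset_representatives:
  assumes F: "subfield F R" and E: "E \<subseteq> carrier R" and S: "finite S" "S \<subseteq> translate (value_group F) ` value_group E"
  obtains Ps where "set Ps \<subseteq> E - {\<zero>}" "length Ps = card S" "sorted_wrt (\<lambda>p q. \<nu> p - \<nu> q \<notin> value_group F) Ps"
proof -
  let ?f = "\<lambda>x. translate (value_group F) (\<nu> x)"
  have "S \<subseteq> ?f ` (E - {\<zero>})" using S(2) by (auto simp: value_group_def)
  then obtain U where U: "U \<subseteq> E - {\<zero>}" "inj_on ?f U" "S = ?f ` U" by (auto simp: subset_image_inj)
  have fU: "finite U" using S(1) U finite_imageD by blast
  obtain Ps where Ps: "set Ps = U" "distinct Ps" using finite_distinct_list[OF fU] by blast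
  have "length Ps = card S" using U(2,3) Ps distinct_card[OF Ps(2)] by (simp add: card_image)
  moreover have "sorted_wrt (\<lambda>p q. \<nu> p - \<nu> q \<notin> value_group F) Ps"
    unfolding sorted_wrt_iff_nth_less
  proof (intro allI impI notI)
    fix i j assume ij: "i < j" "j < length Ps" and "\<nu> (Ps ! i) - \<nu> (Ps ! j) \<in> value_group F"
    then have "?f (Ps ! i) = ?f (Ps ! j)" by (simp add: translate_eq_iff[OF value_group_subgroup[OF F]])
    then have "Ps ! i = Ps ! j" using U(2) ij Ps(1) by (auto simp: inj_on_def)
    then show False using Ps(2) ij by (simp add: nth_eq_iff_index_eq)
  qed
  ultimately show thesis using that U(1) Ps(1) by blast
qed

definition residue_degree :: "'a set \<Rightarrow> 'a set \<Rightarrow> nat"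
  where "residue_degree F E = k.dim (residue_field F) (residue_field E)"

lemma fundamental_inequality_lists:
  assumes FE: "finite_ext F E" and S: "finite S" "S \<subseteq> translate (value_group F) ` value_group E"
    and Us: "k.independent (residue_field F) Us" "set Us \<subseteq> residue_field E"
  shows "card S * length Us \<le> dim F E"
proof -
  note D = finite_extD[OF FE]
  obtain Ws where Ws: "set Ws \<subseteq> E" "set Ws \<subseteq> val_ring" "map residue Ws = Us"
    by (rule lift_list[OF D(2) Us(2)])
  obtain Ps where Ps: "set Ps \<subseteq> E - {\<zero>}" "length Ps = card S" "sorted_wrt (\<lambda>p q. \<nu> p - \<nu> q \<notin> value_group F) Ps"
    by (rule coset_representatives[OF D(1) D(6) S])
  let ?L = "concat (map (\<lambda>p. map (\<lambda>w. w \<otimes> p) Ws) Ps)"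
  have Pc: "set Ps \<subseteq> carrier R - {\<zero>}" using Ps(1) D(6) by blast
  have ind: "k.independent (residue_field F) (map residue Ws)" using Us(1) Ws(3) by simp
  have "independent F ?L" using independent_products[OF D(1) Ws(2) ind Pc Ps(3)] by blast
  moreover have "set ?L \<subseteq> E" using Ws(1) Ps(1) subringE(6)[OF subfieldE(1)[OF D(2)]] by auto
  ultimately have "length ?L \<le> dim F E" by (rule independent_length_le_dimension[OF D(1,5)])
  moreover have "length ?L = length Ps * length Ws"
    by (induction Ps) auto
  moreover have "length Ws = length Us" using Ws(3) by auto
  ultimately show ?thesis using Ps(2) by simp
qed

lemma fundamental_inequality:
  assumes FE: "finite_ext F E"
  shows "finite (translate (value_group F) ` value_group E)"
    and "k.finite_ext (residue_field F) (residue_field E)"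
    and "ramification_index F E * residue_degree F E \<le> dim F E"
    and "0 < ramification_index F E" and "0 < residue_degree F E"
proof -
  note D = finite_extD[OF FE]
  note kF = residue_field_subfield[OF D(1)] and kE = residue_field_subfield[OF D(2)]
  let ?C = "translate (value_group F) ` value_group E"
  have kone: "\<one>\<^bsub>residue_ring\<^esub> \<in> residue_field E" using subringE(3)[OF subfieldE(1)[OF kE]] .
  have one: "k.independent (residue_field F) [\<one>\<^bsub>residue_ring\<^esub>]"
    by (intro k.li_Cons) auto
  show fin: "finite ?C"
  proof (rule ccontr)
    assume "infinite ?C"
    then obtain S where S: "finite S" "card S = Suc (dim F E)" "S \<subseteq> ?C"
      using infinite_arbitrarily_large by metis
    then show False using fundamental_inequality_lists[OF FE S(1,3) one] kone by simp
  qed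
  have ne: "?C \<noteq> {}" using additive_subgroup_setD(1)[OF value_group_subgroup[OF D(2)]] by blast
  then obtain c where c: "c \<in> ?C" by blast
  have "length Us \<le> dim F E" if "k.independent (residue_field F) Us" "set Us \<subseteq> residue_field E" for Us
    using fundamental_inequality_lists[OF FE _ _ that, of "{c}"] c by simp
  then have fd: "k.finite_dimension (residue_field F) (residue_field E)"
    by (rule k.finite_dimension_bounded[OF kF k.subfield_subalgebra[OF kF kE residue_field_mono[OF D(3)]]])
  then show kfe: "k.finite_ext (residue_field F) (residue_field E)"
    using kF kE residue_field_mono[OF D(3)] by (simp add: k.finite_ext_def)
  obtain Us where Us: "set Us \<subseteq> carrier residue_ring" "k.independent (residue_field F) Us"
    "length Us = residue_degree F E" "k.Span (residue_field F) Us = residue_field E"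
    using k.exists_base[OF kF k.finite_extD(5)[OF kfe]] by (auto simp: residue_degree_def)
  have UE: "set Us \<subseteq> residue_field E" using k.Span_base_incl[OF kF Us(1)] Us(4) by simp
  show "ramification_index F E * residue_degree F E \<le> dim F E"
    using fundamental_inequality_lists[OF FE fin subset_refl Us(2) UE] Us(3)
    by (simp add: ramification_index_alt)
  show "0 < ramification_index F E" using fin ne by (simp add: ramification_index_alt card_gt_0_iff)
  have "length [\<one>\<^bsub>residue_ring\<^esub>] \<le> residue_degree F E"
    using k.independent_length_le_dimension[OF kF k.finite_extD(5)[OF kfe] one] kone
    by (simp add: residue_degree_def)
  then show "0 < residue_degree F E" by simp
qed

lemma residue_degree_tower:
  assumes "finite_ext F T" "finite_ext T E"
  shows "residue_degree F E = residue_degree F T * residue_degree T E"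
  unfolding residue_degree_def
  by (rule k.finite_ext_trans(2)[OF fundamental_inequality(2)[OF assms(1)] fundamental_inequality(2)[OF assms(2)]])

text \<open>What tameness of a finite extension amounts to when the residue field is perfect: residue
  field extensions are then separable, and the numerical conditions pass to subextensions.\<close>

definition tamely_defectless :: "'a set \<Rightarrow> 'a set \<Rightarrow> bool"
  where "tamely_defectless F E \<longleftrightarrow> finite_ext F E \<and>
    \<not> field_char residue_ring dvd ramification_index F E \<and>
    dim F E = ramification_index F E * residue_degree F E"

lemma residue_char_not_dvd_mult:
  "\<not> field_char residue_ring dvd a * b \<longleftrightarrow> \<not> field_char residue_ring dvd a \<and> \<not> field_char residue_ring dvd b"
proof (cases "field_char residue_ring = 0")
  case False
  then show ?thesis using prime_dvd_mult_iff[OF k.field_char_prime] by simp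
qed simp

lemma tamely_defectless_refl:
  assumes "subfield F R" shows "tamely_defectless F F"
proof -
  have "ramification_index F F = 1" using ramification_index_eq_1_iff[OF assms assms] by simp
  moreover have "residue_degree F F = 1"
    using k.finite_ext_refl(2)[OF residue_field_subfield[OF assms]] by (simp add: residue_degree_def)
  moreover have "\<not> field_char residue_ring dvd 1" using k.field_char_dvd[of 1] by simp
  ultimately show ?thesis using finite_ext_refl[OF assms] by (simp add: tamely_defectless_def)
qed

lemma tamely_defectless_trans:
  assumes "tamely_defectless F T" "tamely_defectless T E"
  shows "tamely_defectless F E"
proof -
  have f: "finite_ext F T" "finite_ext T E" using assms by (auto simp: tamely_defectless_def)
  note D = finite_extD[OF f(1)] and D' = finite_extD[OF f(2)]
  show ?thesis
    using assms finite_ext_trans[OF f] residue_degree_tower[OF f]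
      ramification_index_tower[OF D(1,2) D'(2) D(3) D'(3)]
    by (simp add: tamely_defectless_def residue_char_not_dvd_mult)
qed

text \<open>Each of the two steps satisfies the fundamental inequality, and the product of the two
  inequalities is an equality.\<close>

lemma tamely_defectless_intermediate:
  assumes "tamely_defectless F E" "subfield T R" "F \<subseteq> T" "T \<subseteq> E"
  shows "tamely_defectless F T" "tamely_defectless T E"
proof -
  have fe: "finite_ext F E" using assms(1) by (simp add: tamely_defectless_def)
  note f = finite_ext_intermediate[OF fe assms(2-4)]
  note D = finite_extD[OF f(1)] and D' = finite_extD[OF f(2)]
  note I = fundamental_inequality(3-5)[OF f(1)] and I' = fundamental_inequality(3-5)[OF f(2)]
  note e = ramification_index_tower[OF D(1,2) D'(2) D(3) D'(3)]
  let ?a = "ramification_index F T * residue_degree F T" and ?b = "ramification_index T E * residue_degree T E"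
  have "dim F T * dim T E = ?a * ?b"
    using assms(1) finite_ext_trans(2)[OF f] residue_degree_tower[OF f] e
    by (simp add: tamely_defectless_def)
  moreover have "0 < ?a" "0 < ?b" using I I' by auto
  ultimately have "dim F T = ?a" "dim T E = ?b"
    using I(1) I'(1) mult_le_less_imp_less[of ?a "dim F T" ?b "dim T E"] mult_less_le_imp_less[of ?a "dim F T" ?b "dim T E"]
    by (metis le_neq_implies_less less_irrefl zero_le)+
  then show "tamely_defectless F T" "tamely_defectless T E"
    using assms(1) f e by (auto simp: tamely_defectless_def residue_char_not_dvd_mult)
qed

lemma tamely_defectless_trivial:
  assumes "tamely_defectless F E" "value_group E = value_group F" "residue_field E = residue_field F"
  shows "E = F"
proof -
  have fe: "finite_ext F E" using assms(1) by (simp add: tamely_defectless_def)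
  note D = finite_extD[OF fe]
  have "ramification_index F E = 1" using ramification_index_eq_1_iff[OF D(1-3)] assms(2) by simp
  moreover have "residue_degree F E = 1"
    using k.finite_ext_refl(2)[OF residue_field_subfield[OF D(1)]] assms(3) by (simp add: residue_degree_def)
  ultimately have "dim F E = 1" using assms(1) by (simp add: tamely_defectless_def)
  then show ?thesis using dim_1_imp_eq[OF fe] by simp
qed

end

section \<open>Conjugation in henselian fields\<close>

sublocale henselian \<subseteq> ac_valued_field R \<nu>
  by unfold_locales

lemma card_set_mset_le_size: "card (set_mset A) \<le> size A"
  by (induction A) (auto simp: card_insert_if)

context henselian
begin

definition automorphisms_over :: "'a set \<Rightarrow> ('a \<Rightarrow> 'a) set"
  where "automorphisms_over F = {\<phi> \<in> ring_iso R R. \<forall>x\<in>F. \<phi> x = x}"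

abbreviation intermediate :: "'a set \<Rightarrow> bool"
  where "intermediate F \<equiv> subfield F R \<and> K \<subseteq> F"

lemma intermediate_base: "intermediate K"
  using subfield_axioms by simp

lemma intermediate_algebraic: "intermediate F \<Longrightarrow> x \<in> carrier R \<Longrightarrow> algebraic F x"
  using algebraic_extension[of x] algebraic_mono[of K F x] by (simp add: over_def)

lemma automorphism_props:
  assumes "\<phi> \<in> automorphisms_over F"
  shows "x \<in> carrier R \<Longrightarrow> \<phi> x \<in> carrier R"
    "\<lbrakk> x \<in> carrier R; y \<in> carrier R \<rbrakk> \<Longrightarrow> \<phi> (x \<oplus> y) = \<phi> x \<oplus> \<phi> y"
    "\<lbrakk> x \<in> carrier R; y \<in> carrier R \<rbrakk> \<Longrightarrow> \<phi> (x \<otimes> y) = \<phi> x \<otimes> \<phi> y"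
    "\<lbrakk> x \<in> carrier R; y \<in> carrier R \<rbrakk> \<Longrightarrow> \<phi> (x \<ominus> y) = \<phi> x \<ominus> \<phi> y"
    "\<phi> \<zero> = \<zero>" "\<phi> \<one> = \<one>" "x \<in> F \<Longrightarrow> \<phi> x = x"
    "x \<in> carrier R \<Longrightarrow> \<phi> (x [^] n) = \<phi> x [^] (n::nat)"
    "\<lbrakk> x \<in> carrier R; y \<in> carrier R; \<phi> x = \<phi> y \<rbrakk> \<Longrightarrow> x = y"
    "\<lbrakk> x \<in> carrier R; set p \<subseteq> F; F \<subseteq> carrier R \<rbrakk> \<Longrightarrow> \<phi> (eval p x) = eval p (\<phi> x)"
    "\<lbrakk> x \<in> carrier R; x \<noteq> \<zero> \<rbrakk> \<Longrightarrow> \<phi> (inv x) = inv (\<phi> x)"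
proof -
  have h: "\<phi> \<in> ring_hom R R" and b: "bij_betw \<phi> (carrier R) (carrier R)" and f: "\<And>x. x \<in> F \<Longrightarrow> \<phi> x = x"
    using assms by (auto simp: automorphisms_over_def ring_iso_def)
  interpret h: ring_hom_ring R R \<phi> using h by (intro ring_hom_ringI2) (auto intro: ring_axioms)
  show c: "x \<in> carrier R \<Longrightarrow> \<phi> x \<in> carrier R" for x by simp
  show "\<lbrakk> x \<in> carrier R; y \<in> carrier R \<rbrakk> \<Longrightarrow> \<phi> (x \<oplus> y) = \<phi> x \<oplus> \<phi> y"
    "\<lbrakk> x \<in> carrier R; y \<in> carrier R \<rbrakk> \<Longrightarrow> \<phi> (x \<otimes> y) = \<phi> x \<otimes> \<phi> y"
    "\<lbrakk> x \<in> carrier R; y \<in> carrier R \<rbrakk> \<Longrightarrow> \<phi> (x \<ominus> y) = \<phi> x \<ominus> \<phi> y"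
    "\<phi> \<zero> = \<zero>" "\<phi> \<one> = \<one>" by (simp_all add: a_minus_def)
  show "x \<in> F \<Longrightarrow> \<phi> x = x" using f .
  show "\<phi> (x [^] n) = \<phi> x [^] (n::nat)" if "x \<in> carrier R" using h.hom_nat_pow[OF that] .
  show "x = y" if "x \<in> carrier R" "y \<in> carrier R" "\<phi> x = \<phi> y"
    using inj_onD[OF bij_betw_imp_inj_on[OF b] that(3,1,2)] .
  show "\<phi> (eval p x) = eval p (\<phi> x)" if "x \<in> carrier R" "set p \<subseteq> F" "F \<subseteq> carrier R"
  proof -
    have "map \<phi> p = p" using that f by (intro map_idI) auto
    then show ?thesis using h.eval_hom'[of x p] that by auto
  qed
  show "\<phi> (inv x) = inv (\<phi> x)" if x: "x \<in> carrier R" "x \<noteq> \<zero>"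
  proof -
    have "\<phi> x \<otimes> \<phi> (inv x) = \<one>" using h.hom_mult[of x "inv x"] inv_props[OF x] x(1) by simp
    then show ?thesis using inv_props(1)[OF x] x(1) by (intro comm_inv_char[symmetric]) auto
  qed
qed

text \<open>This is the only way in which the uniqueness of the extension of the valuation is used.\<close>

lemma automorphism_value:
  assumes "K \<subseteq> F" "\<phi> \<in> automorphisms_over F" "x \<in> carrier R - {\<zero>}"
  shows "\<nu> (\<phi> x) = \<nu> x"
proof -
  note A = automorphism_props[OF assms(2)]
  have nz: "\<phi> x \<in> carrier R - {\<zero>}" if "x \<in> carrier R - {\<zero>}" for x
    using A(1)[of x] A(9)[of x \<zero>] A(5) that by auto
  have "valued_field R (\<lambda>x. \<nu> (\<phi> x))"
  proof (intro valued_field.intro valued_field_axioms.intro)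
    show "field R" by (rule field_axioms)
    fix x y assume xy: "x \<in> carrier R - {\<zero>}" "y \<in> carrier R - {\<zero>}"
    show "\<nu> (\<phi> (x \<otimes> y)) = \<nu> (\<phi> x) + \<nu> (\<phi> y)"
      using xy A(3)[of x y] val_mult[OF nz[OF xy(1)] nz[OF xy(2)]] by simp
    assume n: "x \<oplus> y \<noteq> \<zero>"
    then have "\<phi> x \<oplus> \<phi> y \<noteq> \<zero>" using nz[of "x \<oplus> y"] A(2)[of x y] xy by simp
    then show "min (\<nu> (\<phi> x)) (\<nu> (\<phi> y)) \<le> \<nu> (\<phi> (x \<oplus> y))"
      using xy A(2)[of x y] val_add[OF nz[OF xy(1)] nz[OF xy(2)]] by simp
  qed
  moreover have "\<nu> (\<phi> x) = \<nu> x" if "x \<in> K - {\<zero>}" for x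
  proof -
    have "x \<in> F" using that assms(1) by blast
    then show ?thesis using A(7) by simp
  qed
  ultimately show ?thesis using unique_extension[of "\<lambda>x. \<nu> (\<phi> x)"] assms(3) by blast
qed

lemma automorphism_val_ring:
  assumes "K \<subseteq> F" "\<phi> \<in> automorphisms_over F" "x \<in> carrier R"
  shows "\<phi> x \<in> val_ring \<longleftrightarrow> x \<in> val_ring" "\<phi> x \<in> val_ideal \<longleftrightarrow> x \<in> val_ideal"
proof -
  note A = automorphism_props[OF assms(2)]
  have "\<phi> x = \<zero> \<longleftrightarrow> x = \<zero>" using A(9)[of x \<zero>] A(5) assms(3) by auto
  then show "\<phi> x \<in> val_ring \<longleftrightarrow> x \<in> val_ring" "\<phi> x \<in> val_ideal \<longleftrightarrow> x \<in> val_ideal"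
    using A(1)[OF assms(3)] automorphism_value[OF assms(1,2), of x] assms(3)
    by (auto simp: mem_val_ring mem_val_ideal)
qed

lemma exists_automorphism:
  assumes "intermediate F" "x \<in> carrier R" "y \<in> carrier R" "eval (Irr F x) y = \<zero>"
  obtains \<phi> where "\<phi> \<in> automorphisms_over F" "\<phi> x = y"
  using conjugate_automorphism[OF _ intermediate_algebraic[OF assms(1)] assms(2-4)] assms(1)
  by (auto simp: automorphisms_over_def)

lemma finite_ext_simple_extension:
  assumes "intermediate F" "x \<in> carrier R"
  shows "finite_ext F (simple_extension F x)" "dim F (simple_extension F x) = degree (Irr F x)"
    "intermediate (simple_extension F x)" "F \<subseteq> simple_extension F x" "x \<in> simple_extension F x"
proof -
  have a: "algebraic F x" using intermediate_algebraic[OF assms] .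
  have F: "subfield F R" using assms(1) by simp
  note S = simple_extension_subfield[OF F assms(2) a]
  show "finite_ext F (simple_extension F x)" "intermediate (simple_extension F x)"
    "F \<subseteq> simple_extension F x" "x \<in> simple_extension F x"
    using S F assms(1) by (auto simp: finite_ext_def)
  show "dim F (simple_extension F x) = degree (Irr F x)"
    using simple_extension_dim[OF F assms(2)] a by (simp add: over_def)
qed

section \<open>Unramified elements\<close>

text \<open>An integral element whose conjugates have pairwise distinct residues. This is inherited by
  larger base fields, since there are fewer conjugates, and it implies that the element generates
  an unramified extension.\<close>

definition unramified_element :: "'a set \<Rightarrow> 'a \<Rightarrow> bool"
  where "unramified_element F c \<longleftrightarrow> c \<in> val_ring \<and> separable_over F c \<and>
    (\<forall>y\<in>carrier R. eval (Irr F c) y = \<zero> \<and> y \<ominus> c \<in> val_ideal \<longrightarrow> y = c)"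

lemma unramified_elementD:
  assumes "unramified_element F c"
  shows "c \<in> val_ring" "c \<in> carrier R" "separable_over F c"
    "\<lbrakk> y \<in> carrier R; eval (Irr F c) y = \<zero>; y \<ominus> c \<in> val_ideal \<rbrakk> \<Longrightarrow> y = c"
  using assms val_ring_carrier by (auto simp: unramified_element_def)

lemma unramified_element_mono:
  assumes "intermediate F" "intermediate F'" "F \<subseteq> F'" "unramified_element F c"
  shows "unramified_element F' c"
proof -
  note D = unramified_elementD[OF assms(4)]
  have F: "subfield F R" and F': "subfield F' R" using assms by auto
  note I = IrrE'[OF F D(2) intermediate_algebraic[OF assms(1) D(2)]]
  have "Irr F c \<in> carrier (F'[X])" using I(1) univ_poly_mono[OF assms(3)] by blast
  note P = Irr_pdivides[OF F' D(2) this I(7,4)]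
  show ?thesis
    unfolding unramified_element_def using D separable_over_mono[OF F F' assms(3) D(2,3)] P(5) by blast
qed

text \<open>Conjugates of \<open>c\<close> over \<open>E\<close> are as close to \<open>u\<close> as \<open>c\<close> is, hence close to \<open>c\<close>.\<close>

lemma unramified_element_mem:
  assumes E: "intermediate E" and c: "unramified_element E c" and u: "u \<in> E" "c \<ominus> u \<in> val_ideal"
  shows "c \<in> E"
proof -
  note D = unramified_elementD[OF c]
  have uc: "u \<in> carrier R" using u(1) E subfieldE(3) by blast
  have sE: "subfield E R" "K \<subseteq> E" "E \<subseteq> carrier R" using E subfieldE(3) by auto
  show ?thesis
  proof (rule unique_root_imp_mem[OF sE(1) D(2,3)])
    fix y assume y: "y \<in> carrier R" "eval (Irr E c) y = \<zero>"
    obtain \<phi> where s: "\<phi> \<in> automorphisms_over E" "\<phi> c = y"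
      by (rule exists_automorphism[OF E D(2) y])
    note A = automorphism_props[OF s(1)]
    have "\<phi> (c \<ominus> u) \<in> val_ideal"
      using automorphism_val_ring(2)[OF sE(2) s(1), of "c \<ominus> u"] u(2) D(2) uc by simp
    moreover have "\<phi> (c \<ominus> u) = y \<ominus> u" using A(4)[OF D(2) uc] A(7)[OF u(1)] s(2) by simp
    ultimately have "(y \<ominus> u) \<ominus> (c \<ominus> u) \<in> val_ideal" using val_ideal_closed(6) u(2) by simp
    moreover have "(y \<ominus> u) \<ominus> (c \<ominus> u) = y \<ominus> c"
      using y(1) uc D(2) by algebra
    ultimately show "y = c" using D(4)[OF y] by simp
  qed
qed

text \<open>Move one of two conjugates with the same residue to \<open>c\<close> by an automorphism.\<close>

lemma unramified_element_conjugates: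
  assumes F: "intermediate F" and c: "unramified_element F c"
    and y: "y \<in> carrier R" "eval (Irr F c) y = \<zero>" and y': "y' \<in> carrier R" "eval (Irr F c) y' = \<zero>"
    and d: "y \<ominus> y' \<in> val_ideal"
  shows "y = y'"
proof -
  note D = unramified_elementD[OF c]
  have sF: "subfield F R" "K \<subseteq> F" "F \<subseteq> carrier R" using F subfieldE(3) by auto
  note a = intermediate_algebraic[OF F D(2)]
  note I = IrrE'[OF sF(1) D(2) a]
  have "Irr F y' = Irr F c" using Irr_unique(2)[OF sF(1) D(2) a y'] .
  then have "eval (Irr F y') c = \<zero>" using I(4) by simp
  then obtain \<tau> where t: "\<tau> \<in> automorphisms_over F" "\<tau> y' = c"
    by (rule exists_automorphism[OF F y'(1) D(2)])
  note A = automorphism_props[OF t(1)]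
  have ty: "\<tau> y \<in> carrier R" using A(1)[OF y(1)] .
  have "eval (Irr F c) (\<tau> y) = \<zero>" using A(10)[OF y(1) I(5) sF(3)] y(2) A(5) by simp
  moreover have "\<tau> y \<ominus> c \<in> val_ideal"
    using automorphism_val_ring(2)[OF sF(2) t(1), of "y \<ominus> y'"] d A(4)[OF y(1) y'(1)] t(2) y(1) y'(1) by simp
  ultimately have "\<tau> y = c" using D(4)[OF ty] by blast
  then show ?thesis using A(9)[OF y(1) y'(1)] t(2) by simp
qed

text \<open>A polynomial over the residue field of \<open>F\<close> that vanishes at the residue of \<open>c\<close> vanishes at
  the residues of all conjugates, so its degree is at least their number.\<close>

lemma unramified_element_extension:
  assumes F: "intermediate F" and c: "unramified_element F c"
  shows "tamely_defectless F (simple_extension F c)"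
    "value_group (simple_extension F c) = value_group F"
proof -
  note D = unramified_elementD[OF c]
  have sF: "subfield F R" "K \<subseteq> F" "F \<subseteq> carrier R" using F subfieldE(3) by auto
  note a = intermediate_algebraic[OF F D(2)]
  note I = IrrE'[OF sF(1) D(2) a]
  let ?E = "simple_extension F c" and ?n = "degree (Irr F c)"
  note S = finite_ext_simple_extension[OF F D(2)]
  note kF = residue_field_subfield[OF sF(1)]
  have sE: "subfield ?E R" using S(3) by simp
  let ?Z = "{y \<in> carrier R. eval (Irr F c) y = \<zero>}"
  have cardZ: "card ?Z = ?n" using card_roots_separable[OF sF(1) D(2,3)] .
  have ZO: "y \<in> val_ring" if "y \<in> ?Z" for y
  proof -
    have y: "y \<in> carrier R" "eval (Irr F c) y = \<zero>" using that by auto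
    obtain \<phi> where s: "\<phi> \<in> automorphisms_over F" "\<phi> c = y"
      by (rule exists_automorphism[OF F D(2) y])
    then show ?thesis using automorphism_val_ring(1)[OF sF(2) s(1) D(2)] D(1) by simp
  qed
  have inj: "inj_on residue ?Z"
  proof (rule inj_onI)
    fix y y' assume y: "y \<in> ?Z" "y' \<in> ?Z" "residue y = residue y'"
    then have "y \<ominus> y' \<in> val_ideal" using residue_eq_iff ZO by simp
    then show "y = y'" using unramified_element_conjugates[OF F c] y by simp
  qed
  let ?x = "residue c"
  have xk: "?x \<in> carrier residue_ring" using residue_closed D(1) by simp
  have ebc: "set (k.exp_base ?x ?n) \<subseteq> carrier residue_ring" using k.exp_base_closed[OF xk] .
  have len: "length (k.exp_base ?x ?n) = ?n" by (simp add: k.exp_base_def)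
  have ind: "k.independent (residue_field F) (k.exp_base ?x ?n)"
  proof (rule ccontr)
    assume dep: "\<not> k.independent (residue_field F) (k.exp_base ?x ?n)"
    obtain Ks where Ks: "length Ks = length (k.exp_base ?x ?n)"
      "k.combine Ks (k.exp_base ?x ?n) = \<zero>\<^bsub>residue_ring\<^esub>" "set Ks \<subseteq> residue_field F" "set Ks \<noteq> {\<zero>\<^bsub>residue_ring\<^esub>}"
      by (rule k.dependent_imp_non_trivial_combine[OF kF ebc dep])
    have lK: "length Ks = ?n" using Ks(1) len by simp
    have ev: "k.eval Ks ?x = \<zero>\<^bsub>residue_ring\<^esub>" using k.combine_eq_eval[of Ks ?x] Ks(2) lK by simp
    have Kc: "set Ks \<subseteq> carrier residue_ring" using Ks(3) subfieldE(3)[OF kF] by blast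
    have Kn: "\<not> set Ks \<subseteq> {\<zero>\<^bsub>residue_ring\<^esub>}" using Ks(4) lK I(8) by (auto simp: subset_singleton_iff)
    obtain q where q: "set q \<subseteq> F" "set q \<subseteq> val_ring" "map residue q = Ks"
      by (rule lift_list[OF sF(1) Ks(3)])
    have van: "k.eval Ks (residue y) = \<zero>\<^bsub>residue_ring\<^esub>" if y: "y \<in> ?Z" for y
    proof -
      have y': "y \<in> carrier R" "eval (Irr F c) y = \<zero>" using y by auto
      obtain \<phi> where s: "\<phi> \<in> automorphisms_over F" "\<phi> c = y"
        by (rule exists_automorphism[OF F D(2) y'])
      have qc: "eval q c \<in> val_ring" using eval_val_ring[OF q(2) D(1)] .
      have "residue (eval q c) = \<zero>\<^bsub>residue_ring\<^esub>" using residue_eval[OF q(2) D(1)] q(3) ev by simp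
      then have "eval q c \<in> val_ideal" using residue_zero_iff[OF qc] by simp
      then have "\<phi> (eval q c) \<in> val_ideal"
        using automorphism_val_ring(2)[OF sF(2) s(1) val_ring_carrier[OF qc]] by simp
      then have "eval q y \<in> val_ideal" using automorphism_props(10)[OF s(1) D(2) q(1) sF(3)] s(2) by simp
      then have "residue (eval q y) = \<zero>\<^bsub>residue_ring\<^esub>"
        using residue_zero_iff[of "eval q y"] val_ideal_closed(7) by blast
      then show ?thesis using residue_eval[OF q(2) ZO[OF y]] q(3) by simp
    qed
    let ?P = "k.normalize Ks"
    have P: "?P \<in> carrier (poly_ring residue_ring)"
      using k.normalize_gives_polynomial[OF Kc] by (simp add: univ_poly_carrier)
    have P0: "?P \<noteq> []"
    proof
      assume "?P = []"
      then have "k.coeff Ks i = \<zero>\<^bsub>residue_ring\<^esub>" for i using k.normalize_coeff[of Ks] by (metis k.coeff.simps(1))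
      then have "(k.coeff Ks) ` {..<length Ks} \<subseteq> {\<zero>\<^bsub>residue_ring\<^esub>}" by auto
      then show False using Kn k.coeff_img_restrict[of Ks] by simp
    qed
    have "residue ` ?Z \<subseteq> {z \<in> carrier residue_ring. k.eval ?P z = \<zero>\<^bsub>residue_ring\<^esub>}"
    proof (rule image_subsetI)
      fix y assume y: "y \<in> ?Z"
      then have "residue y \<in> carrier residue_ring" using residue_closed ZO by blast
      then show "residue y \<in> {z \<in> carrier residue_ring. k.eval ?P z = \<zero>\<^bsub>residue_ring\<^esub>}"
        using van[OF y] k.eval_normalize[OF Kc] by simp
    qed
    then have "card (residue ` ?Z) \<le> card (set_mset (k.roots ?P))"
      unfolding k.finite_roots(2)[OF P P0] by (intro card_mono) auto
    also have "\<dots> \<le> size (k.roots ?P)" by (rule card_set_mset_le_size)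
    also have "\<dots> = degree ?P" by (rule k.size_roots_eq_degree[OF P])
    also have "\<dots> \<le> length Ks - 1" using k.normalize_length_le[of Ks] by linarith
    also have "\<dots> < ?n" using lK I(8) by linarith
    finally show False using card_image[OF inj] cardZ by simp
  qed
  have xE: "?x \<in> residue_field ?E"
    using S(5) D(1) mem_valuation_ring[OF sE] by (auto simp: residue_field_alt)
  have "set (k.exp_base ?x ?n) \<subseteq> residue_field ?E"
    using k.pow_closed_subring[OF subfieldE(1)[OF residue_field_subfield[OF sE]] xE] by (auto simp: k.exp_base_def)
  then have nf: "?n \<le> residue_degree F ?E"
    using k.independent_length_le_dimension[OF kF k.finite_extD(5)[OF fundamental_inequality(2)[OF S(1)]] ind] len
    by (simp add: residue_degree_def)
  note FI = fundamental_inequality(3-5)[OF S(1)]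
  have "1 * residue_degree F ?E \<le> ramification_index F ?E * residue_degree F ?E"
    using FI(2) by (intro mult_le_mono1) simp
  then have f: "residue_degree F ?E = ?n" and ef: "ramification_index F ?E * residue_degree F ?E = ?n"
    using FI(1) S(2) nf by linarith+
  then have "ramification_index F ?E * ?n = 1 * ?n" by simp
  then have "ramification_index F ?E = 1 \<or> ?n = 0" by (simp only: mult_cancel2)
  moreover have "?n \<noteq> 0" using I(8) by linarith
  ultimately have e: "ramification_index F ?E = 1" by argo
  then show "value_group ?E = value_group F"
    using ramification_index_eq_1_iff[OF sF(1) sE S(4)] by simp
  have "\<not> field_char residue_ring dvd 1" using k.field_char_dvd[of 1] by simp
  then show "tamely_defectless F ?E" using S(1,2) e f by (simp add: tamely_defectless_def)
qed

end

section \<open>Radicals of exponent prime to the residue characteristic\<close>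

context henselian
begin

abbreviation tame_exponents :: "nat set"
  where "tame_exponents \<equiv> {n. \<not> field_char residue_ring dvd n}"

lemma tame_exponent_pos: "n \<in> tame_exponents \<Longrightarrow> 0 < n"
  by (cases n) auto

lemma residue_of_nat: "[n] \<cdot> \<one> \<in> val_ring \<and> residue ([n] \<cdot> \<one>) = [n] \<cdot>\<^bsub>residue_ring\<^esub> \<one>\<^bsub>residue_ring\<^esub>" for n :: nat
  by (induction n) (auto simp: val_ring_closed residue_zero residue_one residue_add)

lemma tame_exponent_nonzero:
  assumes "n \<in> tame_exponents" shows "[n] \<cdot> \<one> \<noteq> \<zero>"
proof
  assume "[n] \<cdot> \<one> = \<zero>"
  then have "[n] \<cdot>\<^bsub>residue_ring\<^esub> \<one>\<^bsub>residue_ring\<^esub> = \<zero>\<^bsub>residue_ring\<^esub>"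
    using residue_of_nat[of n] residue_zero by simp
  then show False using k.field_char_dvd[of n] assms by simp
qed

text \<open>Otherwise \<open>1 + z + z\<^sup>2 + ...\<close>, with \<open>n\<close> terms, vanishes, whereas its residue is \<open>n\<close>.\<close>

lemma root_of_unity_near_one:
  assumes z: "z \<in> carrier R" "z [^] n = \<one>" "z \<ominus> \<one> \<in> val_ideal" and n: "n \<in> tame_exponents"
  shows "z = \<one>"
proof (rule ccontr)
  assume z1: "z \<noteq> \<one>"
  let ?s = "\<lambda>m. eval (replicate m \<one>) z"
  have sc: "?s m \<in> carrier R" for m using z by (intro eval_in_carrier) auto
  have geo: "(z \<ominus> \<one>) \<otimes> ?s m = z [^] m \<ominus> \<one>" for m :: nat
  proof (induction m)
    case 0
    then show ?case using z by (simp add: a_minus_def r_neg)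
  next
    case (Suc m)
    have "(z \<ominus> \<one>) \<otimes> ?s (Suc m) = (z \<ominus> \<one>) \<otimes> z [^] m \<oplus> (z \<ominus> \<one>) \<otimes> ?s m"
      using z sc[of m] by (simp add: r_distr)
    also have "\<dots> = (z \<ominus> \<one>) \<otimes> z [^] m \<oplus> (z [^] m \<ominus> \<one>)" using Suc by simp
    also have "\<dots> = z [^] m \<otimes> z \<ominus> \<one>"
    proof -
      have "z [^] m \<in> carrier R" using z by simp
      then show ?thesis using z(1) by algebra
    qed
    finally show ?case by simp
  qed
  have "(z \<ominus> \<one>) \<otimes> ?s n = \<zero>" using geo[of n] z by (simp add: a_minus_def r_neg)
  moreover have "z \<ominus> \<one> \<noteq> \<zero>" using z1 z(1) r_right_minus_eq[of z \<one>] by simp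
  ultimately have s0: "?s n = \<zero>" using integral[of "z \<ominus> \<one>" "?s n"] sc z(1) by auto
  have "z = (z \<ominus> \<one>) \<oplus> \<one>" using z(1) by algebra
  then have zO: "z \<in> val_ring" using val_ideal_closed(7)[OF z(3)] val_ring_closed(2,5) by metis
  have rz: "residue z = \<one>\<^bsub>residue_ring\<^esub>"
    using residue_eq_iff[OF zO val_ring_closed(2)] z(3) residue_one by simp
  have "k.eval (replicate m \<one>\<^bsub>residue_ring\<^esub>) \<one>\<^bsub>residue_ring\<^esub> = [m] \<cdot>\<^bsub>residue_ring\<^esub> \<one>\<^bsub>residue_ring\<^esub>" for m :: nat
    by (induction m) (auto simp: k.a_comm)
  moreover have "set (replicate n \<one>) \<subseteq> val_ring" using val_ring_closed(2) by auto
  ultimately have "residue (?s n) = [n] \<cdot>\<^bsub>residue_ring\<^esub> \<one>\<^bsub>residue_ring\<^esub>"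
    using residue_eval[OF _ zO, of "replicate n \<one>"] rz residue_one by (simp add: map_replicate_const)
  then have "[n] \<cdot>\<^bsub>residue_ring\<^esub> \<one>\<^bsub>residue_ring\<^esub> = \<zero>\<^bsub>residue_ring\<^esub>" using s0 residue_zero by simp
  then show False using k.field_char_dvd[of n] n by simp
qed

lemma pow_nonzero: "x \<in> carrier R \<Longrightarrow> x \<noteq> \<zero> \<Longrightarrow> x [^] (n::nat) \<noteq> \<zero>"
  by (induction n) (auto simp: integral_iff)

text \<open>The minimal polynomial of \<open>x\<close> divides \<open>X\<^sup>n - x\<^sup>n\<close>.\<close>

lemma radical_conjugate:
  assumes "intermediate F" "x \<in> carrier R" "x [^] n \<in> F" "0 < n" "y \<in> carrier R" "eval (Irr F x) y = \<zero>"
  shows "y [^] n = x [^] n" "degree (Irr F x) \<le> n"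
proof -
  have F: "subfield F R" using assms by simp
  note P = pure_poly[OF subfieldE(1)[OF F] assms(3,4)]
  have ne: "pure_poly n (x [^] n) \<noteq> []" using P(2) by auto
  have ex: "eval (pure_poly n (x [^] n)) x = \<zero>" using P(4)[OF assms(2)] assms(2) by simp
  note D = Irr_pdivides[OF F assms(2) P(1) ne ex]
  show "y [^] n = x [^] n" using D(5)[OF assms(5,6)] P(4)[OF assms(5)] assms(2,5) by simp
  show "degree (Irr F x) \<le> n"
    using pdivides_imp_degree_le[OF subfieldE(1)[OF F] IrrE'(1)[OF F assms(2) D(1)] P(1) ne D(2)] P(2) by simp
qed

text \<open>Conjugates of \<open>u\<close> differ from \<open>u\<close> by \<open>n\<close>-th roots of unity as factors, and these have distinct
  residues.\<close>

lemma unit_radical_unramified: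
  assumes F: "intermediate F" and u: "u \<in> val_ring - val_ideal" "u [^] n \<in> F" and n: "n \<in> tame_exponents"
  shows "unramified_element F u"
proof -
  have u': "u \<in> carrier R" "u \<noteq> \<zero>" "u \<in> val_ring" using u(1) unit_iff by blast+
  note i = inv_props[OF u'(1,2)]
  have iO: "inv u \<in> val_ring" using unit_inv[OF u(1)] by blast
  show ?thesis
    unfolding unramified_element_def
  proof (intro conjI ballI impI)
    show "u \<in> val_ring" by fact
    show "separable_over F u" using radical_separable[OF _ _ u(2) tame_exponent_nonzero[OF n]] F u' by simp
    fix y assume y: "y \<in> carrier R" and yy: "eval (Irr F u) y = \<zero> \<and> y \<ominus> u \<in> val_ideal"
    have yn: "y [^] n = u [^] n" using radical_conjugate(1)[OF F u'(1) u(2) tame_exponent_pos[OF n] y] yy by simp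
    let ?z = "y \<otimes> inv u"
    have "?z [^] n = u [^] n \<otimes> inv u [^] n" using y i by (simp add: nat_pow_distrib yn)
    also have "\<dots> = (u \<otimes> inv u) [^] n" by (rule nat_pow_distrib[OF u'(1) i(1), symmetric])
    finally have z1: "?z [^] n = \<one>" using i by (simp add: nat_pow_one)
    have "(y \<ominus> u) \<otimes> inv u = ?z \<ominus> u \<otimes> inv u" using y u' i(1) by algebra
    then have "?z \<ominus> \<one> = (y \<ominus> u) \<otimes> inv u" using i by simp
    then have "?z \<ominus> \<one> \<in> val_ideal" using val_ideal_closed(4)[of "y \<ominus> u" "inv u"] yy iO by simp
    then have "?z = \<one>" using root_of_unity_near_one[OF _ z1 _ n] y i by simp
    then have "(y \<otimes> inv u) \<otimes> u = u" using u' by simp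
    then show "y = u" using y u' i by (simp add: m_assoc)
  qed
qed

lemma value_group_mem: "g \<in> value_group F \<Longrightarrow> \<exists>b\<in>F. b \<noteq> \<zero> \<and> \<nu> b = g"
  by (auto simp: value_group_def)

lemma value_group_pow:
  assumes "a \<in> F" "a \<noteq> \<zero>" "subfield F R"
  shows "\<nu> (a [^] (n::nat)) \<in> value_group F"
proof -
  have "a \<in> carrier R" using assms subfieldE(3) by blast
  then have "a [^] n \<in> F - {\<zero>}"
    using pow_closed_subring[OF subfieldE(1)[OF assms(3)] assms(1)] pow_nonzero assms(2) by simp
  then show ?thesis unfolding value_group_def by blast
qed

lemma value_quotient:
  "\<lbrakk> x \<in> carrier R; x \<noteq> \<zero>; y \<in> carrier R; y \<noteq> \<zero> \<rbrakk> \<Longrightarrow> \<nu> (x \<otimes> inv y) = \<nu> x - \<nu> y \<and> x \<otimes> inv y \<noteq> \<zero>"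
  using val_mult[of x "inv y"] val_inv[of y] inv_props[of y] integral_iff[of x "inv y"] by simp

lemma value_pow_mult: "a \<in> carrier R \<Longrightarrow> a \<noteq> \<zero> \<Longrightarrow> \<nu> (a [^] (i + j)) = \<nu> (a [^] i) + \<nu> (a [^] j)" for i j :: nat
  using val_mult[of "a [^] i" "a [^] j"] pow_nonzero[of a] by (simp add: nat_pow_mult)

text \<open>The values of the powers of \<open>a\<close> with exponent less than \<open>N\<close> lie in different cosets, so the
  ramification index is at least \<open>N\<close>, while the degree is at most \<open>N\<close>.\<close>

lemma ramified_radical_extension:
  assumes F: "intermediate F" and a: "a \<in> carrier R" "a \<noteq> \<zero>" and aN: "a [^] N \<in> F" and N: "N \<in> tame_exponents"
    and min: "\<And>i::nat. \<lbrakk> 0 < i; i < N \<rbrakk> \<Longrightarrow> \<nu> (a [^] i) \<notin> value_group F"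
  shows "tamely_defectless F (simple_extension F a)"
proof -
  let ?E = "simple_extension F a"
  have sF: "subfield F R" using F by simp
  note S = finite_ext_simple_extension[OF F a(1)]
  have sE: "subfield ?E R" using S(3) by simp
  note aa = IrrE'(4)[OF sF a(1) intermediate_algebraic[OF F a(1)]]
  have dN: "dim F ?E \<le> N" using radical_conjugate(2)[OF F a(1) aN tame_exponent_pos[OF N] a(1) aa] S(2) by simp
  note H = value_group_subgroup[OF sF]
  let ?f = "\<lambda>i. translate (value_group F) (\<nu> (a [^] i))"
  have ne: "?f i \<noteq> ?f j" if "i < j" "j < N" for i j
  proof
    assume "?f i = ?f j"
    then have "?f j = ?f i" by simp
    then have "\<nu> (a [^] j) - \<nu> (a [^] i) \<in> value_group F" by (simp add: translate_eq_iff[OF H])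
    moreover have "\<nu> (a [^] j) = \<nu> (a [^] (j - i)) + \<nu> (a [^] i)" using value_pow_mult[OF a, of "j - i" i] that by simp
    ultimately show False using min[of "j - i"] that by simp
  qed
  have inj: "inj_on ?f {..<N}"
    by (rule linorder_inj_onI) (use ne in auto)
  have "?f ` {..<N} \<subseteq> translate (value_group F) ` value_group ?E"
    using value_group_pow[OF S(5) a(2) sE] by blast
  then have "card (?f ` {..<N}) \<le> ramification_index F ?E"
    unfolding ramification_index_alt using fundamental_inequality(1)[OF S(1)] by (rule card_mono[rotated])
  then have eN: "N \<le> ramification_index F ?E" using card_image[OF inj] by simp
  note FI = fundamental_inequality(3-5)[OF S(1)]
  have "ramification_index F ?E * 1 \<le> ramification_index F ?E * residue_degree F ?E"
    using FI(3) by (intro mult_le_mono2) simp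
  then have "ramification_index F ?E = N" "dim F ?E = ramification_index F ?E * residue_degree F ?E"
    using FI(1) dN eN by linarith+
  then show ?thesis using S(1) N by (simp add: tamely_defectless_def)
qed

text \<open>With \<open>N\<close> the order of the value of \<open>w\<close> modulo that of \<open>F\<close>, the radical \<open>w\<close> is an \<open>N\<close>-th root
  of \<open>b u\<close>, where \<open>b\<close> is in \<open>F\<close> and the unit \<open>u\<close>, itself a radical, generates an unramified
  extension.\<close>

lemma tame_radical_extension:
  assumes F: "intermediate F" and w: "w \<in> carrier R" "w \<noteq> \<zero>" and wn: "w [^] n \<in> F" and n: "n \<in> tame_exponents"
  shows "tamely_defectless F (simple_extension F w)"
proof -
  have sF: "subfield F R" "F \<subseteq> carrier R" using F subfieldE(3) by auto
  note D = additive_subgroup_setD[OF value_group_subgroup[OF sF(1)]]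
  note n0 = tame_exponent_pos[OF n]
  let ?P = "\<lambda>i::nat. 0 < i \<and> \<nu> (w [^] i) \<in> value_group F"
  have "w [^] n \<in> F - {\<zero>}" using wn pow_nonzero[OF w] by simp
  then have Pn: "?P n" using n0 by (auto simp: value_group_def)
  define N where "N = (LEAST i. ?P i)"
  have PN: "?P N" unfolding N_def by (rule LeastI[of ?P n, OF Pn])
  have min: "\<nu> (w [^] i) \<notin> value_group F" if "0 < i" "i < N" for i :: nat
    using not_less_Least[of i ?P] that unfolding N_def by blast
  have mult: "\<nu> (w [^] (N * q)) \<in> value_group F" for q :: nat
  proof (induction q)
    case (Suc q)
    have "\<nu> (w [^] (N * Suc q)) = \<nu> (w [^] N) + \<nu> (w [^] (N * q))" using value_pow_mult[OF w, of N "N * q"] by simp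
    then show ?case using Suc PN D(4) by simp
  qed (use D(1) in simp)
  have dvd: "N dvd n"
  proof (rule ccontr)
    assume "\<not> N dvd n"
    then have r: "0 < n mod N" "n mod N < N" using PN by (simp_all add: dvd_eq_mod_eq_0)
    have "\<nu> (w [^] n) = \<nu> (w [^] (n mod N)) + \<nu> (w [^] (N * (n div N)))"
      using value_pow_mult[OF w, of "n mod N" "N * (n div N)"] by simp
    then have "\<nu> (w [^] (n mod N)) = \<nu> (w [^] n) - \<nu> (w [^] (N * (n div N)))" by simp
    then show False using D(2) Pn mult min[OF r] by simp
  qed
  then obtain m where m: "n = N * m" by (auto elim: dvdE)
  have tN: "N \<in> tame_exponents" and tm: "m \<in> tame_exponents"
    using n m residue_char_not_dvd_mult[of N m] by auto
  obtain b where b: "b \<in> F" "b \<noteq> \<zero>" "\<nu> b = \<nu> (w [^] N)" using value_group_mem PN by metis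
  have bc: "b \<in> carrier R" using b sF(2) by blast
  note ib = inv_props[OF bc b(2)]
  have ibF: "inv b \<in> F" using subfield_m_inv(1)[OF sF(1)] b by simp
  have wN: "w [^] N \<in> carrier R" "w [^] N \<noteq> \<zero>" using w pow_nonzero[OF w] by auto
  let ?u = "w [^] N \<otimes> inv b"
  have uc: "?u \<in> carrier R" using wN ib by simp
  have u: "?u \<in> val_ring - val_ideal" unfolding unit_iff using value_quotient[OF wN bc b(2)] b(3) uc by simp
  have "?u [^] m = w [^] n \<otimes> inv b [^] m" using w wN ib by (simp add: nat_pow_distrib nat_pow_pow m)
  then have um: "?u [^] m \<in> F"
    using subringE(6)[OF subfieldE(1)[OF sF(1)] wn pow_closed_subring[OF subfieldE(1)[OF sF(1)] ibF]] by simp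
  let ?T = "simple_extension F ?u"
  note ST = finite_ext_simple_extension[OF F uc]
  note T = unramified_element_extension[OF F unit_radical_unramified[OF F u um tm]]
  have sT: "subfield ?T R" using ST(3) by simp
  have eq: "?u \<otimes> b = w [^] N" using wN ib bc by (simp add: m_assoc)
  have "?u \<otimes> b \<in> ?T"
    using subringE(6)[OF subfieldE(1)[OF sT] ST(5)] ST(4) b(1) by blast
  then have wT: "w [^] N \<in> ?T" unfolding eq .
  have 2: "tamely_defectless ?T (simple_extension ?T w)"
    using ramified_radical_extension[OF ST(3) w wT tN] min T(2) by simp
  note SF = finite_ext_simple_extension[OF F w(1)]
  have sW: "subring (simple_extension F w) R" using SF(3) subfieldE(1) by blast
  have "?u \<in> simple_extension F w"
    using subringE(6)[OF sW pow_closed_subring[OF sW SF(5)]] ibF SF(4) by blast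
  then have "?T \<subseteq> simple_extension F w" using simple_extension_subring_incl[OF sW SF(4)] by simp
  then have "simple_extension ?T w \<subseteq> simple_extension F w"
    using simple_extension_subring_incl[OF sW _ SF(5)] by simp
  moreover have "simple_extension F w \<subseteq> simple_extension ?T w" using mono_simple_extension[OF ST(4)] .
  ultimately have "simple_extension ?T w = simple_extension F w" by blast
  then show ?thesis using tamely_defectless_trans[OF T(1) 2] by simp
qed

text \<open>The polynomial \<open>X\<^sup>n - u\<close> has a root close to \<open>1\<close>. Being an unramified element and close to an element
  of \<open>E\<close>, it lies in \<open>E\<close>.\<close>

lemma one_unit_root:
  assumes E: "intermediate E" and u: "u \<in> E" "u \<ominus> \<one> \<in> val_ideal" and n: "n \<in> tame_exponents"
  obtains v where "v \<in> E" "v [^] n = u" "v \<in> val_ring - val_ideal"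
proof -
  have sE: "subfield E R" "E \<subseteq> carrier R" using E subfieldE(3) by auto
  have uc: "u \<in> carrier R" using u sE by blast
  note n0 = tame_exponent_pos[OF n]
  let ?p = "pure_poly n u"
  note P = pure_poly[OF subfieldE(1)[OF sE(1)] u(1) n0]
  have "u = (u \<ominus> \<one>) \<oplus> \<one>" using uc by algebra
  then have uO: "u \<in> val_ring" using val_ideal_closed(7)[OF u(2)] val_ring_closed(2,5) by metis
  have pO: "set ?p \<subseteq> val_ring" using pure_poly(3)[OF val_ring_subring uO n0] .
  have p0: "?p \<noteq> []" using P(2) by auto
  have hp: "hd ?p = \<one>" by (simp add: pure_poly_def monom_def)
  have pc: "?p \<in> carrier (poly_ring R)" using carrier_polynomial_shell[OF subfieldE(1)[OF sE(1)] P(1)] .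
  have int: "c \<in> val_ring" if "c \<in> carrier R" "eval ?p c = \<zero>" for c
    using root_of_unit_lead_coeff[OF pO p0 _ that] hp val_ideal_closed(9) by simp
  have "eval ?p \<one> = \<one> \<ominus> u" using P(4)[of \<one>] by (simp add: nat_pow_one)
  also have "\<one> \<ominus> u = \<ominus> (u \<ominus> \<one>)" using uc by algebra
  finally have "eval ?p \<one> = \<ominus> (u \<ominus> \<one>)" .
  then have near: "eval ?p \<one> \<in> val_ideal" using val_ideal_closed(3)[OF u(2)] by (simp only:)
  have hu: "hd ?p \<in> val_ring - val_ideal" using hp val_ring_closed(2) val_ideal_closed(9) by simp
  have "\<exists>c\<in>val_ring. eval ?p c = \<zero> \<and> \<one> \<ominus> c \<in> val_ideal"
    by (rule root_near_approximate_root[OF pc p0 hu int val_ring_closed(2) near])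
  then obtain v where v: "v \<in> val_ring" "eval ?p v = \<zero>" "\<one> \<ominus> v \<in> val_ideal" by blast
  have vc: "v \<in> carrier R" using val_ring_carrier[OF v(1)] .
  have "v [^] n \<ominus> u = \<zero>" using P(4)[OF vc] v(2) by simp
  then have vn: "v [^] n = u" using r_right_minus_eq[of "v [^] n" u] vc uc by simp
  have "\<one> = (\<one> \<ominus> v) \<oplus> v" using vc by algebra
  then have "v \<notin> val_ideal" using val_ideal_closed(2)[OF v(3)] val_ideal_closed(9) by metis
  then have vu: "v \<in> val_ring - val_ideal" using v(1) by blast
  have un: "unramified_element E v" using unit_radical_unramified[OF E vu _ n] vn u(1) by simp
  have "v \<ominus> \<one> = \<ominus> (\<one> \<ominus> v)" using vc by algebra
  then have d: "v \<ominus> \<one> \<in> val_ideal" using val_ideal_closed(3)[OF v(3)] by simp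
  have "v \<in> E" using unramified_element_mem[OF E un _ d] subringE(3)[OF subfieldE(1)[OF sE(1)]] by simp
  then show thesis using that vn vu by blast
qed

text \<open>If \<open>T\<close> and \<open>E\<close> have the same residue field, then, modulo 1-units, which are \<open>n\<close>-th powers, an
  element of \<open>E\<close> whose \<open>n\<close>-th power has a value in \<open>T\<close> is an \<open>n\<close>-th root of an element of \<open>T\<close>.\<close>

lemma radical_with_value:
  assumes T: "intermediate T" and E: "intermediate E" "T \<subseteq> E" and res: "residue_field E = residue_field T"
    and a: "a \<in> E" "a \<noteq> \<zero>" and n: "n \<in> tame_exponents" and v: "\<nu> (a [^] n) \<in> value_group T"
  obtains w where "w \<in> E" "w \<noteq> \<zero>" "w [^] n \<in> T" "\<nu> w = \<nu> a"
proof -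
  have sE: "subfield E R" "E \<subseteq> carrier R" and sT: "subfield T R" "T \<subseteq> carrier R"
    using E T subfieldE(3) by auto
  note rE = subringE[OF subfieldE(1)[OF sE(1)]]
  have ac: "a \<in> carrier R" using a sE by blast
  have an: "a [^] n \<in> carrier R" "a [^] n \<noteq> \<zero>" "a [^] n \<in> E"
    using ac pow_nonzero[OF ac a(2)] pow_closed_subring[OF subfieldE(1)[OF sE(1)] a(1)] by auto
  obtain b where b: "b \<in> T" "b \<noteq> \<zero>" "\<nu> b = \<nu> (a [^] n)" using value_group_mem[OF v] by metis
  have bc: "b \<in> carrier R" "b \<in> E" using b(1) sT(2) E(2) by blast+
  note ib = inv_props[OF bc(1) b(2)]
  have ibE: "inv b \<in> E" using subfield_m_inv(1)[OF sE(1)] bc b by simp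
  let ?u = "a [^] n \<otimes> inv b"
  have uE: "?u \<in> E" using rE(6)[OF an(3) ibE] .
  have uc: "?u \<in> carrier R" using an ib by simp
  have uu: "?u \<in> val_ring - val_ideal" unfolding unit_iff using value_quotient[OF an(1,2) bc(1) b(2)] b(3) uc by simp
  then have "residue ?u \<in> residue_field E" using uE mem_valuation_ring[OF sE(1)] by (auto simp: residue_field_alt)
  then obtain s where s: "s \<in> T" "s \<in> val_ring" "residue s = residue ?u"
    using res mem_valuation_ring[OF sT(1)] by (auto simp: residue_field_alt)
  have sc: "s \<in> carrier R" "s \<in> E" using s(1) sT(2) E(2) by blast+
  have "residue s \<noteq> \<zero>\<^bsub>residue_ring\<^esub>" using s(3) residue_zero_iff[of ?u] uu by auto
  then have su: "s \<in> val_ring - val_ideal" using residue_zero_iff[OF s(2)] s(2) by simp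
  then have s0: "s \<noteq> \<zero>" using unit_iff by blast
  note js = inv_props[OF sc(1) s0]
  have isE: "inv s \<in> E" using subfield_m_inv(1)[OF sE(1)] sc s0 by simp
  have isO: "inv s \<in> val_ring" using unit_inv[OF su] by blast
  let ?u' = "?u \<otimes> inv s"
  have u'E: "?u' \<in> E" using rE(6)[OF uE isE] .
  have "?u \<ominus> s \<in> val_ideal" using residue_eq_iff[of ?u s] s uu by auto
  then have "(?u \<ominus> s) \<otimes> inv s \<in> val_ideal" using val_ideal_closed(4) isO by blast
  moreover have "(?u \<ominus> s) \<otimes> inv s = ?u' \<ominus> s \<otimes> inv s" using uc sc(1) js(1) by algebra
  ultimately have "?u' \<ominus> \<one> \<in> val_ideal" using js by simp
  then obtain r where r: "r \<in> E" "r [^] n = ?u'" "r \<in> val_ring - val_ideal"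
    by (rule one_unit_root[OF E(1) u'E _ n])
  have r': "r \<in> carrier R" "r \<noteq> \<zero>" "\<nu> r = 0" using r(3) unit_iff by blast+
  note ir = inv_props[OF r'(1,2)]
  have irE: "inv r \<in> E" using subfield_m_inv(1)[OF sE(1)] r r' by simp
  let ?w = "a \<otimes> inv r"
  have wE: "?w \<in> E" using rE(6)[OF a(1) irE] .
  have wv: "\<nu> ?w = \<nu> a \<and> ?w \<noteq> \<zero>" using value_quotient[OF ac a(2) r'(1,2)] r'(3) by simp
  have bs: "b \<otimes> s \<in> T" using subringE(6)[OF subfieldE(1)[OF sT(1)] b(1) s(1)] .
  have "a [^] n = (b \<otimes> s) \<otimes> r [^] n"
  proof -
    have "(b \<otimes> s) \<otimes> r [^] n = a [^] n \<otimes> (b \<otimes> inv b) \<otimes> (s \<otimes> inv s)"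
      unfolding r(2) using an(1) bc(1) ib(1) sc(1) js(1) by algebra
    then show ?thesis using an ib js by simp
  qed
  then have "?w [^] n = (b \<otimes> s) \<otimes> (r [^] n \<otimes> inv r [^] n)"
    using ac r' ir bc sc by (simp add: nat_pow_distrib m_assoc)
  also have "r [^] n \<otimes> inv r [^] n = \<one>"
    using nat_pow_distrib[of r "inv r" n] r' ir by (simp add: nat_pow_one)
  finally have "?w [^] n = b \<otimes> s" using bc sc by simp
  then show thesis using that[of ?w] wE wv bs by simp
qed

section \<open>Towers of unramified and radical extensions\<close>

text \<open>The exponents of the radicals are taken from \<open>N\<close>: the set of all exponents prime to the
  residue characteristic gives the tame extensions and the empty set the unramified ones.\<close>

inductive tower :: "nat set \<Rightarrow> 'a set \<Rightarrow> 'a set \<Rightarrow> bool" for N F where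
  tower_base: "tower N F F"
| tower_unramified: "\<lbrakk> tower N F E; unramified_element E c \<rbrakk> \<Longrightarrow> tower N F (simple_extension E c)"
| tower_radical: "\<lbrakk> tower N F E; c \<in> carrier R; c \<noteq> \<zero>; n \<in> N; c [^] n \<in> E \<rbrakk> \<Longrightarrow> tower N F (simple_extension E c)"

lemma tower_tamely_defectless:
  assumes "tower N F E" "intermediate F" "N \<subseteq> tame_exponents"
  shows "intermediate E \<and> F \<subseteq> E \<and> tamely_defectless F E \<and> (N = {} \<longrightarrow> value_group E = value_group F)"
  using assms(1)
proof induction
  case tower_base
  then show ?case using assms(2) tamely_defectless_refl by simp
next
  case (tower_unramified E c)
  note E = tower_unramified.IH and c = unramified_elementD(2)[OF tower_unramified.hyps(2)]
  have iE: "intermediate E" using E by simp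
  show ?case
    using E finite_ext_simple_extension[OF iE c] unramified_element_extension[OF iE tower_unramified.hyps(2)]
      tamely_defectless_trans[of F E "simple_extension E c"] by auto
next
  case (tower_radical E c n)
  note E = tower_radical.IH
  have iE: "intermediate E" using E by simp
  have "n \<in> tame_exponents" "N \<noteq> {}" using tower_radical.hyps assms(3) by auto
  then show ?case
    using E finite_ext_simple_extension[OF iE tower_radical.hyps(2)]
      tame_radical_extension[OF iE tower_radical.hyps(2,3,5)]
      tamely_defectless_trans[of F E "simple_extension E c"] by auto
qed

lemma tower_base_change:
  assumes "tower N F E" "intermediate F" "intermediate F'" "F \<subseteq> F'" "N \<subseteq> tame_exponents"
  shows "\<exists>E'. tower N F' E' \<and> E \<subseteq> E' \<and> (\<forall>A. subfield A R \<and> E \<subseteq> A \<and> F' \<subseteq> A \<longrightarrow> E' \<subseteq> A)"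
  using assms(1)
proof induction
  case tower_base
  then show ?case using assms(4) tower.tower_base[of N F'] by (intro exI[of _ F']) simp
next
  case (tower_unramified E c)
  note c = unramified_elementD(2)[OF tower_unramified.hyps(2)]
  from tower_unramified.IH obtain E' where E': "tower N F' E'" "E \<subseteq> E'"
    "\<forall>A. subfield A R \<and> E \<subseteq> A \<and> F' \<subseteq> A \<longrightarrow> E' \<subseteq> A" by (elim exE conjE)
  have iE: "intermediate E" using tower_tamely_defectless[OF tower_unramified.hyps(1) assms(2,5)] by simp
  have iE': "intermediate E'" using tower_tamely_defectless[OF E'(1) assms(3,5)] by simp
  have "tower N F' (simple_extension E' c)"
    using tower.tower_unramified[OF E'(1) unramified_element_mono[OF iE iE' E'(2) tower_unramified.hyps(2)]] .
  moreover have "simple_extension E' c \<subseteq> A" if A: "subfield A R \<and> simple_extension E c \<subseteq> A \<and> F' \<subseteq> A" for A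
  proof -
    have "E \<subseteq> A" "c \<in> A" using finite_ext_simple_extension(4,5)[OF iE c] A by auto
    then have "E' \<subseteq> A" using E'(3) A by simp
    then show ?thesis using simple_extension_subring_incl[OF subfieldE(1) _ \<open>c \<in> A\<close>] A by simp
  qed
  ultimately show ?case
    using mono_simple_extension[OF E'(2)] by (intro exI[of _ "simple_extension E' c"]) simp
next
  case (tower_radical E c n)
  note c = tower_radical.hyps(2)
  from tower_radical.IH obtain E' where E': "tower N F' E'" "E \<subseteq> E'"
    "\<forall>A. subfield A R \<and> E \<subseteq> A \<and> F' \<subseteq> A \<longrightarrow> E' \<subseteq> A" by (elim exE conjE)
  have iE: "intermediate E" using tower_tamely_defectless[OF tower_radical.hyps(1) assms(2,5)] by simp
  have "c [^] n \<in> E'" using tower_radical.hyps(5) E'(2) by blast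
  then have "tower N F' (simple_extension E' c)"
    using tower.tower_radical[OF E'(1) tower_radical.hyps(2-4)] by simp
  moreover have "simple_extension E' c \<subseteq> A" if A: "subfield A R \<and> simple_extension E c \<subseteq> A \<and> F' \<subseteq> A" for A
  proof -
    have "E \<subseteq> A" "c \<in> A" using finite_ext_simple_extension(4,5)[OF iE c] A by auto
    then have "E' \<subseteq> A" using E'(3) A by simp
    then show ?thesis using simple_extension_subring_incl[OF subfieldE(1) _ \<open>c \<in> A\<close>] A by simp
  qed
  ultimately show ?case
    using mono_simple_extension[OF E'(2)] by (intro exI[of _ "simple_extension E' c"]) simp
qed

lemma dim_pos: "finite_ext F E \<Longrightarrow> 0 < dim F E"
  using fundamental_inequality(3-5)[of F E] by (metis le_zero_eq mult_eq_0_iff neq0_conv)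

text \<open>The degrees of the towers inside \<open>E\<close> are bounded by that of \<open>E\<close>.\<close>

lemma maximal_tower:
  assumes F: "intermediate F" and FE: "finite_ext F E" and N: "N \<subseteq> tame_exponents"
  obtains T where "tower N F T" "T \<subseteq> E" "\<And>T'. \<lbrakk> tower N F T'; T' \<subseteq> E; T \<subseteq> T' \<rbrakk> \<Longrightarrow> T' = T"
proof -
  let ?P = "\<lambda>d. \<exists>T. tower N F T \<and> T \<subseteq> E \<and> dim F T = d"
  have fe: "finite_ext F T" "finite_ext T E" if "tower N F T" "T \<subseteq> E" for T
    using finite_ext_intermediate[OF FE] tower_tamely_defectless[OF that(1) F N] that(2) by auto
  have b: "d < Suc (dim F E)" if d: "?P d" for d
  proof -
    obtain T where T: "tower N F T" "T \<subseteq> E" "dim F T = d" using d by blast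
    have "dim F T * 1 \<le> dim F T * dim T E" using dim_pos[OF fe(2)[OF T(1,2)]] by (intro mult_le_mono2) simp
    then show ?thesis using finite_ext_trans(2)[OF fe[OF T(1,2)]] T(3) by linarith
  qed
  have P1: "?P (dim F F)" using tower_base[of N F] finite_extD(3)[OF FE] by blast
  have "\<exists>d. ?P d \<and> (\<forall>d'. ?P d' \<longrightarrow> d' \<le> d)"
    using ex_has_greatest_nat[of ?P "dim F F" "\<lambda>d. d" "Suc (dim F E)", OF P1] b by blast
  then obtain d where dd: "?P d \<and> (\<forall>d'. ?P d' \<longrightarrow> d' \<le> d)" by (rule exE)
  note d = conjunct1[OF dd] and dm = conjunct2[OF dd]
  from d obtain T where T: "tower N F T" "T \<subseteq> E" "dim F T = d" by (elim exE conjE)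
  have mx: "d' \<le> dim F T" if "?P d'" for d' using dm that T(3) by simp
  have "T' = T" if T': "tower N F T'" "T' \<subseteq> E" "T \<subseteq> T'" for T'
  proof -
    have iT': "subfield T' R" using tower_tamely_defectless[OF T'(1) F N] by simp
    have g: "finite_ext T T'" using finite_ext_intermediate(1)[OF fe(2)[OF T(1,2)] iT' T'(3,2)] .
    have "dim F T * dim T T' \<le> dim F T * 1"
      using finite_ext_trans(2)[OF fe(1)[OF T(1,2)] g] mx[of "dim F T'"] T' by auto
    then have "dim T T' \<le> 1" using dim_pos[OF fe(1)[OF T(1,2)]] by simp
    then have "dim T T' = 1" using dim_pos[OF g] by simp
    then show ?thesis using dim_1_imp_eq[OF g] by simp
  qed
  then show thesis using that T(1,2) by blast
qed

end

section \<open>Perfect residue fields\<close>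

lemma size_eq_card_imp_count_le_1:
  assumes "size A = card (set_mset A)" shows "count A x \<le> 1"
proof (cases "x \<in># A")
  case True
  then have "A = add_mset x (A - {#x#})" by simp
  then have s: "size A = Suc (size (A - {#x#}))" by (metis size_add_mset)
  have "card (set_mset (A - {#x#})) \<le> size (A - {#x#})" by (rule card_set_mset_le_size)
  moreover have "set_mset (A - {#x#}) = set_mset A" if "1 < count A x"
    using that True by (auto simp: set_eq_iff in_diff_count)
  ultimately show ?thesis using s assms by (metis Suc_n_not_le_n not_le_imp_less)
qed (simp add: not_in_iff)

lemma (in domain) separable_over_base:
  assumes "subfield K R" "x \<in> K" shows "separable_over K x"
proof -
  have x: "x \<in> carrier R" using assms subfieldE(3) by blast
  note P = pure_poly[OF subfieldE(1)[OF assms(1)] assms(2), of 1]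
  show ?thesis
  proof (rule separable_overI_poly[OF assms(1) x, of "pure_poly 1 x"])
    show "pure_poly 1 x \<in> carrier (K[X])" using P(1) by simp
    show "pure_poly 1 x \<noteq> []" using P(2) by auto
    show "eval (pure_poly 1 x) x = \<zero>" using P(4)[OF _ x] x by simp
    show "False" if "y \<in> carrier R" "eval_der (pure_poly 1 x) y = \<zero>" for y
      using that P(5)[of y] by simp
  qed
qed

lemma (in field) subfield_Int:
  assumes "subfield E R" "subfield F R" shows "subfield (E \<inter> F) R"
proof (rule subfieldI'[OF subringI])
  note S = subringE[OF subfieldE(1)[OF assms(1)]] and S' = subringE[OF subfieldE(1)[OF assms(2)]]
  show "E \<inter> F \<subseteq> carrier R" "\<one> \<in> E \<inter> F" using S(1,3) S'(3) by auto
  show "\<ominus> x \<in> E \<inter> F" if "x \<in> E \<inter> F" for x using S(5) S'(5) that by simp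
  show "x \<otimes> y \<in> E \<inter> F" if "x \<in> E \<inter> F" "y \<in> E \<inter> F" for x y using S(6) S'(6) that by simp
  show "x \<oplus> y \<in> E \<inter> F" if "x \<in> E \<inter> F" "y \<in> E \<inter> F" for x y using S(7) S'(7) that by simp
  show "inv x \<in> E \<inter> F" if "x \<in> E \<inter> F - {\<zero>}" for x
    using subfield_m_inv(1)[OF assms(1), of x] subfield_m_inv(1)[OF assms(2), of x] that by simp
qed

locale perfect_henselian = henselian R K \<nu>
  for R :: "('a, 'b) ring_scheme" (structure) and K and \<nu> :: "'a \<Rightarrow> 'g::linordered_ab_group_add" +
  assumes perfect_residue_field: "field_char residue_ring = 0 \<or>
    (\<forall>a\<in>residue_field K. \<exists>b\<in>residue_field K. b [^]\<^bsub>residue_ring\<^esub> field_char residue_ring = a)"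
begin

lemma residue_algebraic:
  assumes F: "intermediate F" and x: "x \<in> carrier residue_ring"
  shows "k.algebraic (residue_field F) x"
proof -
  obtain u where u: "u \<in> val_ring" "x = residue u" using x by (auto simp: residue_ring_carrier)
  note S = finite_ext_simple_extension[OF F val_ring_carrier[OF u(1)]]
  have sE: "subfield (simple_extension F u) R" and sF: "subfield F R" using S(3) F by auto
  have "x \<in> residue_field (simple_extension F u)"
    using S(5) u mem_valuation_ring[OF sE] by (auto simp: residue_field_alt)
  then show ?thesis
    using k.finite_dimension_imp_algebraic[OF residue_field_subfield[OF sF] subfieldE(1)[OF residue_field_subfield[OF sE]]
        k.finite_extD(4)[OF fundamental_inequality(2)[OF S(1)]]] by (simp add: over_def)
qed

lemma residue_separable:
  assumes F: "intermediate F" and x: "x \<in> carrier residue_ring"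
  shows "k.separable_over (residue_field F) x"
proof -
  have sF: "subfield F R" using F by simp
  have sK: "subfield K R" using intermediate_base by simp
  have "k.separable_over (residue_field K) x"
    by (rule k.perfect_imp_separable[OF residue_field_subfield[OF sK] x
        residue_algebraic[OF intermediate_base x] perfect_residue_field])
  then show ?thesis
    using k.separable_over_mono[OF residue_field_subfield[OF sK] residue_field_subfield[OF sF] residue_field_mono x] F
    by blast
qed

text \<open>A monic lift of the minimal polynomial of the residue has as many roots as that polynomial, and
  every residue root comes from one of them, so distinct roots have distinct residues.\<close>

lemma lift_unramified_element:
  assumes F: "intermediate F" and x: "x \<in> carrier residue_ring"
  obtains c where "unramified_element F c" "residue c = x"
proof -
  have sF: "subfield F R" using F by simp
  note kF = residue_field_subfield[OF sF]
  let ?m = "k.Irr (residue_field F) x"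
  note I = k.IrrE'[OF kF x residue_algebraic[OF F x]]
  obtain q where q: "set q \<subseteq> F" "set q \<subseteq> val_ring" "map residue q = ?m" "q \<noteq> []"
    "hd q \<in> val_ring - val_ideal" "q \<in> carrier (F[X])" "q \<in> carrier (poly_ring R)"
    "\<And>c. \<lbrakk> c \<in> carrier R; eval q c = \<zero> \<rbrakk> \<Longrightarrow> c \<in> val_ring"
    using lift_polynomial[OF sF I(1,7)] by metis
  have dq: "degree q = degree ?m" using q(3) by (metis length_map)
  let ?S = "{c \<in> carrier R. eval q c = \<zero>}" and ?Z = "{z \<in> carrier residue_ring. k.eval ?m z = \<zero>\<^bsub>residue_ring\<^esub>}"
  have Z: "card ?Z = degree ?m" using k.card_roots_separable[OF kF x residue_separable[OF F x]] .
  have near: "\<exists>c\<in>?S. residue c = z" if z: "z \<in> ?Z" for z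
  proof -
    have "z \<in> carrier residue_ring" using z by simp
    then obtain u where u: "u \<in> val_ring" "z = residue u" by (auto simp: residue_ring_carrier)
    have "residue (eval q u) = \<zero>\<^bsub>residue_ring\<^esub>" using residue_eval[OF q(2) u(1)] q(3) u(2) z by simp
    then have near: "eval q u \<in> val_ideal" using residue_zero_iff[OF eval_val_ring[OF q(2) u(1)]] by simp
    have "\<exists>c\<in>val_ring. eval q c = \<zero> \<and> u \<ominus> c \<in> val_ideal"
      by (rule root_near_approximate_root[OF q(7,4,5,8) u(1) near])
    then obtain c where c: "c \<in> val_ring" "eval q c = \<zero>" "u \<ominus> c \<in> val_ideal" by blast
    then have "residue c = z" using residue_eq_iff[OF u(1) c(1)] u(2) by simp
    then show ?thesis using c val_ring_carrier by blast
  qed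
  (* The residues of the roots of \<open>q\<close> include the roots of \<open>?m\<close>, and there are at least as many of the
     latter, so the roots of \<open>q\<close> are simple and have distinct residues. *)
  have fS: "finite ?S" and Sr: "?S = set_mset (roots q)" using finite_roots[OF q(7,4)] by auto
  have "card ?S \<le> size (roots q)" unfolding Sr by (rule card_set_mset_le_size)
  then have c1: "card ?S \<le> degree ?m" using size_roots_eq_degree[OF q(7)] dq by simp
  have "?Z \<subseteq> residue ` ?S" using near by blast
  then have c2: "degree ?m \<le> card (residue ` ?S)" using card_mono[of "residue ` ?S" ?Z] fS Z by simp
  have c3: "card (residue ` ?S) \<le> card ?S" using card_image_le[OF fS] .
  then have "card (residue ` ?S) = card ?S" using c1 c2 by linarith
  then have inj: "inj_on residue ?S" using eq_card_imp_inj_on[OF fS] by blast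
  have cS: "degree ?m = card ?S" using c1 c2 c3 by linarith
  have "size (roots q) = degree ?m" using size_roots_eq_degree[OF q(7)] dq by (simp only:)
  also have "\<dots> = card (set_mset (roots q))" using cS unfolding Sr .
  finally have sz: "size (roots q) = card (set_mset (roots q))" .
  have simple: "alg_mult q y \<le> 1" for y
    using size_eq_card_imp_count_le_1[OF sz, of y] alg_mult_eq_count_roots[OF q(7)] by simp
  have "x \<in> ?Z" using x I(4) by simp
  then obtain c where c: "c \<in> ?S" "residue c = x" using near by blast
  have cc: "c \<in> carrier R" "eval q c = \<zero>" "c \<in> val_ring" using c q(8) by auto
  note D = Irr_pdivides[OF sF cc(1) q(6,4) cc(2)]
  have "unramified_element F c"
    unfolding unramified_element_def
  proof (intro conjI ballI impI)
    show "c \<in> val_ring" using cc by simp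
    show "separable_over F c"
      unfolding separable_over_def over_def using D(1,4) simple order_trans by blast
    fix y assume y: "y \<in> carrier R" and yy: "eval (Irr F c) y = \<zero> \<and> y \<ominus> c \<in> val_ideal"
    have yS: "y \<in> ?S" using D(5)[OF y] yy y by simp
    then have "y \<in> val_ring" using q(8) by blast
    then have "residue y = residue c" using residue_eq_iff[OF _ cc(3)] yy by simp
    then show "y = c" using inj yS c(1) by (simp add: inj_on_def)
  qed
  then show thesis using that c(2) by blast
qed

text \<open>Here \<open>c\<close> is close to the element of \<open>E\<close> whose residue it lifts.\<close>

lemma lift_unramified_element_mem:
  assumes F: "intermediate F" and E: "intermediate E" "F \<subseteq> E" and x: "x \<in> residue_field E"
  obtains c where "unramified_element F c" "residue c = x" "c \<in> E"
proof -
  have sE: "subfield E R" using E by simp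
  obtain u where u: "u \<in> E" "u \<in> val_ring" "x = residue u"
    using x mem_valuation_ring[OF sE] by (auto simp: residue_field_alt)
  obtain c where c: "unramified_element F c" "residue c = x"
    by (rule lift_unramified_element[OF F residue_closed[OF u(2)]]) (use u(3) that in auto)
  have "c \<ominus> u \<in> val_ideal" using residue_eq_iff[OF unramified_elementD(1)[OF c(1)] u(2)] c(2) u(3) by simp
  then have "c \<in> E" using unramified_element_mem[OF E(1) unramified_element_mono[OF F E c(1)] u(1)] by blast
  then show thesis using that c by blast
qed

text \<open>Adjoining a lift of a missing residue would be one more step of the tower.\<close>

lemma maximal_tower_residue_field:
  assumes F: "intermediate F" and E: "intermediate E" and N: "N \<subseteq> tame_exponents"
    and T: "tower N F T" "T \<subseteq> E" and mx: "\<And>T'. \<lbrakk> tower N F T'; T' \<subseteq> E; T \<subseteq> T' \<rbrakk> \<Longrightarrow> T' = T"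
  shows "residue_field E = residue_field T"
proof
  have iT: "intermediate T" using tower_tamely_defectless[OF T(1) F N] by simp
  have sT: "subfield T R" and sE: "subfield E R" using iT E by auto
  show "residue_field T \<subseteq> residue_field E" using residue_field_mono[OF T(2)] .
  show "residue_field E \<subseteq> residue_field T"
  proof
    fix x assume x: "x \<in> residue_field E"
    obtain c where c: "unramified_element T c" "residue c = x" "c \<in> E"
      by (rule lift_unramified_element_mem[OF iT E T(2) x])
    note S = finite_ext_simple_extension[OF iT unramified_elementD(2)[OF c(1)]]
    have "simple_extension T c = T"
      using mx[OF tower_unramified[OF T(1) c(1)] simple_extension_subring_incl[OF subfieldE(1)[OF sE] T(2) c(3)] S(4)] .
    then have "c \<in> T" using S(5) by simp
    then show "x \<in> residue_field T"
      using mem_valuation_ring[OF sT] unramified_elementD(1)[OF c(1)] c(2) by (auto simp: residue_field_alt)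
  qed
qed

text \<open>A maximal tower \<open>T\<close> in \<open>E\<close> has the residue field of \<open>E\<close>. It has the value group as well: by
  \<open>radical_with_value\<close>, every value of \<open>E\<close> is the value of a radical over \<open>T\<close> whose exponent is
  the ramification index, and this radical is in \<open>T\<close> by maximality. As \<open>E\<close> is defectless over \<open>T\<close>,
  they are equal.\<close>

lemma tamely_defectless_tower:
  assumes F: "intermediate F" and FE: "tamely_defectless F E"
  shows "tower tame_exponents F E"
proof -
  have fe: "finite_ext F E" using FE by (simp add: tamely_defectless_def)
  note D = finite_extD[OF fe]
  have E: "intermediate E" using F D by auto
  obtain T where T: "tower tame_exponents F T" "T \<subseteq> E"
    and mx: "\<And>T'. \<lbrakk> tower tame_exponents F T'; T' \<subseteq> E; T \<subseteq> T' \<rbrakk> \<Longrightarrow> T' = T"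
    using maximal_tower[OF F fe subset_refl] by metis
  note tT = tower_tamely_defectless[OF T(1) F subset_refl]
  have iT: "intermediate T" and FT: "F \<subseteq> T" using tT by auto
  have res: "residue_field E = residue_field T"
    by (rule maximal_tower_residue_field[OF F E subset_refl T mx])
  have tn: "ramification_index F E \<in> tame_exponents" using FE by (simp add: tamely_defectless_def)
  have "g \<in> value_group T" if g: "g \<in> value_group E" for g
  proof -
    obtain a where a: "a \<in> E" "a \<noteq> \<zero>" "\<nu> a = g" using value_group_mem[OF g] by metis
    have "\<nu> (a [^] ramification_index F E) \<in> value_group F"
      using ramification_index_torsion[OF D(1-3) fundamental_inequality(1)[OF fe]] a by simp
    then have "\<nu> (a [^] ramification_index F E) \<in> value_group T" using value_group_mono[OF FT] by blast
    then obtain w where w: "w \<in> E" "w \<noteq> \<zero>" "w [^] ramification_index F E \<in> T" "\<nu> w = \<nu> a"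
      by (rule radical_with_value[OF iT E T(2) res a(1,2) tn])
    have wc: "w \<in> carrier R" using w(1) D(6) by blast
    note S = finite_ext_simple_extension[OF iT wc]
    have "simple_extension T w = T"
      using mx[OF tower_radical[OF T(1) wc w(2) tn w(3)] simple_extension_subring_incl[OF subfieldE(1)[OF D(2)] T(2) w(1)] S(4)] .
    then have "w \<in> T" using S(5) by simp
    then show ?thesis using w(2,4) a(3) by (auto simp: value_group_def)
  qed
  then have "value_group E = value_group T" using value_group_mono[OF T(2)] by blast
  moreover have "tamely_defectless T E" using tamely_defectless_intermediate(2)[OF FE _ FT T(2)] iT by simp
  ultimately have "E = T" using tamely_defectless_trivial res by blast
  then show ?thesis using T(1) by simp
qed

text \<open>Since the value group does not grow, a maximal tower of unramified steps alone already has the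
  value group and the residue field of \<open>E\<close>, hence the same degree.\<close>

lemma unramified_defectless_tower:
  assumes F: "intermediate F" and FE: "tamely_defectless F E" and v: "value_group E = value_group F"
  shows "tower {} F E"
proof -
  have fe: "finite_ext F E" using FE by (simp add: tamely_defectless_def)
  note D = finite_extD[OF fe]
  have E: "intermediate E" using F D by auto
  obtain T where T: "tower {} F T" "T \<subseteq> E"
    and mx: "\<And>T'. \<lbrakk> tower {} F T'; T' \<subseteq> E; T \<subseteq> T' \<rbrakk> \<Longrightarrow> T' = T"
    using maximal_tower[OF F fe empty_subsetI] by metis
  note tT = tower_tamely_defectless[OF T(1) F empty_subsetI]
  have iT: "intermediate T" and FT: "F \<subseteq> T" using tT by auto
  have res: "residue_field E = residue_field T"
    by (rule maximal_tower_residue_field[OF F E empty_subsetI T mx])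
  have "value_group E = value_group T" using tT v by simp
  moreover have "tamely_defectless T E" using tamely_defectless_intermediate(2)[OF FE _ FT T(2)] iT by simp
  ultimately have "E = T" using tamely_defectless_trivial res by blast
  then show ?thesis using T(1) by simp
qed

lemma tame_iff_tamely_defectless:
  assumes F: "intermediate F" and fe: "finite_ext F E"
  shows "tame F E \<longleftrightarrow> tamely_defectless F E"
proof
  note D = finite_extD[OF fe]
  have rc: "residue_char F = field_char residue_ring"
    unfolding residue_char_def
    by (rule k.field_char_subring[OF subfieldE(1)[OF residue_field_subfield[OF D(1)]]])
  { assume "tame F E"
    then have "(residue_char F \<noteq> 0 \<longrightarrow> \<not> residue_char F dvd ramification_index F E) \<and> defectless F E"
      using fe unfolding tame_def by blast
    then show "tamely_defectless F E"
      using fe rc fundamental_inequality(4)[OF fe]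
      by (auto simp: tamely_defectless_def defectless_def residue_degree_def) }
  { assume t: "tamely_defectless F E"
    show "tame F E"
      unfolding tame_def
    proof (intro conjI allI impI)
      show "algebraic_ext F E"
        unfolding algebraic_ext_def over_def using D intermediate_algebraic[OF F] by blast
      fix E' assume E': "finite_ext F E' \<and> E' \<subseteq> E"
      note D' = finite_extD[OF conjunct1[OF E']]
      have t': "tamely_defectless F E'" using tamely_defectless_intermediate(1)[OF t D'(2,3)] E' by simp
      show "\<not> residue_char F dvd ramification_index F E'"
        using t' rc by (simp add: tamely_defectless_def)
      show "defectless F E'"
        using t' k.finite_extD(4)[OF fundamental_inequality(2)[OF conjunct1[OF E']]]
        by (simp add: tamely_defectless_def defectless_def residue_degree_def)
      show "k.separable_ext (residue_field F) (residue_field E')"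
        unfolding k.separable_ext_def
        using residue_field_subfield[OF D'(1)] residue_field_subfield[OF D'(2)] residue_field_mono[OF D'(3)]
          residue_separable[OF F] subfieldE(3)[OF residue_field_subfield[OF D'(2)]] by blast
    qed }
qed

end

section \<open>The ramification field\<close>

context henselian
begin

lemma ramification_group_automorphism:
  assumes "\<phi> \<in> ramification_group" shows "\<phi> \<in> automorphisms_over K"
  using assms by (simp add: ramification_group_def automorphisms_over_def)

text \<open>The defining inequality in terms of the relative difference, including the case that the
  difference vanishes.\<close>

lemma ramification_groupD:
  assumes p: "\<phi> \<in> ramification_group" and x: "x \<in> val_ring" "x \<noteq> \<zero>"
  shows "(\<phi> x \<ominus> x) \<otimes> inv x \<in> val_ideal"
proof -
  have xc: "x \<in> carrier R" using val_ring_carrier[OF x(1)] .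
  have d: "\<phi> x \<ominus> x = \<zero> \<or> \<nu> x < \<nu> (\<phi> x \<ominus> x)" using p x by (auto simp: ramification_group_def)
  have dc: "\<phi> x \<ominus> x \<in> carrier R" using automorphism_props(1)[OF ramification_group_automorphism[OF p] xc] xc by simp
  note i = inv_props[OF xc x(2)]
  show ?thesis
  proof (cases "\<phi> x \<ominus> x = \<zero>")
    case True
    then show ?thesis using i val_ideal_closed(1) by simp
  next
    case False
    then show ?thesis using d value_quotient[OF dc False xc x(2)] dc i by (simp add: mem_val_ideal)
  qed
qed

lemma ramification_field_subfield: "subfield ramification_field R" "K \<subseteq> ramification_field"
proof -
  have sK: "subfield K R" using intermediate_base by simp
  have S: "subfield separable_closure R"
    unfolding separable_closure_def by (rule separable_closure_subfield[OF sK])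
  note s = subringE[OF subfieldE(1)[OF S]]
  have A: "\<phi> \<in> automorphisms_over K" if "\<phi> \<in> ramification_group" for \<phi>
    using ramification_group_automorphism[OF that] .
  have mem: "x \<in> ramification_field \<longleftrightarrow> x \<in> separable_closure \<and> (\<forall>\<phi>\<in>ramification_group. \<phi> x = x)" for x
    by (simp add: ramification_field_def)
  have car: "x \<in> carrier R" if "x \<in> separable_closure" for x using that s(1) by blast
  show "K \<subseteq> ramification_field"
  proof
    fix x assume x: "x \<in> K"
    have "x \<in> separable_closure"
      using separable_over_base[OF sK x] x subfieldE(3)[OF sK] by (auto simp: separable_closure_def)
    moreover have "\<phi> x = x" if "\<phi> \<in> ramification_group" for \<phi> using automorphism_props(7)[OF A[OF that] x] .
    ultimately show "x \<in> ramification_field" using mem by blast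
  qed
  then have one: "\<one> \<in> ramification_field" using subringE(3)[OF subfieldE(1)[OF sK]] by blast
  show "subfield ramification_field R"
  proof (rule subfieldI'[OF subringI])
    show "ramification_field \<subseteq> carrier R" using mem car by blast
    show "\<one> \<in> ramification_field" by (rule one)
    fix x y assume "x \<in> ramification_field" "y \<in> ramification_field"
    then have x: "x \<in> separable_closure" "\<And>\<phi>. \<phi> \<in> ramification_group \<Longrightarrow> \<phi> x = x"
      and y: "y \<in> separable_closure" "\<And>\<phi>. \<phi> \<in> ramification_group \<Longrightarrow> \<phi> y = y"
      using mem by blast+
    note xc = car[OF x(1)] and yc = car[OF y(1)]
    have "\<phi> (\<ominus> x) = \<ominus> x" if p: "\<phi> \<in> ramification_group" for \<phi>
      using automorphism_props(4)[OF A[OF p] zero_closed xc] automorphism_props(5)[OF A[OF p]] x(2)[OF p] xc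
      by (simp add: a_minus_def)
    then show "\<ominus> x \<in> ramification_field" using mem s(5)[OF x(1)] by blast
    have "\<phi> (x \<otimes> y) = x \<otimes> y" if p: "\<phi> \<in> ramification_group" for \<phi>
      using automorphism_props(3)[OF A[OF p] xc yc] x(2)[OF p] y(2)[OF p] by simp
    then show "x \<otimes> y \<in> ramification_field" using mem s(6)[OF x(1) y(1)] by blast
    have "\<phi> (x \<oplus> y) = x \<oplus> y" if p: "\<phi> \<in> ramification_group" for \<phi>
      using automorphism_props(2)[OF A[OF p] xc yc] x(2)[OF p] y(2)[OF p] by simp
    then show "x \<oplus> y \<in> ramification_field" using mem s(7)[OF x(1) y(1)] by blast
  next
    fix x assume "x \<in> ramification_field - {\<zero>}"
    then have x: "x \<in> separable_closure" "x \<noteq> \<zero>" "\<And>\<phi>. \<phi> \<in> ramification_group \<Longrightarrow> \<phi> x = x"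
      using mem by blast+
    have "\<phi> (inv x) = inv x" if p: "\<phi> \<in> ramification_group" for \<phi>
      using automorphism_props(11)[OF A[OF p] car[OF x(1)] x(2)] x(3)[OF p] by simp
    moreover have "inv x \<in> separable_closure" using subfield_m_inv(1)[OF S] x by simp
    ultimately show "inv x \<in> ramification_field" using mem by blast
  qed
qed

lemma unramified_element_ramification_field:
  assumes c: "unramified_element K c" shows "c \<in> ramification_field"
proof -
  note D = unramified_elementD[OF c]
  have sK: "subfield K R" using intermediate_base by simp
  note I = IrrE'[OF sK D(2) intermediate_algebraic[OF intermediate_base D(2)]]
  have "\<phi> c = c" if p: "\<phi> \<in> ramification_group" for \<phi>
  proof (cases "c = \<zero>")
    case True
    then show ?thesis using automorphism_props(5)[OF ramification_group_automorphism[OF p]] by simp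
  next
    case False
    note A = automorphism_props[OF ramification_group_automorphism[OF p]]
    have pc: "\<phi> c \<in> carrier R" using A(1)[OF D(2)] .
    note i = inv_props[OF D(2) False]
    have "((\<phi> c \<ominus> c) \<otimes> inv c) \<otimes> c \<in> val_ideal"
      using val_ideal_closed(4)[OF ramification_groupD[OF p D(1) False] D(1)] .
    then have d: "\<phi> c \<ominus> c \<in> val_ideal" using pc D(2) i by (simp add: m_assoc)
    have "eval (Irr K c) (\<phi> c) = \<zero>" using A(10)[OF D(2) I(5) subfieldE(3)[OF sK]] I(4) A(5) by simp
    then show ?thesis using D(4)[OF pc _ d] by blast
  qed
  then show ?thesis using D(2,3) by (simp add: ramification_field_def separable_closure_def)
qed

text \<open>The quotient \<open>\<phi> w / w\<close> is an \<open>n\<close>-th root of unity close to \<open>1\<close>. Since the ramification group is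
  defined by a condition on integral elements, \<open>w\<close> or its inverse has to be considered.\<close>

lemma ramification_group_fixes_radical:
  assumes p: "\<phi> \<in> ramification_group" and w: "w \<in> carrier R" "w \<noteq> \<zero>"
    and n: "n \<in> tame_exponents" and wn: "\<phi> (w [^] n) = w [^] n"
  shows "\<phi> w = w"
proof -
  note A = automorphism_props[OF ramification_group_automorphism[OF p]]
  have *: "\<phi> x = x" if x: "x \<in> val_ring" "x \<noteq> \<zero>" "\<phi> (x [^] n) = x [^] n" for x
  proof -
    have xc: "x \<in> carrier R" using val_ring_carrier[OF x(1)] .
    have px: "\<phi> x \<in> carrier R" using A(1)[OF xc] .
    note i = inv_props[OF xc x(2)]
    let ?z = "\<phi> x \<otimes> inv x"
    have "?z [^] n = x [^] n \<otimes> inv x [^] n" using px i A(8)[OF xc, of n] x(3) by (simp add: nat_pow_distrib)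
    also have "\<dots> = (x \<otimes> inv x) [^] n" by (rule nat_pow_distrib[OF xc i(1), symmetric])
    finally have z1: "?z [^] n = \<one>" using i by (simp add: nat_pow_one)
    have "(\<phi> x \<ominus> x) \<otimes> inv x = ?z \<ominus> x \<otimes> inv x" using px xc i(1) by algebra
    then have "?z \<ominus> \<one> \<in> val_ideal" using ramification_groupD[OF p x(1,2)] i by simp
    then have "?z = \<one>" using root_of_unity_near_one[OF _ z1 _ n] px i by simp
    then have "(\<phi> x \<otimes> inv x) \<otimes> x = x" using xc by simp
    then show ?thesis using px xc i by (simp add: m_assoc)
  qed
  show ?thesis
  proof (cases "w \<in> val_ring")
    case True
    then show ?thesis using *[OF True w(2) wn] by simp
  next
    case False
    note i = inv_props[OF w]
    have iO: "inv w \<in> val_ring" using inv_mem_val_ideal[OF w(1) False] val_ideal_closed(7) by blast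
    have "inv w [^] n \<otimes> w [^] n = (inv w \<otimes> w) [^] n" by (rule nat_pow_distrib[OF i(1) w(1), symmetric])
    then have e: "inv w [^] n \<otimes> w [^] n = \<one>" using i by (simp add: nat_pow_one)
    have wnc: "w [^] n \<in> carrier R" "w [^] n \<noteq> \<zero>" using w pow_nonzero by auto
    have "inv w [^] n = inv (w [^] n)"
      using e wnc i by (intro comm_inv_char[symmetric]) (auto simp: m_comm)
    then have "\<phi> (inv w [^] n) = inv w [^] n" using A(11)[OF wnc] wn by simp
    then have "\<phi> (inv w) = inv w" using *[OF iO i(4)] by simp
    then have "inv (\<phi> w) = inv w" using A(11)[OF w] by simp
    moreover have "\<phi> w \<in> carrier R" "\<phi> w \<noteq> \<zero>" using A(1)[OF w(1)] A(9)[OF w(1) zero_closed] A(5) w(2) by auto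
    ultimately show ?thesis using inv_eq_imp_eq[of "\<phi> w" w] w field_Units by simp
  qed
qed

end

context perfect_henselian
begin

text \<open>Modulo the value group of \<open>E \<inter> K\<^sup>r\<close>, the value group of \<open>E\<close> has no torsion prime to \<open>p\<close>. Indeed
  both fields have the same residue field, because unramified elements are in \<open>K\<^sup>r\<close>. So a value
  whose \<open>n\<close>-th multiple comes from \<open>E \<inter> K\<^sup>r\<close> is the value of an \<open>n\<close>-th root in \<open>E\<close> of an element of
  \<open>E \<inter> K\<^sup>r\<close>, and such a root is separable over \<open>K\<close> and fixed by the ramification group.\<close>

lemma value_group_ramification_field:
  assumes E: "finite_ext K E" and a: "a \<in> E" "a \<noteq> \<zero>" and n: "n \<in> tame_exponents"
    and v: "\<nu> (a [^] n) \<in> value_group (E \<inter> ramification_field)"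
  shows "\<nu> a \<in> value_group (E \<inter> ramification_field)"
proof -
  let ?T = "E \<inter> ramification_field"
  note D = finite_extD[OF E]
  have iE: "intermediate E" using D by simp
  have sT: "subfield ?T R" using subfield_Int[OF D(2) ramification_field_subfield(1)] .
  have iT: "intermediate ?T" using sT D(3) ramification_field_subfield(2) by blast
  have fT: "finite_ext K ?T" using finite_ext_intermediate(1)[OF E sT] iT by blast
  have "residue_field E \<subseteq> residue_field ?T"
  proof
    fix x assume x: "x \<in> residue_field E"
    obtain c where c: "unramified_element K c" "residue c = x" "c \<in> E"
      by (rule lift_unramified_element_mem[OF intermediate_base iE D(3) x])
    then have "c \<in> ?T" using unramified_element_ramification_field by blast
    then show "x \<in> residue_field ?T"
      using mem_valuation_ring[OF sT] unramified_elementD(1)[OF c(1)] c(2) by (auto simp: residue_field_alt)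
  qed
  then have res: "residue_field E = residue_field ?T" using residue_field_mono[of ?T E] by blast
  obtain w where w: "w \<in> E" "w \<noteq> \<zero>" "w [^] n \<in> ?T" "\<nu> w = \<nu> a"
    by (rule radical_with_value[OF iT iE Int_lower1 res a n v])
  have wc: "w \<in> carrier R" using w(1) D(6) by blast
  have Ts: "separable_over K x" if "x \<in> ?T" for x
    using that by (simp add: ramification_field_def separable_closure_def)
  have "separable_over K w"
    using radical_separable_trans[OF D(1) sT _ _ Ts _ w(3) tame_exponent_nonzero[OF n]] iT fT wc w(2)
    by (simp add: finite_ext_def)
  moreover have "\<phi> w = w" if p: "\<phi> \<in> ramification_group" for \<phi>
    using ramification_group_fixes_radical[OF p wc w(2) n] w(3) p by (simp add: ramification_field_def)
  ultimately have "w \<in> ?T" using w(1) wc by (simp add: ramification_field_def separable_closure_def)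
  then have "\<nu> w \<in> value_group ?T" using w(2) unfolding value_group_def by blast
  then show ?thesis using w(4) by simp
qed

section \<open>Base change\<close>

lemma tower_compositum:
  assumes "tower N F E" "intermediate F" "intermediate F'" "F \<subseteq> F'" "N \<subseteq> tame_exponents"
  shows "tower N F' (generate_field R (E \<union> F'))"
proof -
  from tower_base_change[OF assms] obtain E' where E': "tower N F' E'" "E \<subseteq> E'"
    "\<forall>A. subfield A R \<and> E \<subseteq> A \<and> F' \<subseteq> A \<longrightarrow> E' \<subseteq> A" by (elim exE conjE)
  have i: "intermediate E'" "F' \<subseteq> E'" using tower_tamely_defectless[OF E'(1) assms(3,5)] by auto
  have c: "E \<union> F' \<subseteq> carrier R" using E'(2) i subfieldE(3)[of E' R] by blast
  have "E' = generate_field R (E \<union> F')"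
    using E' i by (intro generate_fieldI[OF c]) auto
  then show ?thesis using E'(1) by simp
qed

lemma tame_base_change:
  assumes L1: "finite_ext K L\<^sub>1" "tame K L\<^sub>1" and L2: "intermediate L\<^sub>2"
  defines "L \<equiv> generate_field R (L\<^sub>1 \<union> L\<^sub>2)"
  shows "finite_ext L\<^sub>2 L" "tame L\<^sub>2 L"
proof -
  have "tamely_defectless K L\<^sub>1" using tame_iff_tamely_defectless[OF intermediate_base L1(1)] L1(2) by simp
  then have t: "tower tame_exponents K L\<^sub>1" by (rule tamely_defectless_tower[OF intermediate_base])
  have "tower tame_exponents L\<^sub>2 L"
    unfolding L_def using tower_compositum[OF t intermediate_base L2 _ subset_refl] L2 by simp
  then have d: "tamely_defectless L\<^sub>2 L" using tower_tamely_defectless[OF _ L2 subset_refl] by blast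
  then show fe: "finite_ext L\<^sub>2 L" by (simp add: tamely_defectless_def)
  show "tame L\<^sub>2 L" using tame_iff_tamely_defectless[OF L2 fe] d by simp
qed

lemma unramified_base_change_iff:
  assumes L1: "finite_ext K L\<^sub>1" "tame K L\<^sub>1" and L2: "finite_ext K L\<^sub>2"
  defines "L \<equiv> generate_field R (L\<^sub>1 \<union> L\<^sub>2)" and "L\<^sub>2' \<equiv> L\<^sub>2 \<inter> ramification_field"
  defines "L' \<equiv> generate_field R (L\<^sub>1 \<union> L\<^sub>2')"
  shows "(finite_ext L\<^sub>2 L \<and> tame L\<^sub>2 L) \<and> (finite_ext L\<^sub>2' L' \<and> tame L\<^sub>2' L') \<and>
    (unramified L\<^sub>2 L \<longleftrightarrow> unramified L\<^sub>2' L')"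
proof -
  note D1 = finite_extD[OF L1(1)] and D2 = finite_extD[OF L2]
  have i2: "intermediate L\<^sub>2" using D2 by simp
  have s2': "subfield L\<^sub>2' R" unfolding L\<^sub>2'_def using subfield_Int[OF D2(2) ramification_field_subfield(1)] .
  have i2': "intermediate L\<^sub>2'" and sub2: "L\<^sub>2' \<subseteq> L\<^sub>2"
    using s2' D2(3) ramification_field_subfield(2) by (auto simp: L\<^sub>2'_def)
  note B = tame_base_change[OF L1 i2, folded L_def] and B' = tame_base_change[OF L1 i2', folded L'_def]
  have c: "L\<^sub>1 \<union> L\<^sub>2 \<subseteq> carrier R" using D1(6) D2(6) by simp
  have sL: "subfield L R" unfolding L_def by (rule generate_field_is_subfield[OF c])
  have iL: "L\<^sub>1 \<union> L\<^sub>2 \<subseteq> L" unfolding L_def by (auto intro: generate_field.incl)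
  have iL': "L\<^sub>1 \<union> L\<^sub>2' \<subseteq> L'" unfolding L'_def by (auto intro: generate_field.incl)
  have L'L: "L' \<subseteq> L" unfolding L'_def L_def using mono_generate_field[OF _ c] sub2 by blast
  have "unramified L\<^sub>2 L \<longleftrightarrow> unramified L\<^sub>2' L'"
  proof
    (* A value of \<open>L'\<close> is also one of \<open>L\<^sub>2\<close>, and torsion prime to \<open>p\<close> modulo the values of \<open>L\<^sub>2'\<close>. *)
    assume "unramified L\<^sub>2 L"
    then have v: "value_group L = value_group L\<^sub>2" by (simp add: unramified_def)
    note D' = finite_extD[OF B'(1)]
    let ?e = "ramification_index L\<^sub>2' L'"
    have tn: "?e \<in> tame_exponents"
      using tame_iff_tamely_defectless[OF i2' B'(1)] B'(2) by (simp add: tamely_defectless_def)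
    have "g \<in> value_group L\<^sub>2'" if g: "g \<in> value_group L'" for g
    proof -
      obtain a where a: "a \<in> L'" "a \<noteq> \<zero>" "\<nu> a = g" using value_group_mem[OF g] by metis
      have ae: "\<nu> (a [^] ?e) \<in> value_group L\<^sub>2'"
        using ramification_index_torsion[OF D'(1-3) fundamental_inequality(1)[OF B'(1)]] a by simp
      have "g \<in> value_group L\<^sub>2" using g value_group_mono[OF L'L] v by blast
      then obtain b where b: "b \<in> L\<^sub>2" "b \<noteq> \<zero>" "\<nu> b = g" using value_group_mem by metis
      have ac: "a \<in> carrier R" and bc: "b \<in> carrier R" using a b D'(6) D2(6) by auto
      have "\<nu> (b [^] n) = \<nu> (a [^] n)" for n :: nat
        using value_pow_mult[OF ac a(2), of _ 1] value_pow_mult[OF bc b(2), of _ 1] ac bc a(3) b(3)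
        by (induction n) auto
      then have "\<nu> (b [^] ?e) \<in> value_group L\<^sub>2'" using ae by simp
      then show ?thesis
        using value_group_ramification_field[OF L2 b(1,2) tn] b(3) by (simp add: L\<^sub>2'_def)
    qed
    then have "value_group L' = value_group L\<^sub>2'" using value_group_mono[OF D'(3)] by blast
    then show "unramified L\<^sub>2' L'" using B'(2) by (simp add: unramified_def)
  next
    (* The unramified tower from \<open>L\<^sub>2'\<close> to \<open>L'\<close> becomes one from \<open>L\<^sub>2\<close> to \<open>L\<close>. *)
    assume "unramified L\<^sub>2' L'"
    then have v: "value_group L' = value_group L\<^sub>2'" by (simp add: unramified_def)
    have d: "tamely_defectless L\<^sub>2' L'" using tame_iff_tamely_defectless[OF i2' B'(1)] B'(2) by simp
    have t: "tower {} L\<^sub>2 (generate_field R (L' \<union> L\<^sub>2))"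
      using tower_compositum[OF unramified_defectless_tower[OF i2' d v] i2' i2 sub2] by simp
    have "generate_field R (L' \<union> L\<^sub>2) = L"
    proof
      have c2: "L' \<union> L\<^sub>2 \<subseteq> carrier R" using finite_extD(6)[OF B'(1)] D2(6) by simp
      show "generate_field R (L' \<union> L\<^sub>2) \<subseteq> L"
        using generate_field_min_subfield1[OF c2 sL] L'L iL by simp
      show "L \<subseteq> generate_field R (L' \<union> L\<^sub>2)"
        unfolding L_def using mono_generate_field[OF _ c2, of "L\<^sub>1 \<union> L\<^sub>2"] iL' by blast
    qed
    then have "value_group L = value_group L\<^sub>2" using tower_tamely_defectless[OF t i2] by simp
    then show "unramified L\<^sub>2 L" using B(2) by (simp add: unramified_def)
  qed
  then show ?thesis using B B' by blast
qed

end

theorem lemma1p3: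
  fixes R :: "('a, 'b) ring_scheme" (structure)
    and K L\<^sub>1 L\<^sub>2 L L\<^sub>2' L' :: "'a set"
    and \<nu> :: "'a \<Rightarrow> 'g::linordered_ab_group_add"
  assumes "henselian R K \<nu>"
    and "perfect_field
      ((valued_field.residue_ring R \<nu>)\<lparr>carrier := valued_field.residue_field R \<nu> K\<rparr>)"
    and "ring.finite_ext R K L\<^sub>1" and "henselian.tame R \<nu> K L\<^sub>1"
    and "ring.finite_ext R K L\<^sub>2"
    and "L = generate_field R (L\<^sub>1 \<union> L\<^sub>2)"
    and "L\<^sub>2' = L\<^sub>2 \<inter> henselian.ramification_field R K \<nu>"
    and "L' = generate_field R (L\<^sub>1 \<union> L\<^sub>2')"
  shows "(ring.finite_ext R L\<^sub>2 L \<and> henselian.tame R \<nu> L\<^sub>2 L) \<and>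
    (ring.finite_ext R L\<^sub>2' L' \<and> henselian.tame R \<nu> L\<^sub>2' L') \<and>
    (henselian.unramified R \<nu> L\<^sub>2 L \<longleftrightarrow> henselian.unramified R \<nu> L\<^sub>2' L')"
proof -
  interpret henselian R K \<nu> by (rule assms(1))
  let ?k = "residue_ring\<lparr>carrier := residue_field K\<rparr>"
  have sK: "subring (residue_field K) residue_ring"
    using subfieldE(1)[OF residue_field_subfield] intermediate_base by blast
  have ch: "field_char ?k = field_char residue_ring" by (rule k.field_char_subring[OF sK])
  have pw: "x [^]\<^bsub>?k\<^esub> n = x [^]\<^bsub>residue_ring\<^esub> n" for x and n :: nat
    by (simp add: nat_pow_def)
  interpret perfect_henselian R K \<nu>
    using assms(2) unfolding perfect_field_def ch pw by unfold_locales simp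
  show ?thesis
    unfolding assms(6-8) by (rule unramified_base_change_iff[OF assms(3-5)])
qed

end
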